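(* Let $X$ be a Polish space, $E$ an analytic equivalence relation on $X$, and $(E_n)_{n\in\mathbb N}$ a sequence of potentially $F_\sigma$ subequivalence relations of $E$. Then exactly one of the following holds: (1) there is a cover $(B_n)_{n\in\mathbb N}$ of $X$ such that, for every $n$, $B_n$ is an $E_n$-invariant Borel set on which $E$ has countable index over $E_n$; (2) there is a continuous map $\phi\colon(2^{\mathbb N})^{\mathbb N}\to X$ which is a homomorphism from $\mathbb{E}_1$ to $E$ and, for every $n\in\mathbb N$, a homomorphism from the complement of $F_0^n$ to the complement of $\bigcup_{i\le n}E_i$. Moreover, if $E=\bigcup_nE_n$, then the map $\phi$ in (2) is an embedding of $\mathbb{E}_1$ into $E$.
   Context: For $n\in\mathbb N$, $F_0^n$ is the equivalence relation on $(2^{\mathbb N})^{\mathbb N}$ given by $x\mathrel{F_0^n}y\iff\forall l\ge n\ x(l)=y(l)$, and $\mathbb{E}_1=\bigcup_nF_0^n$. A homomorphism from $R$ to $S$ is a map $\phi$ with $(\phi\times\phi)[R]\subseteq S$; an embedding is an injective map $\phi$ with $x\mathrel{R}y\iff\phi(x)\mathrel{S}\phi(y)$. $E$ has countable index over $E_n$ on $B$ if every $(E\restriction B)$-class is a countable union of $(E_n\restriction B)$-classes. A relation on a Polish space is potentially $F_\sigma$ if it is $F_\sigma$ in some Polish topology with the same Borel sets. *)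

theory Defs
  imports "HOL-Analysis.Analysis"
begin

section \<open>Polish spaces and descriptive complexity\<close>

text \<open>Polish spaces are abstract topologies rather than instances of the class
  \<open>polish_space\<close>: the latter excludes the empty space and fixes a single topology on the type,
  whereas potential complexity quantifies over topologies.\<close>

definition polish :: "'a topology \<Rightarrow> bool" where
  "polish X \<longleftrightarrow> completely_metrizable_space X \<and> separable_space X"

definition borel_sets_in :: "'a topology \<Rightarrow> 'a set set" where
  "borel_sets_in X = sigma_sets (topspace X) {U. openin X U}"

text \<open>Analytic sets are the continuous images of closed subsets of the Baire space. Both \<open>nat\<close>
  and \<open>bool\<close> carry the discrete topology, so that \<open>nat \<Rightarrow> nat\<close> and \<open>nat \<Rightarrow> bool\<close> are the Baire and
  the Cantor space. Allowing all closed subsets makes the empty set analytic.\<close>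

definition analytic_in :: "'a topology \<Rightarrow> 'a set \<Rightarrow> bool" where
  "analytic_in X A \<longleftrightarrow>
     (\<exists>(C :: (nat \<Rightarrow> nat) set) f. closed C \<and> continuous_map (top_of_set C) X f \<and> f ` C = A)"

text \<open>The change of topology takes place on \<open>X\<close>, and the relation is \<open>F\<^sub>\<sigma>\<close> in the square of the new
  topology. Equality of the Borel sets forces \<open>topspace Y = topspace X\<close>.\<close>

definition potentially_fsigma :: "'a topology \<Rightarrow> 'a rel \<Rightarrow> bool" where
  "potentially_fsigma X R \<longleftrightarrow>
     (\<exists>Y. polish Y \<and> borel_sets_in Y = borel_sets_in X \<and> fsigma_in (prod_topology Y Y) R)"


section \<open>Relations\<close>

definition restrict_rel :: "'a rel \<Rightarrow> 'a set \<Rightarrow> 'a rel" where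
  "restrict_rel R B = R \<inter> B \<times> B"

definition invariant_set :: "'a rel \<Rightarrow> 'a set \<Rightarrow> bool" where
  "invariant_set R B \<longleftrightarrow> (\<forall>x y. x \<in> B \<longrightarrow> (x, y) \<in> R \<longrightarrow> y \<in> B)"

definition countable_index_on :: "'a rel \<Rightarrow> 'a rel \<Rightarrow> 'a set \<Rightarrow> bool" where
  "countable_index_on E F B \<longleftrightarrow>
     (\<forall>C \<in> B // restrict_rel E B. \<exists>\<D>. countable \<D> \<and> \<D> \<subseteq> B // restrict_rel F B \<and> C = \<Union>\<D>)"

definition homomorphism :: "('a \<Rightarrow> 'b) \<Rightarrow> 'a rel \<Rightarrow> 'b rel \<Rightarrow> bool" where
  "homomorphism \<phi> R S \<longleftrightarrow> map_prod \<phi> \<phi> ` R \<subseteq> S"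

text \<open>The domain of \<open>R\<close> is meant to be all of the type \<open>'a\<close>.\<close>

definition rel_embedding :: "('a \<Rightarrow> 'b) \<Rightarrow> 'a rel \<Rightarrow> 'b rel \<Rightarrow> bool" where
  "rel_embedding \<phi> R S \<longleftrightarrow> inj \<phi> \<and> (\<forall>x y. (x, y) \<in> R \<longleftrightarrow> (\<phi> x, \<phi> y) \<in> S)"

definition F0 :: "nat \<Rightarrow> (nat \<Rightarrow> nat \<Rightarrow> bool) rel" where
  "F0 n = {(x, y). \<forall>l\<ge>n. x l = y l}"

definition E1 :: "(nat \<Rightarrow> nat \<Rightarrow> bool) rel" where
  "E1 = (\<Union>n. F0 n)"

end

theory Submission
  imports Defs "HOL-Probability.Probability"
begin

text \<open>Coding the points of \<open>X\<close> by elements of the Baire space, together with witnesses for the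
  members of countably many Borel sets, makes every \<open>E\<^sub>k\<close> an \<open>F\<^sub>\<sigma>\<close> relation on the Baire space. There,
  \<open>\<phi>\<close> is constructed by a fusion argument. Finite configurations approximate the values of \<open>\<phi>\<close>, at
  level \<open>0\<close>, and auxiliary hubs at the levels \<open>n > 0\<close>, which depend on fewer and fewer coordinates
  of the argument; consecutive levels are linked by witnesses of \<open>E\<close>. Two arguments that agree from
  some coordinate on share a hub, so the limit is a homomorphism from \<open>E1\<close> to \<open>E\<close>.

  The sets of configurations that are kept are large: they remain nonempty after removing, for
  every \<open>k\<close>, countably many Borel families of \<open>E\<^sub>k\<close>-classes indexed by a suitable hub, and every set
  on which the first alternative holds. Largeness allows two copies of a configuration to be made
  \<open>E\<^sub>k\<close>-inequivalent above a common hub. A large set always admits a new hub on top, since the first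
  alternative fails. The alternatives exclude each other by Fubini's theorem.\<close>

section \<open>Analytic sets\<close>

text \<open>Two demands pull against each other: a shared hub must hide the coordinates in which
  related arguments differ, while two values can be made inequivalent only by changing one leaf
  under a hub that leaves its \<open>Ek k\<close>-class open. Each index \<open>k\<close> and leaf
  \<open>l\<close> therefore get a critical level \<open>n\<close>: the point at level
  \<open>n\<close> determines the \<open>Ek k\<close>-class of the value at \<open>l\<close>,
  whereas the point at level \<open>n + 1\<close> does not, not even up to countably many invariant
  Borel choices. Leaves that are already distinguished at level \<open>n\<close> can be separated
  for \<open>Ek k\<close>. Index \<open>k\<close> is treated once, at stage \<open>k\<close>, where
  each of the \<open>2 ^ k\<close> leaves costs one new level, and later copies inherit the
  decision. So all critical levels of \<open>k\<close> are at most \<open>2 ^ (k + 1) - 2\<close>,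
  uniformly in the stage. A coordinate \<open>c\<close> has to be visible at the critical levels of
  every \<open>k \<le> c\<close>, but at finitely many levels only, so that hubs can forget it; this
  is where \<open>lam\<close> comes from.\<close>

type_synonym baire = "nat \<Rightarrow> nat"

section \<open>Cylinders and continuity on sequence spaces\<close>

definition cyl :: "(nat \<Rightarrow> 'b) \<Rightarrow> nat \<Rightarrow> (nat \<Rightarrow> 'b) set" where
  "cyl x n = {y. \<forall>i<n. y i = x i}"

lemma mem_cyl_self [simp]: "x \<in> cyl x n"
  by (simp add: cyl_def)

lemma cyl_antimono: "m \<le> n \<Longrightarrow> cyl x n \<subseteq> cyl x m"
  by (auto simp: cyl_def)

lemma open_cyl [simp]: "open (cyl (x :: nat \<Rightarrow> 'b::discrete_topology) n)"
proof -
  have "open {f. \<forall>i\<in>{..<n}. f (id i) \<in> {x i}}"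
    by (rule product_topology_basis') (auto intro: discrete_topology_class.open_discrete)
  then show ?thesis by (simp add: cyl_def lessThan_def)
qed

lemma closed_cyl [simp]: "closed (cyl (x :: nat \<Rightarrow> 'b::discrete_topology) n)"
proof -
  have "- cyl x n = (\<Union>y\<in>- cyl x n. cyl y n)"
    by (fastforce simp: cyl_def)
  then show ?thesis
    by (metis (no_types, lifting) closed_open open_UN open_cyl)
qed

lemma open_contains_cyl:
  fixes x :: "nat \<Rightarrow> 'b::topological_space"
  assumes "open S" "x \<in> S"
  obtains n where "cyl x n \<subseteq> S"
proof -
  have "openin (product_topology (\<lambda>i. euclidean) UNIV) S"
    using assms(1) by (simp add: euclidean_product_topology)
  then obtain U where U: "finite {i. U i \<noteq> UNIV}" "x \<in> Pi\<^sub>E UNIV U" "Pi\<^sub>E UNIV U \<subseteq> S"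
    using assms(2) unfolding openin_product_topology_alt by (auto dest!: bspec[where x = x])
  obtain n where n: "\<And>i. i \<in> {i. U i \<noteq> UNIV} \<Longrightarrow> i < n"
    using U(1) unfolding finite_nat_set_iff_bounded by blast
  have "cyl x n \<subseteq> Pi\<^sub>E UNIV U"
  proof
    fix y assume y: "y \<in> cyl x n"
    have "y i \<in> U i" for i
    proof (cases "i < n")
      case True
      then show ?thesis using y U(2) by (auto simp: cyl_def PiE_iff)
    next
      case False
      then have "U i = UNIV" using n by blast
      then show ?thesis by simp
    qed
    then show "y \<in> Pi\<^sub>E UNIV U" by auto
  qed
  then show ?thesis using U(3) by (intro that[of n]) simp
qed

lemma continuous_map_baireI:
  fixes f :: "(nat \<Rightarrow> 'b::discrete_topology) \<Rightarrow> 'a"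
  assumes "\<And>z. f z \<in> topspace T"
    and "\<And>z U. openin T U \<Longrightarrow> f z \<in> U \<Longrightarrow> \<exists>n. f ` cyl z n \<subseteq> U"
  shows "continuous_map euclidean T f"
  unfolding continuous_map_def
proof (intro conjI allI impI)
  show "f \<in> topspace euclidean \<rightarrow> topspace T" using assms(1) by auto
next
  fix U assume U: "openin T U"
  have "open {x. f x \<in> U}"
    unfolding open_subopen[of "{x. f x \<in> U}"]
  proof
    fix x assume "x \<in> {x. f x \<in> U}"
    then obtain n where "f ` cyl x n \<subseteq> U" using assms(2)[OF U] by blast
    then show "\<exists>V. open V \<and> x \<in> V \<and> V \<subseteq> {x. f x \<in> U}"
      by (intro exI[of _ "cyl x n"]) auto
  qed
  then show "openin euclidean {x \<in> topspace euclidean. f x \<in> U}" by simp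
qed

lemma continuous_map_baireD:
  fixes f :: "(nat \<Rightarrow> 'b::topological_space) \<Rightarrow> 'a"
  assumes "continuous_map euclidean T f" "openin T U" "f z \<in> U"
  shows "\<exists>n. f ` cyl z n \<subseteq> U"
proof -
  have "open {x. f x \<in> U}"
    using openin_continuous_map_preimage[OF assms(1,2)] by simp
  then obtain n where "cyl z n \<subseteq> {x. f x \<in> U}"
    using open_contains_cyl[of "{x. f x \<in> U}" z] assms(3) by auto
  then show ?thesis by (intro exI[of _ n]) auto
qed

section \<open>Polish spaces as images of the Baire space\<close>

lemma polish_image_baire:
  assumes "polish T" "topspace T \<noteq> {}"
  obtains f :: "baire \<Rightarrow> 'a" where "continuous_map euclidean T f" "range f = topspace T"
proof -
  obtain M d where Md: "Metric_space M d" "Metric_space.mcomplete M d" "T = Metric_space.mtopology M d"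
    using assms(1) unfolding polish_def completely_metrizable_space_def by blast
  interpret Metric_space M d by fact
  have T: "T = mtopology" and compl: "mcomplete" using Md by auto
  have [simp]: "topspace T = M" using T by simp
  obtain C where C: "countable C" "C \<subseteq> M" "mtopology closure_of C = M"
    using assms(1) T unfolding polish_def separable_space_def by auto
  have "C \<noteq> {}" using C(3) assms(2) by auto
  define e where "e = from_nat_into C"
  have e: "range e = C" using C(1) \<open>C \<noteq> {}\<close> unfolding e_def by (rule range_from_nat_into[rotated])
  have eM: "e i \<in> M" for i using e C(2) by blast
  have dense: "\<exists>i. d (e i) x < r" if r: "x \<in> M" "r > 0" for x r
  proof -
    have "x \<in> mtopology closure_of C" using that C by simp
    then obtain y where "y \<in> C" "y \<in> mball x r" using r(2) unfolding metric_closure_of by blast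
    then show ?thesis using e by (metis commute imageE in_mball)
  qed
  \<comment> \<open>A proposed point is accepted only if it moves the sequence by less than
    \<open>(1/2)^n\<close>; otherwise the sequence stalls. So every \<open>z\<close> yields a Cauchy
    sequence and the limit map is total.\<close>
  define X where "X = (\<lambda>z::baire. rec_nat (e (z 0))
      (\<lambda>n x. if d x (e (z (Suc n))) < (1/2)^n then e (z (Suc n)) else x))"
  have X0: "X z 0 = e (z 0)" for z by (simp add: X_def)
  have XS: "X z (Suc n) = (if d (X z n) (e (z (Suc n))) < (1/2)^n then e (z (Suc n)) else X z n)" for z n
    by (simp add: X_def)
  have XM: "X z n \<in> M" for z n by (induction n) (auto simp: X0 XS eM)
  have step: "d (X z n) (X z (Suc n)) \<le> (1/2)^n" for z n
    using XM[of z n] by (auto simp: XS)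
  have dist: "d (X z n) (X z (n + k)) \<le> 2 * (1/2)^n - 2 * (1/2)^(n+k)" for z n k
  proof (induction k)
    case 0 then show ?case using XM by simp
  next
    case (Suc k)
    have "d (X z n) (X z (n + Suc k)) \<le> d (X z n) (X z (n+k)) + d (X z (n+k)) (X z (Suc (n+k)))"
      using triangle[OF XM XM XM] by simp
    also have "\<dots> \<le> 2 * (1/2)^n - 2 * (1/2)^(n+k) + (1/2)^(n+k)"
      using Suc step by (intro add_mono)
    finally show ?case by simp
  qed
  have dist': "d (X z n) (X z m) \<le> 2 * (1/2)^n" if "n \<le> m" for z n m
  proof -
    have "0 \<le> 2 * (1/2::real)^m" by simp
    moreover have "d (X z n) (X z m) \<le> 2 * (1/2)^n - 2 * (1/2)^m"
      using dist[of z n "m - n"] le_add_diff_inverse[OF that] by metis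
    ultimately show ?thesis by linarith
  qed
  have small: "\<exists>n. 4 * (1/2)^n < r" if r: "r > 0" for r :: real
  proof -
    obtain n where "(1/2)^n < r/4" using r real_arch_pow_inv[of "r/4" "1/2"] by auto
    then show ?thesis by (intro exI[of _ n]) simp
  qed
  have "MCauchy (X z)" for z
    unfolding MCauchy_def
  proof (intro conjI allI impI)
    show "range (X z) \<subseteq> M" using XM by auto
    fix r :: real assume "r > 0"
    then obtain N where N: "4 * (1/2)^N < r" using small by blast
    have "d (X z n) (X z n') < r" if "N \<le> n" "N \<le> n'" for n n'
    proof -
      have "d (X z n) (X z n') \<le> d (X z N) (X z n) + d (X z N) (X z n')"
        using triangle[OF XM[of z n] XM[of z N] XM[of z n']] commute[of "X z n" "X z N"] by linarith
      then show ?thesis using dist'[OF that(1), of z] dist'[OF that(2), of z] N by linarith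
    qed
    then show "\<exists>N. \<forall>n n'. N \<le> n \<longrightarrow> N \<le> n' \<longrightarrow> d (X z n) (X z n') < r" by blast
  qed
  then have "\<exists>x. limitin mtopology (X z) x sequentially" for z
    using compl unfolding mcomplete_def by blast
  then obtain f where f: "\<And>z. limitin mtopology (X z) (f z) sequentially" by metis
  have fM: "f z \<in> M" for z using f[of z] by (simp add: limitin_metric)
  have fX: "d (X z n) (f z) \<le> 2 * (1/2)^n" for z n
  proof (rule field_le_epsilon)
    fix r :: real assume "r > 0"
    then obtain N where N: "\<And>m. m \<ge> N \<Longrightarrow> d (X z m) (f z) < r"
      using f[of z] unfolding limitin_metric eventually_sequentially by blast
    have "d (X z n) (f z) \<le> d (X z n) (X z (max n N)) + d (X z (max n N)) (f z)"
      using triangle XM fM by blast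
    then show "d (X z n) (f z) \<le> 2 * (1/2)^n + r"
      using N[of "max n N"] dist'[of n "max n N" z] by simp
  qed
  have loc: "X z' n = X z n" if "z' \<in> cyl z (Suc n)" for z z' n
    using that by (induction n) (auto simp: X0 XS cyl_def)
  have "continuous_map euclidean T f"
  proof (rule continuous_map_baireI)
    show "f z \<in> topspace T" for z using fM by simp
  next
    fix z U assume "openin T U" "f z \<in> U"
    then obtain r where r: "r > 0" "mball (f z) r \<subseteq> U"
      unfolding T openin_mtopology by blast
    obtain n where n: "4 * (1/2)^n < r" using small r by blast
    have "f z' \<in> U" if "z' \<in> cyl z (Suc n)" for z'
    proof -
      have "d (f z) (f z') \<le> d (X z n) (f z) + d (X z' n) (f z')"
        using triangle[OF fM[of z] XM[of z n] fM[of z']] loc[OF that] commute[of "f z" "X z n"] by simp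
      then have "d (f z) (f z') < r" using fX[of z n] fX[of z' n] n by linarith
      then show ?thesis using r fM by (auto simp: in_mball)
    qed
    then show "\<exists>n. f ` cyl z n \<subseteq> U" by blast
  qed
  moreover have "range f = topspace T"
  proof (intro equalityI subsetI)
    fix x assume "x \<in> topspace T"
    then have x: "x \<in> M" by simp
    \<comment> \<open>The extra factor \<open>1/2\<close> keeps consecutive choices within
      \<open>(1/2)^n\<close> of each other, so that none of them is rejected.\<close>
    have "\<forall>n. \<exists>i. d (e i) x < (1/2)^n / 2" by (intro allI dense[OF x]) simp
    then obtain z where z: "\<And>n. d (e (z n)) x < (1/2)^n / 2" by metis
    have Xz: "X z n = e (z n)" for n
    proof (induction n)
      case (Suc n)
      have "d (e (z n)) (e (z (Suc n))) \<le> d (e (z n)) x + d (e (z (Suc n))) x"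
        using triangle[OF eM[of "z n"] x eM[of "z (Suc n)"]] commute[of x "e (z (Suc n))"] by linarith
      also have "\<dots> < (1/2)^n / 2 + (1/2)^(Suc n) / 2" using z by (intro add_strict_mono)
      also have "\<dots> \<le> (1/2)^n" by simp
      finally show ?case by (simp add: XS Suc)
    qed (simp add: X0)
    have "limitin mtopology (X z) x sequentially"
      unfolding limitin_metric
    proof (intro conjI allI impI x)
      fix r :: real assume "r > 0"
      then obtain N where N: "4 * (1/2)^N < r" using small by blast
      have "X z n \<in> M \<and> d (X z n) x < r" if "n \<ge> N" for n
      proof -
        have "(1/2::real)^n \<le> (1/2)^N" using that by (intro power_decreasing) auto
        moreover have "(0::real) < (1/2)^N" by simp
        ultimately have "d (e (z n)) x < r" using z[of n] N nonneg[of "e (z n)" x] by argo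
        then show ?thesis using XM[of z n] Xz[of n] by simp
      qed
      then show "\<forall>\<^sub>F n in sequentially. X z n \<in> M \<and> d (X z n) x < r"
        unfolding eventually_sequentially by blast
    qed
    then have "f z = x" using f limitin_metric_unique by (metis trivial_limit_sequentially)
    then show "x \<in> range f" by blast
  qed (use fM in auto)
  ultimately show ?thesis using that by blast
qed

section \<open>Standard Polish spaces and second countability\<close>

lemma polish_euclidean:
  assumes "completely_metrizable_space (euclidean :: 'a::second_countable_topology topology)"
  shows "polish (euclidean :: 'a topology)"
proof -
  obtain D :: "'a set" where D: "countable D" "\<And>X. open X \<Longrightarrow> X \<noteq> {} \<Longrightarrow> \<exists>d\<in>D. d \<in> X"
    using countable_dense_setE by blast
  have "\<exists>y\<in>D. y \<in> T" if "x \<in> T" "open T" for x T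
    using D(2)[of T] that by blast
  then have "euclidean closure_of D = UNIV"
    unfolding set_eq_iff in_closure_of by simp blast
  then show ?thesis
    unfolding polish_def separable_space_def using assms D(1) by auto
qed

lemma completely_metrizable_fun:
  assumes "completely_metrizable_space (euclidean :: 'b::topological_space topology)"
  shows "completely_metrizable_space (euclidean :: ('a::countable \<Rightarrow> 'b) topology)"
proof -
  have "completely_metrizable_space (product_topology (\<lambda>i::'a. euclidean :: 'b topology) UNIV)"
    unfolding completely_metrizable_space_product_topology using assms by auto
  then show ?thesis by (simp add: euclidean_product_topology)
qed

lemma completely_metrizable_prod:
  assumes "completely_metrizable_space (euclidean :: 'a::topological_space topology)"
    and "completely_metrizable_space (euclidean :: 'b::topological_space topology)"
  shows "completely_metrizable_space (euclidean :: ('a \<times> 'b) topology)"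
  using assms completely_metrizable_space_prod_topology[of "euclidean :: 'a topology" "euclidean :: 'b topology"]
  by simp

lemma completely_metrizable_discrete:
  "completely_metrizable_space (euclidean :: 'a::discrete_topology topology)"
proof -
  have "(euclidean :: 'a topology) = discrete_topology UNIV"
    by (simp add: topology_eq discrete_topology_class.open_discrete)
  then show ?thesis by (simp add: completely_metrizable_space_discrete_topology)
qed

lemma completely_metrizable_baire: "completely_metrizable_space (euclidean :: baire topology)"
  by (intro completely_metrizable_fun completely_metrizable_discrete)

lemma polish_second_countable:
  assumes "polish T"
  shows "second_countable T"
proof -
  obtain M d where Md: "Metric_space M d" "T = Metric_space.mtopology M d"
    using assms unfolding polish_def completely_metrizable_space_def by blast
  interpret Metric_space M d by fact
  obtain C where C: "countable C" "C \<subseteq> M" "mtopology closure_of C = M"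
    using assms Md(2) unfolding polish_def separable_space_def by auto
  define \<B> where "\<B> = (\<lambda>(c, n::nat). mball c (inverse (Suc n))) ` (C \<times> UNIV)"
  show ?thesis unfolding second_countable_def
  proof (intro exI[of _ \<B>] conjI allI impI ballI)
    show "countable \<B>" unfolding \<B>_def using C(1) by auto
    show "openin T V" if "V \<in> \<B>" for V
      using that by (auto simp: \<B>_def Md(2))
  next
    fix U x assume U: "openin T U \<and> x \<in> U"
    then obtain r where r: "r > 0" "mball x r \<subseteq> U"
      unfolding Md(2) openin_mtopology by blast
    have xM: "x \<in> M" using U openin_subset[of T U] Md(2) by auto
    obtain n where n: "inverse (Suc n) < r / 2" using reals_Archimedean[of "r/2"] r by auto
    have "x \<in> mtopology closure_of C" using xM C by simp
    then obtain c where c: "c \<in> C" "c \<in> mball x (inverse (Suc n))"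
      unfolding metric_closure_of by (auto dest!: spec[of _ "inverse (Suc n)"])
    have "mball c (inverse (Suc n)) \<subseteq> mball x r"
    proof
      fix y assume y: "y \<in> mball c (inverse (Suc n))"
      have "d x y \<le> d x c + d c y" using triangle[of x c y] xM c y by (auto simp: in_mball)
      also have "\<dots> < inverse (Suc n) + inverse (Suc n)"
        using c y by (intro add_strict_mono) (auto simp: in_mball)
      finally show "y \<in> mball x r" using n xM y by (auto simp: in_mball)
    qed
    moreover have "x \<in> mball c (inverse (Suc n))" using c by (auto simp: in_mball commute)
    moreover have "mball c (inverse (Suc n)) \<in> \<B>" unfolding \<B>_def using c(1) by auto
    ultimately show "\<exists>V\<in>\<B>. x \<in> V \<and> V \<subseteq> U" using r(2) by blast
  qed
qed

lemma polish_subtopology: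
  assumes "polish T" "closedin T S \<or> openin T S"
  shows "polish (subtopology T S)"
  unfolding polish_def
proof
  show "completely_metrizable_space (subtopology T S)"
    using assms completely_metrizable_space_closedin[of T S] completely_metrizable_space_openin[of T S]
    unfolding polish_def by metis
  show "separable_space (subtopology T S)"
    by (intro second_countable_imp_separable_space second_countable_subtopology
        polish_second_countable assms(1))
qed

section \<open>Closure properties of analytic sets\<close>

definition analytic :: "'a topology \<Rightarrow> 'a set \<Rightarrow> bool" where
  "analytic T A \<longleftrightarrow> A = {} \<or> (\<exists>f :: baire \<Rightarrow> 'a. continuous_map euclidean T f \<and> range f = A)"

lemma analytic_empty [simp]: "analytic T {}"
  by (simp add: analytic_def)

lemma analyticI: "continuous_map euclidean T f \<Longrightarrow> analytic T (range (f :: baire \<Rightarrow> 'a))"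
  by (auto simp: analytic_def)

lemma analytic_polish_image:
  assumes "polish S" "continuous_map S T f"
  shows "analytic T (f ` topspace S)"
proof (cases "topspace S = {}")
  case False
  then obtain g :: "baire \<Rightarrow> _" where g: "continuous_map euclidean S g" "range g = topspace S"
    using polish_image_baire assms(1) by metis
  have "continuous_map euclidean T (f \<circ> g)"
    using g(1) assms(2) by (rule continuous_map_compose)
  then have "analytic T (range (f \<circ> g))" by (rule analyticI)
  then show ?thesis using g(2) by (metis image_comp)
qed simp

lemma analytic_continuous_image:
  assumes "analytic S A" "continuous_map S T f"
  shows "analytic T (f ` A)"
  using assms unfolding analytic_def
  by (metis (no_types, opaque_lifting) continuous_map_compose image_comp image_empty)

lemma analytic_closed_or_open:
  assumes "polish T" "closedin T S \<or> openin T S"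
  shows "analytic T S"
proof -
  have "S \<subseteq> topspace T" using assms(2) closedin_subset openin_subset by blast
  moreover have "analytic T (id ` topspace (subtopology T S))"
    by (intro analytic_polish_image[OF polish_subtopology[OF assms]])
      (simp add: continuous_map_from_subtopology)
  ultimately show ?thesis by (simp add: Int_absorb1)
qed

lemma analytic_UN:
  assumes "\<And>n::nat. analytic T (A n)"
  shows "analytic T (\<Union>n. A n)"
proof (cases "\<forall>n. A n = {}")
  case False
  then obtain n0 where n0: "A n0 \<noteq> {}" by blast
  \<comment> \<open>Empty pieces are replaced by the nonempty piece \<open>A n0\<close>, so that the
    first digit can select any piece.\<close>
  define B where "B n = (if A n = {} then A n0 else A n)" for n
  have B: "(\<Union>n. A n) = (\<Union>n. B n)" using n0 by (auto simp: B_def split: if_splits)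
  have "\<exists>f :: baire \<Rightarrow> 'a. continuous_map euclidean T f \<and> range f = B n" for n
    using assms[of n] assms[of n0] n0 unfolding analytic_def B_def by auto
  then obtain f :: "nat \<Rightarrow> baire \<Rightarrow> 'a" where
    f: "\<And>n. continuous_map euclidean T (f n)" "\<And>n. range (f n) = B n" by metis
  define g where "g z = f (z 0) (\<lambda>n. z (Suc n))" for z :: baire
  have "continuous_map euclidean T g"
  proof (rule continuous_map_baireI)
    show "g z \<in> topspace T" for z
      using f(1)[of "z 0"] unfolding g_def continuous_map_def by auto
  next
    fix z U assume "openin T U" "g z \<in> U"
    then obtain n where n: "f (z 0) ` cyl (\<lambda>n. z (Suc n)) n \<subseteq> U"
      using continuous_map_baireD[OF f(1)[of "z 0"], of U] unfolding g_def by metis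
    have "g z' \<in> U" if "z' \<in> cyl z (Suc n)" for z'
    proof -
      have "z' 0 = z 0" "(\<lambda>n. z' (Suc n)) \<in> cyl (\<lambda>n. z (Suc n)) n"
        using that by (auto simp: cyl_def)
      then show ?thesis using n unfolding g_def by auto
    qed
    then show "\<exists>n. g ` cyl z n \<subseteq> U" by blast
  qed
  moreover have "range g = (\<Union>n. B n)"
  proof (intro equalityI subsetI)
    fix x assume "x \<in> (\<Union>n. B n)"
    then obtain n z where "x = f n z" using f(2) by blast
    then have "x = g (case_nat n z)" by (simp add: g_def)
    then show "x \<in> range g" by blast
  next
    fix x assume "x \<in> range g"
    then obtain z where "x = f (z 0) (\<lambda>n. z (Suc n))" unfolding g_def by blast
    then show "x \<in> (\<Union>n. B n)" using f(2)[of "z 0"] by blast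
  qed
  ultimately show ?thesis using B unfolding analytic_def by metis
qed simp

lemma analytic_INT:
  assumes "Hausdorff_space T" "\<And>n::nat. analytic T (A n)"
  shows "analytic T (\<Inter>n. A n)"
proof (cases "\<exists>n. A n = {}")
  case True
  then have "(\<Inter>n. A n) = {}" by auto
  then show ?thesis by simp
next
  case False
  then obtain f :: "nat \<Rightarrow> baire \<Rightarrow> 'a" where
    f: "\<And>n. continuous_map euclidean T (f n)" "\<And>n. range (f n) = A n"
    using assms(2) unfolding analytic_def by metis
  \<comment> \<open>The fibre product of the parametrisations, closed because \<open>T\<close> is
    Hausdorff.\<close>
  define C where "C = (\<Inter>n. {z :: nat \<Rightarrow> baire. f n (z n) = f 0 (z 0)})"
  have co: "continuous_map euclidean T (\<lambda>z::nat \<Rightarrow> baire. f n (z n))" for n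
    using continuous_map_compose[OF _ f(1), of euclidean "\<lambda>z. z n" n] by (simp add: o_def)
  have "closed C" unfolding C_def
  proof (intro closed_INT ballI)
    fix n show "closed {z :: nat \<Rightarrow> baire. f n (z n) = f 0 (z 0)}"
      using closedin_continuous_maps_eq[OF assms(1) co[of n] co[of 0]] by simp
  qed
  then have "polish (top_of_set C)"
    by (intro polish_subtopology polish_euclidean completely_metrizable_fun
        completely_metrizable_baire) simp
  then have "analytic T ((\<lambda>z. f 0 (z 0)) ` topspace (top_of_set C))"
    by (rule analytic_polish_image) (simp add: co continuous_map_from_subtopology)
  also have "(\<lambda>z. f 0 (z 0)) ` topspace (top_of_set C) = (\<Inter>n. A n)"
  proof (intro equalityI subsetI)
    fix x assume "x \<in> (\<lambda>z. f 0 (z 0)) ` topspace (top_of_set C)"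
    then obtain z where "z \<in> C" "x = f 0 (z 0)" by auto
    then have "f n (z n) = x" for n unfolding C_def by (simp; metis)
    then show "x \<in> (\<Inter>n. A n)" using f(2) by (metis INT_I rangeI)
  next
    fix x assume "x \<in> (\<Inter>n. A n)"
    then have "\<forall>n. \<exists>y. f n y = x" using f(2) by (metis INT_E UNIV_I imageE)
    then obtain z where "\<And>n. f n (z n) = x" by metis
    then show "x \<in> (\<lambda>z. f 0 (z 0)) ` topspace (top_of_set C)"
      by (intro image_eqI[of _ _ z]) (auto simp: C_def)
  qed
  finally show ?thesis .
qed

lemma analytic_Int:
  assumes "Hausdorff_space T" "analytic T A" "analytic T B"
  shows "analytic T (A \<inter> B)"
proof -
  have "A \<inter> B = (\<Inter>n::nat. if n = 0 then A else B)"
    by (auto split: if_splits)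
  also have "analytic T \<dots>" by (rule analytic_INT) (use assms in auto)
  finally show ?thesis .
qed

lemma polish_Hausdorff: "polish T \<Longrightarrow> Hausdorff_space T"
  by (simp add: polish_def completely_metrizable_imp_metrizable_space metrizable_imp_Hausdorff_space)

lemma borel_imp_analytic:
  assumes "polish T" "A \<in> borel_sets_in T"
  shows "analytic T A"
proof -
  \<comment> \<open>The complement is carried along, since analyticity alone does not pass to
    complements.\<close>
  have "analytic T A \<and> analytic T (topspace T - A)"
    using assms(2) unfolding borel_sets_in_def
  proof (induction rule: sigma_sets.induct)
    case (Basic U)
    then show ?case using analytic_closed_or_open[OF assms(1)] by auto
  next
    case Empty
    then show ?case using analytic_closed_or_open[OF assms(1), of "topspace T"] by auto
  next
    case (Compl A)
    have "analytic T (topspace T \<inter> A)"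
      using Compl analytic_closed_or_open[OF assms(1), of "topspace T"]
        analytic_Int[OF polish_Hausdorff[OF assms(1)]] by blast
    moreover have "topspace T - (topspace T - A) = topspace T \<inter> A" by blast
    ultimately show ?case using Compl by simp
  next
    case (Union A)
    have "topspace T - (\<Union>n. A n) = (\<Inter>n. topspace T - A n)" by blast
    then show ?case using Union analytic_UN[of T A]
        analytic_INT[OF polish_Hausdorff[OF assms(1)], of "\<lambda>n. topspace T - A n"] by simp
  qed
  then show ?thesis ..
qed

lemma sigma_algebra_borel_sets_in: "sigma_algebra (topspace T) (borel_sets_in T)"
  unfolding borel_sets_in_def by (rule sigma_algebra_sigma_sets) (auto dest: openin_subset)

lemma borel_sets_in_euclidean: "borel_sets_in euclidean = sets borel"
  by (simp add: borel_sets_in_def borel_def)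

lemma openin_borel_sets_in: "openin T U \<Longrightarrow> U \<in> borel_sets_in T"
  by (simp add: borel_sets_in_def sigma_sets.Basic)

lemma borel_sets_in_subset: "A \<in> borel_sets_in T \<Longrightarrow> A \<subseteq> topspace T"
  using sigma_algebra_borel_sets_in[of T] unfolding sigma_algebra_iff2 by blast

lemma borel_sets_in_vimage:
  assumes "continuous_map S T f" "A \<in> borel_sets_in T"
  shows "{x \<in> topspace S. f x \<in> A} \<in> borel_sets_in S"
  using assms(2) unfolding borel_sets_in_def
proof (induction rule: sigma_sets.induct)
  case (Basic U)
  then show ?case using openin_continuous_map_preimage[OF assms(1)] by (auto intro: sigma_sets.Basic)
next
  case Empty
  then show ?case by (simp add: sigma_sets.Empty)
next
  case (Compl A)
  have "{x \<in> topspace S. f x \<in> topspace T - A} = topspace S - {x \<in> topspace S. f x \<in> A}"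
    using assms(1) by (auto simp: continuous_map_def)
  then show ?case using Compl by (simp add: sigma_sets.Compl)
next
  case (Union A)
  have "{x \<in> topspace S. f x \<in> (\<Union>i. A i)} = (\<Union>i. {x \<in> topspace S. f x \<in> A i})" by auto
  then show ?case using Union by (simp add: sigma_sets.Union)
qed

section \<open>Borel separation\<close>

definition borel_separated :: "'a topology \<Rightarrow> 'a set \<Rightarrow> 'a set \<Rightarrow> bool" where
  "borel_separated T A B \<longleftrightarrow> (\<exists>S\<in>borel_sets_in T. A \<subseteq> S \<and> S \<inter> B = {})"

lemma borel_separated_UN:
  assumes "\<And>(i::nat) (j::nat). borel_separated T (A i) (B j)"
  shows "borel_separated T (\<Union>i. A i) (\<Union>j. B j)"
proof -
  interpret sigma_algebra "topspace T" "borel_sets_in T" by (rule sigma_algebra_borel_sets_in)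
  obtain S where S: "\<And>i j. S i j \<in> borel_sets_in T" "\<And>i j. A i \<subseteq> S i j" "\<And>i j. S i j \<inter> B j = {}"
    using assms unfolding borel_separated_def by metis
  have "(\<Union>i. \<Inter>j. S i j) \<in> borel_sets_in T"
    by (rule countable_UN, rule image_subsetI, rule countable_INT) (use S(1) in auto)
  then show ?thesis unfolding borel_separated_def
    using S(2,3) by (intro bexI[of _ "\<Union>i. \<Inter>j. S i j"]) fastforce+
qed

lemma cyl_eq_UN: "cyl x n = (\<Union>i. cyl (x(n := i)) (Suc n))"
proof (intro equalityI subsetI)
  fix y assume "y \<in> cyl x n"
  then have "y \<in> cyl (x(n := y n)) (Suc n)" by (simp add: cyl_def)
  then show "y \<in> (\<Union>i. cyl (x(n := i)) (Suc n))" by blast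
next
  fix y assume "y \<in> (\<Union>i. cyl (x(n := i)) (Suc n))"
  then obtain i where "y \<in> cyl (x(n := i)) (Suc n)" by blast
  then show "y \<in> cyl x n" by (simp add: cyl_def)
qed

text \<open>If the images of two cylinders are not separated, neither are those of some pair of
  longer cylinders inside them. A branch of such pairs yields two points with distinct images, and
  disjoint neighbourhoods of these images separate a pair on the branch.\<close>

theorem lusin_separation:
  assumes T: "Hausdorff_space T" and A: "analytic T A" and B: "analytic T B" and disj: "A \<inter> B = {}"
  shows "borel_separated T A B"
proof (cases "A = {} \<or> B = {}")
  case True
  interpret sigma_algebra "topspace T" "borel_sets_in T" by (rule sigma_algebra_borel_sets_in)
  have "A \<subseteq> topspace T" using A unfolding analytic_def by (auto simp: continuous_map_def)
  then show ?thesis unfolding borel_separated_def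
    using True by (intro bexI[of _ "if A = {} then {} else topspace T"]) auto
next
  case False
  then obtain f g :: "baire \<Rightarrow> 'a" where f: "continuous_map euclidean T f" "range f = A"
    and g: "continuous_map euclidean T g" "range g = B"
    using A B unfolding analytic_def by blast
  define bad where "bad n p \<longleftrightarrow> \<not> borel_separated T (f ` cyl (fst p) n) (g ` cyl (snd p) n)"
    for n and p :: "baire \<times> baire"
  show ?thesis
  proof (rule ccontr)
    assume "\<not> borel_separated T A B"
    \<comment> \<open>Cylinders of length \<open>0\<close> are the whole space, so their base points
      are arbitrary.\<close>
    then have bad0: "bad 0 (undefined, undefined)"
      using f(2) g(2) by (simp add: bad_def cyl_def)
    have step: "\<exists>q. bad (Suc n) q \<and> fst q \<in> cyl (fst p) n \<and> snd q \<in> cyl (snd p) n"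
      if "bad n p" for n p
    proof (rule ccontr)
      assume neg: "\<not> ?thesis"
      have "borel_separated T (f ` cyl ((fst p)(n := i)) (Suc n)) (g ` cyl ((snd p)(n := j)) (Suc n))" for i j
      proof -
        have "(fst p)(n := i) \<in> cyl (fst p) n" "(snd p)(n := j) \<in> cyl (snd p) n"
          by (simp_all add: cyl_def)
        then show ?thesis using neg unfolding bad_def by (metis fst_conv snd_conv)
      qed
      then have "borel_separated T (\<Union>i. f ` cyl ((fst p)(n := i)) (Suc n))
          (\<Union>j. g ` cyl ((snd p)(n := j)) (Suc n))"
        by (rule borel_separated_UN)
      then have "borel_separated T (f ` cyl (fst p) n) (g ` cyl (snd p) n)"
        by (simp add: cyl_eq_UN[of _ n] image_UN)
      then show False using that by (simp add: bad_def)
    qed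
    have "\<exists>P. \<forall>n. bad n (P n) \<and> fst (P (Suc n)) \<in> cyl (fst (P n)) n \<and> snd (P (Suc n)) \<in> cyl (snd (P n)) n"
      using dependent_nat_choice[of bad "\<lambda>n p q. fst q \<in> cyl (fst p) n \<and> snd q \<in> cyl (snd p) n"]
        bad0 step by blast
    then obtain P where P: "\<And>n. bad n (P n)" "\<And>n. fst (P (Suc n)) \<in> cyl (fst (P n)) n"
      "\<And>n. snd (P (Suc n)) \<in> cyl (snd (P n)) n" by blast
    \<comment> \<open>\<open>h n\<close> settles only the digits below \<open>n\<close>, so digit
      \<open>i\<close> of the limit is read off \<open>h (Suc i)\<close>.\<close>
    have lim: "cyl (\<lambda>i. h (Suc i) i) n = cyl (h n) n"
      if h: "\<And>n. h (Suc n) \<in> cyl (h n) n" for h :: "nat \<Rightarrow> baire" and n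
    proof -
      have "h (n + k) i = h n i" if "i < n" for n k i
        using that
      proof (induction k)
        case (Suc k)
        then show ?case using h[of "n + k"] by (auto simp: cyl_def)
      qed simp
      then have "h (Suc i) i = h n i" if "i < n" for i
        using that by (metis Suc_leI le_add_diff_inverse lessI)
      then show ?thesis by (auto simp: cyl_def)
    qed
    define x where "x = (\<lambda>i. fst (P (Suc i)) i)"
    define y where "y = (\<lambda>i. snd (P (Suc i)) i)"
    have x: "cyl x n = cyl (fst (P n)) n" for n
      unfolding x_def by (rule lim[of "\<lambda>n. fst (P n)"]) (rule P)
    have y: "cyl y n = cyl (snd (P n)) n" for n
      unfolding y_def by (rule lim[of "\<lambda>n. snd (P n)"]) (rule P)
    have "f x \<noteq> g y" using disj f(2) g(2) by blast
    moreover have "f x \<in> topspace T" "g y \<in> topspace T"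
      using f(1) g(1) by (auto simp: continuous_map_def)
    ultimately obtain U V where UV: "openin T U" "openin T V" "f x \<in> U" "g y \<in> V" "disjnt U V"
      using T unfolding Hausdorff_space_def by blast
    obtain m n where m: "f ` cyl x m \<subseteq> U" and n: "g ` cyl y n \<subseteq> V"
      using continuous_map_baireD[OF f(1) UV(1,3)] continuous_map_baireD[OF g(1) UV(2,4)] by blast
    have "f ` cyl x (max m n) \<subseteq> U" "g ` cyl y (max m n) \<subseteq> V"
      using order_trans[OF image_mono[OF cyl_antimono] m] order_trans[OF image_mono[OF cyl_antimono] n]
      by simp_all
    then have "borel_separated T (f ` cyl x (max m n)) (g ` cyl y (max m n))"
      unfolding borel_separated_def using UV(5)
      by (intro bexI[of _ U] openin_borel_sets_in UV(1)) (auto simp: disjnt_def)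
    then show False using P(1)[of "max m n"] by (simp add: bad_def x y)
  qed
qed

text \<open>A closed subset of the Baire space is Polish, so if it is nonempty it is itself a
  continuous image of the whole Baire space.\<close>

lemma analytic_in_imp_analytic:
  assumes "analytic_in T A"
  shows "analytic T A"
proof -
  obtain C :: "baire set" and f where C: "closed C" "continuous_map (top_of_set C) T f" "f ` C = A"
    using assms unfolding analytic_in_def by blast
  have "polish (top_of_set C)"
    using C(1) by (intro polish_subtopology polish_euclidean completely_metrizable_baire) simp
  then show ?thesis using analytic_polish_image[OF _ C(2)] C(3) by simp
qed

text \<open>Each point is coded together with witnesses deciding its membership in every \<open>U i\<close>.\<close>

lemma baire_surjection_open_vimages:
  assumes X: "polish X" "topspace X \<noteq> {}" and U: "\<And>i::nat. U i \<in> borel_sets_in X"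
  obtains p :: "baire \<Rightarrow> 'a" where "continuous_map euclidean X p" "range p = topspace X"
    "\<And>i. open {z. p z \<in> U i}"
proof -
  interpret sigma_algebra "topspace X" "borel_sets_in X" by (rule sigma_algebra_borel_sets_in)
  obtain p0 :: "baire \<Rightarrow> 'a" where p0: "continuous_map euclidean X p0" "range p0 = topspace X"
    using polish_image_baire[OF X] by metis
  have piece: "\<exists>f :: baire \<Rightarrow> 'a. continuous_map euclidean X f \<and> (V \<noteq> {} \<longrightarrow> range f = V)"
    if "V \<in> borel_sets_in X" for V
    using borel_imp_analytic[OF X(1) that] p0(1) unfolding analytic_def by auto
  \<comment> \<open>Digit \<open>0\<close> asserts non-membership in \<open>U i\<close>, every other
    digit membership.\<close>
  define V where "V i b = (if b = (0::nat) then topspace X - U i else U i)" for i b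
  have V: "V i b \<in> borel_sets_in X" for i b
    using U by (auto simp: V_def)
  have "\<forall>i b. \<exists>f :: baire \<Rightarrow> 'a. continuous_map euclidean X f \<and> (V i b \<noteq> {} \<longrightarrow> range f = V i b)"
    by (intro allI piece V)
  then obtain f :: "nat \<Rightarrow> nat \<Rightarrow> baire \<Rightarrow> 'a" where
    f: "\<And>i b. continuous_map euclidean X (f i b)" "\<And>i b. V i b \<noteq> {} \<Longrightarrow> range (f i b) = V i b"
    unfolding choice_iff by blast
  define h where "h i z = f i (z 0) (\<lambda>n. z (Suc n))" for i and z :: baire
  have h: "continuous_map euclidean X (h i)" for i
  proof (rule continuous_map_baireI)
    show "h i z \<in> topspace X" for z
      using f(1)[of i "z 0"] unfolding h_def continuous_map_def by auto
  next
    fix z W assume "openin X W" "h i z \<in> W"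
    then obtain n where n: "f i (z 0) ` cyl (\<lambda>n. z (Suc n)) n \<subseteq> W"
      using continuous_map_baireD[OF f(1)[of i "z 0"], of W] unfolding h_def by metis
    have "h i z' \<in> W" if "z' \<in> cyl z (Suc n)" for z'
    proof -
      have "z' 0 = z 0" "(\<lambda>n. z' (Suc n)) \<in> cyl (\<lambda>n. z (Suc n)) n"
        using that by (auto simp: cyl_def)
      then show ?thesis using n unfolding h_def by auto
    qed
    then show "\<exists>n. h i ` cyl z n \<subseteq> W" by blast
  qed
  \<comment> \<open>Entry \<open>0\<close> codes the point, entry \<open>i + 1\<close> a witness for
    its side of \<open>U i\<close>. The second set rules out digits \<open>b\<close> with
    \<open>V i b\<close> empty, for which \<open>f i b\<close> takes arbitrary values.\<close>
  define C where "C = (\<Inter>i. {z :: nat \<Rightarrow> baire. h i (z (Suc i)) = p0 (z 0)} \<inter> {z. V i (z (Suc i) 0) \<noteq> {}})"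
  have co: "continuous_map euclidean X (\<lambda>z::nat \<Rightarrow> baire. q (z n))"
    if "continuous_map euclidean X q" for q n
    using continuous_map_compose[OF _ that, of euclidean "\<lambda>z. z n"] by (simp add: o_def)
  have clopen: "closed {z :: nat \<Rightarrow> baire. Q (z n 0)}" "open {z :: nat \<Rightarrow> baire. Q (z n 0)}" for Q n
  proof -
    have "continuous_on UNIV (\<lambda>z :: nat \<Rightarrow> baire. z n 0)"
      by (rule continuous_on_product_then_coordinatewise[OF continuous_on_product_coordinates])
    then have *: "open ((\<lambda>z :: nat \<Rightarrow> baire. z n 0) -` A)" for A
      by (intro open_vimage discrete_topology_class.open_discrete)
    have "{z :: nat \<Rightarrow> baire. Q (z n 0)} = (\<lambda>z. z n 0) -` {k. Q k}"
      "- {z :: nat \<Rightarrow> baire. Q (z n 0)} = (\<lambda>z. z n 0) -` {k. \<not> Q k}" by auto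
    then show "closed {z :: nat \<Rightarrow> baire. Q (z n 0)}" "open {z :: nat \<Rightarrow> baire. Q (z n 0)}"
      using * by (metis closed_def, metis)
  qed
  have "closed C" unfolding C_def
  proof (intro closed_INT closed_Int ballI)
    fix i show "closed {z :: nat \<Rightarrow> baire. h i (z (Suc i)) = p0 (z 0)}"
      using closedin_continuous_maps_eq[OF polish_Hausdorff[OF X(1)] co[OF h[of i], of "Suc i"] co[OF p0(1), of 0]]
      by simp
    show "closed {z :: nat \<Rightarrow> baire. V i (z (Suc i) 0) \<noteq> {}}" using clopen(1)[of "\<lambda>b. V i b \<noteq> {}" "Suc i"] .
  qed
  then have pol: "polish (top_of_set C)"
    by (intro polish_subtopology polish_euclidean completely_metrizable_fun
        completely_metrizable_baire) simp
  have hV: "h i (z (Suc i)) \<in> V i (z (Suc i) 0)" if "z \<in> C" for z i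
    using that f(2)[of i "z (Suc i) 0"] unfolding C_def h_def by blast
  have surj: "\<exists>z\<in>C. p0 (z 0) = x" if x: "x \<in> topspace X" for x
  proof -
    obtain w where w: "p0 w = x" using p0(2) x by (metis imageE)
    have "\<exists>y. h i y = x \<and> V i (y 0) \<noteq> {}" for i
    proof -
      define b where "b = (if x \<in> U i then 1 else 0::nat)"
      have "x \<in> V i b" using x by (auto simp: V_def b_def)
      moreover then obtain y where "f i b y = x" using f(2)[of i b] by (metis empty_iff imageE)
      ultimately show ?thesis by (intro exI[of _ "case_nat b y"]) (auto simp: h_def)
    qed
    then obtain y where "\<And>i. h i (y i) = x" "\<And>i. V i (y i 0) \<noteq> {}" by metis
    then show ?thesis using w by (intro bexI[of _ "case_nat w y"]) (auto simp: C_def)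
  qed
  have "C \<noteq> {}" using surj X(2) by blast
  then obtain e :: "baire \<Rightarrow> nat \<Rightarrow> baire" where e: "continuous_map euclidean (top_of_set C) e" "range e = C"
    using polish_image_baire[OF pol] by auto
  have eC: "e z \<in> C" for z using e(2) by blast
  have econt: "continuous_on UNIV e" using e(1) by (simp add: continuous_map_in_subtopology)
  show ?thesis
  proof
    show "continuous_map euclidean X (\<lambda>z. p0 (e z 0))"
      using continuous_map_compose[OF _ co[OF p0(1), of 0], of euclidean e] econt by (simp add: o_def)
    show "range (\<lambda>z. p0 (e z 0)) = topspace X"
    proof (intro equalityI subsetI)
      fix x assume "x \<in> topspace X"
      then obtain c where "c \<in> C" "p0 (c 0) = x" using surj by blast
      then show "x \<in> range (\<lambda>z. p0 (e z 0))" using e(2) by (metis imageE rangeI)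
    qed (use p0(2) in blast)
    show "open {z. p0 (e z 0) \<in> U i}" for i
    proof -
      have "p0 (c 0) \<in> U i \<longleftrightarrow> c (Suc i) 0 \<noteq> 0" if "c \<in> C" for c
      proof -
        have "h i (c (Suc i)) = p0 (c 0)" using that by (simp add: C_def)
        then show ?thesis using hV[OF that, of i] by (auto simp: V_def split: if_splits)
      qed
      then have "{z. p0 (e z 0) \<in> U i} = e -` {c. c (Suc i) 0 \<noteq> 0}" using eC by auto
      then show ?thesis using open_vimage[OF clopen(2)[of "\<lambda>b. b \<noteq> 0" "Suc i"] econt] by simp
    qed
  qed
qed

section \<open>Analytic and Borel sets in the concrete spaces\<close>

lemmas cm_intros = completely_metrizable_prod completely_metrizable_fun completely_metrizable_discrete

lemma Hausdorff_euclidean: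
  "completely_metrizable_space (euclidean :: 'a::topological_space topology) \<Longrightarrow>
    Hausdorff_space (euclidean :: 'a topology)"
  by (simp add: completely_metrizable_imp_metrizable_space metrizable_imp_Hausdorff_space)

lemma analytic_of_borel:
  fixes A :: "'a::second_countable_topology set"
  assumes "completely_metrizable_space (euclidean :: 'a topology)" "A \<in> sets borel"
  shows "analytic euclidean A"
  using borel_imp_analytic[OF polish_euclidean[OF assms(1)]] assms(2) by (simp add: borel_sets_in_euclidean)

lemma analytic_image:
  assumes "analytic euclidean A" "continuous_on UNIV f"
  shows "analytic euclidean (f ` A)"
  using assms by (intro analytic_continuous_image[of euclidean]) auto

lemma borel_vimage:
  assumes "continuous_on UNIV f" "A \<in> sets borel"
  shows "f -` A \<in> sets borel"
  using measurable_sets[OF borel_measurable_continuous_onI[OF assms(1)] assms(2)] by simp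

lemma borel_separation:
  fixes A B :: "'a::topological_space set"
  assumes "completely_metrizable_space (euclidean :: 'a topology)"
    and "analytic euclidean A" "analytic euclidean B" "A \<inter> B = {}"
  shows "\<exists>S\<in>sets borel. A \<subseteq> S \<and> S \<inter> B = {}"
  using lusin_separation[OF Hausdorff_euclidean[OF assms(1)] assms(2-4)]
  by (simp add: borel_separated_def borel_sets_in_euclidean)

lemma analytic_vimage:
  fixes f :: "'a::second_countable_topology \<Rightarrow> 'b::topological_space"
  assumes "completely_metrizable_space (euclidean :: 'a topology)"
    and B: "completely_metrizable_space (euclidean :: 'b topology)"
    and A: "analytic euclidean A" and f: "continuous_on UNIV f"
  shows "analytic euclidean (f -` A)"
proof (cases "A = {}")
  case False
  then obtain g :: "baire \<Rightarrow> 'b" where g: "continuous_on UNIV g" "range g = A"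
    using A unfolding analytic_def by auto
  have "continuous_on UNIV (\<lambda>p::'a \<times> baire. f (fst p))" "continuous_on UNIV (\<lambda>p::'a \<times> baire. g (snd p))"
    using continuous_on_compose2[OF f continuous_on_fst[OF continuous_on_id]]
      continuous_on_compose2[OF g(1) continuous_on_snd[OF continuous_on_id]] by auto
  \<comment> \<open>The preimage is the projection of this fibre product of \<open>f\<close> with a
    parametrisation of \<open>A\<close>.\<close>
  then have "closed {p :: 'a \<times> baire. f (fst p) = g (snd p)}"
    using closedin_continuous_maps_eq[OF Hausdorff_euclidean[OF B], of euclidean
        "\<lambda>p::'a \<times> baire. f (fst p)" "\<lambda>p. g (snd p)"] by simp
  then have "analytic euclidean {p :: 'a \<times> baire. f (fst p) = g (snd p)}"
    by (intro analytic_of_borel completely_metrizable_prod assms(1) completely_metrizable_baire borel_closed)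
  then have "analytic euclidean (fst ` {p :: 'a \<times> baire. f (fst p) = g (snd p)})"
    by (rule analytic_image) (rule continuous_on_fst[OF continuous_on_id])
  also have "fst ` {p :: 'a \<times> baire. f (fst p) = g (snd p)} = f -` A"
    using g(2) by (fastforce simp: image_iff)
  finally show ?thesis .
qed simp

lemma analytic_relcomp:
  fixes C A :: "(baire \<times> baire) set"
  assumes "analytic euclidean C" "analytic euclidean A"
  shows "analytic euclidean (C O A)"
proof -
  let ?p = "\<lambda>t::baire \<times> baire \<times> baire. (fst t, fst (snd t))" and ?q = "\<lambda>t::baire \<times> baire \<times> baire. snd t"
  have co: "continuous_on UNIV ?p" "continuous_on UNIV ?q"
    "continuous_on UNIV (\<lambda>t::baire \<times> baire \<times> baire. (fst t, snd (snd t)))"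
    by (intro continuous_intros)+
  have cm: "completely_metrizable_space (euclidean :: (baire \<times> baire \<times> baire) topology)"
    by (intro completely_metrizable_prod completely_metrizable_baire)
  have "analytic euclidean (?p -` C \<inter> ?q -` A)"
    by (intro analytic_Int analytic_vimage cm cm_intros assms co Hausdorff_euclidean)
  then have "analytic euclidean ((\<lambda>t. (fst t, snd (snd t))) ` (?p -` C \<inter> ?q -` A))"
    by (rule analytic_image) (rule co)
  also have "(\<lambda>t. (fst t, snd (snd t))) ` (?p -` C \<inter> ?q -` A) = C O A"
  proof (intro equalityI subsetI)
    fix p assume "p \<in> C O A"
    then obtain x y z where "p = (x, z)" "(x, y) \<in> C" "(y, z) \<in> A" by auto
    then show "p \<in> (\<lambda>t. (fst t, snd (snd t))) ` (?p -` C \<inter> ?q -` A)"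
      by (intro image_eqI[of _ _ "(x, y, z)"]) auto
  qed auto
  finally show ?thesis .
qed

lemma analytic_Image:
  fixes C :: "(baire \<times> baire) set"
  assumes "analytic euclidean C" "analytic euclidean A"
  shows "analytic euclidean (C `` A)"
proof -
  have "analytic euclidean (C \<inter> fst -` A)"
    by (intro analytic_Int analytic_vimage cm_intros assms Hausdorff_euclidean
        continuous_on_fst continuous_on_id)
  then have "analytic euclidean (snd ` (C \<inter> fst -` A))"
    by (rule analytic_image) (rule continuous_on_snd[OF continuous_on_id])
  also have "snd ` (C \<inter> fst -` A) = C `` A" by force
  finally show ?thesis .
qed

section \<open>Reflection\<close>

text \<open>The situation after coding. \<open>Ew\<close> is closed so that
  \<open>E\<close>-relatedness passes to limits as soon as the witnesses converge; the open sets
  \<open>Ok k q\<close> split inequivalence into countably many requirements, each of which can be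
  met at a finite stage and kept in the limit.\<close>

locale baire_relations =
  fixes E :: "baire rel" and Ew :: "(baire \<times> baire \<times> baire) set"
    and Ek :: "nat \<Rightarrow> baire rel" and Ok :: "nat \<Rightarrow> nat \<Rightarrow> (baire \<times> baire) set"
  assumes equiv_E: "equiv UNIV E"
    and closed_Ew: "closed Ew"
    and E_iff: "(x, y) \<in> E \<longleftrightarrow> (\<exists>w. (x, y, w) \<in> Ew)"
    and equiv_Ek: "equiv UNIV (Ek k)"
    and Ek_subset: "Ek k \<subseteq> E"
    and open_Ok: "open (Ok k q)"
    and Ek_compl: "- Ek k = (\<Inter>q. Ok k q)"
begin

lemma E_refl: "(x, x) \<in> E" and E_sym: "(x, y) \<in> E \<Longrightarrow> (y, x) \<in> E"
  and E_trans: "(x, y) \<in> E \<Longrightarrow> (y, z) \<in> E \<Longrightarrow> (x, z) \<in> E"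
  using equiv_E by (auto elim!: equivE dest: symD transD refl_onD)

lemma Ek_refl: "(x, x) \<in> Ek k" and Ek_sym: "(x, y) \<in> Ek k \<Longrightarrow> (y, x) \<in> Ek k"
  and Ek_trans: "(x, y) \<in> Ek k \<Longrightarrow> (y, z) \<in> Ek k \<Longrightarrow> (x, z) \<in> Ek k"
  using equiv_Ek[of k] by (auto elim!: equivE dest: symD transD refl_onD)

lemma cm_pair: "completely_metrizable_space (euclidean :: (baire \<times> baire) topology)"
  by (intro completely_metrizable_prod completely_metrizable_baire)

lemma borel_Ek_compl: "- Ek k \<in> sets borel"
  unfolding Ek_compl by (intro sets.countable_INT' borel_open open_Ok) (auto intro: borel_open open_Ok)

lemma borel_Ek: "Ek k \<in> sets borel"
  using borel_comp[OF borel_Ek_compl[of k]] by simp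

lemma analytic_Ek: "analytic euclidean (Ek k)" "analytic euclidean (- Ek k)"
  by (intro analytic_of_borel cm_pair borel_Ek borel_Ek_compl)+

lemma analytic_E: "analytic euclidean E"
proof -
  have "analytic euclidean Ew"
    by (intro analytic_of_borel completely_metrizable_prod completely_metrizable_baire borel_closed closed_Ew)
  then have "analytic euclidean ((\<lambda>t. (fst t, fst (snd t))) ` Ew)"
    by (rule analytic_image) (intro continuous_intros)
  also have "(\<lambda>t. (fst t, fst (snd t))) ` Ew = E"
    by (force simp: E_iff image_iff)
  finally show ?thesis .
qed

section \<open>Reflection and the two ideals\<close>

definition small_sections :: "nat \<Rightarrow> (baire \<times> baire) set \<Rightarrow> bool" where
  "small_sections k R \<longleftrightarrow> (\<forall>x x' y. (x, y) \<in> R \<longrightarrow> (x', y) \<in> R \<longrightarrow> (x, x') \<in> Ek k)"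

definition invariant_sections :: "nat \<Rightarrow> (baire \<times> baire) set \<Rightarrow> bool" where
  "invariant_sections k R \<longleftrightarrow> (\<forall>x x' y. (x, y) \<in> R \<longrightarrow> (x, x') \<in> Ek k \<longrightarrow> (x', y) \<in> R)"

text \<open>The usual double separation that proves the first reflection theorem.\<close>

lemma borel_small_sections:
  assumes R: "analytic euclidean R" "small_sections k R"
  obtains R' where "R' \<in> sets borel" "R \<subseteq> R'" "small_sections k R'"
proof -
  have sep: "\<exists>S\<in>sets borel. R \<subseteq> S \<and> S \<inter> ((- Ek k) O A) = {}"
    if "analytic euclidean A" "R \<inter> ((- Ek k) O A) = {}" for A
    by (rule borel_separation[OF cm_pair R(1) analytic_relcomp[OF analytic_Ek(2) that(1)] that(2)])
  have "R \<inter> ((- Ek k) O R) = {}" using R(2) by (auto simp: small_sections_def)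
  then obtain R1 where R1: "R1 \<in> sets borel" "R \<subseteq> R1" "R1 \<inter> ((- Ek k) O R) = {}"
    using sep[OF R(1)] by blast
  have "R \<inter> ((- Ek k) O R1) = {}" using R1(3) by (auto dest: Ek_sym)
  then obtain R2 where R2: "R2 \<in> sets borel" "R \<subseteq> R2" "R2 \<inter> ((- Ek k) O R1) = {}"
    using sep[OF analytic_of_borel[OF cm_pair R1(1)]] by blast
  show ?thesis
  proof
    show "R1 \<inter> R2 \<in> sets borel" using R1 R2 by auto
    show "R \<subseteq> R1 \<inter> R2" using R1 R2 by auto
    show "small_sections k (R1 \<inter> R2)"
      unfolding small_sections_def
    proof (intro allI impI)
      fix x x' y assume "(x, y) \<in> R1 \<inter> R2" "(x', y) \<in> R1 \<inter> R2"
      then show "(x, x') \<in> Ek k" using R2(3) by blast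
    qed
  qed
qed

lemma small_sections_saturation: "small_sections k R \<Longrightarrow> small_sections k (Ek k O R)"
  unfolding small_sections_def by (blast intro: Ek_sym Ek_trans)

text \<open>Borel covers with small sections alternate with saturations under \<open>Ek k\<close>.
  The union is invariant because each saturation lies in the next set, and its sections are small
  because the sets increase.\<close>

lemma reflection:
  assumes R: "analytic euclidean R" "small_sections k R"
  obtains R' where "R' \<in> sets borel" "R \<subseteq> R'" "small_sections k R'" "invariant_sections k R'"
proof -
  have "\<exists>S. \<forall>n::nat. (S n \<in> sets borel \<and> small_sections k (S n) \<and> R \<subseteq> S n) \<and> Ek k O S n \<subseteq> S (Suc n)"
  proof (rule dependent_nat_choice)
    show "\<exists>x. x \<in> sets borel \<and> small_sections k x \<and> R \<subseteq> x"
      using borel_small_sections[OF R] by metis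
  next
    fix A and n :: nat assume A: "A \<in> sets borel \<and> small_sections k A \<and> R \<subseteq> A"
    have "analytic euclidean (Ek k O A)"
      using A by (intro analytic_relcomp analytic_Ek analytic_of_borel cm_pair) auto
    then obtain B where B: "B \<in> sets borel" "Ek k O A \<subseteq> B" "small_sections k B"
      using borel_small_sections small_sections_saturation A by metis
    have "A \<subseteq> Ek k O A" using Ek_refl by auto
    then show "\<exists>y. (y \<in> sets borel \<and> small_sections k y \<and> R \<subseteq> y) \<and> Ek k O A \<subseteq> y"
      using A B by (intro exI[of _ B]) auto
  qed
  then obtain S where S: "\<And>n::nat. S n \<in> sets borel" "\<And>n. small_sections k (S n)" "\<And>n. R \<subseteq> S n"
    "\<And>n. Ek k O S n \<subseteq> S (Suc n)" by metis
  have "S n \<subseteq> S (Suc n)" for n using S(4)[of n] Ek_refl by auto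
  then have mono: "S m \<subseteq> S n" if "m \<le> n" for m n using that lift_Suc_mono_le[of S m n] by blast
  show ?thesis
  proof
    show "(\<Union>n. S n) \<in> sets borel" using S(1) by auto
    show "R \<subseteq> (\<Union>n. S n)" using S(3) by auto
    show "small_sections k (\<Union>n. S n)" unfolding small_sections_def
    proof (intro allI impI)
      fix x x' y assume "(x, y) \<in> (\<Union>n. S n)" "(x', y) \<in> (\<Union>n. S n)"
      then obtain m n where "(x, y) \<in> S m" "(x', y) \<in> S n" by auto
      then have "(x, y) \<in> S (max m n)" "(x', y) \<in> S (max m n)"
        using mono[of m "max m n"] mono[of n "max m n"] by auto
      then show "(x, x') \<in> Ek k" using S(2)[of "max m n"] unfolding small_sections_def by metis
    qed
    show "invariant_sections k (\<Union>n. S n)" unfolding invariant_sections_def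
    proof (intro allI impI)
      fix x x' y assume "(x, y) \<in> (\<Union>n. S n)" and x: "(x, x') \<in> Ek k"
      then obtain n where "(x, y) \<in> S n" by auto
      then have "(x', y) \<in> S (Suc n)" using S(4)[of n] Ek_sym[OF x] by auto
      then show "(x', y) \<in> (\<Union>n. S n)" by blast
    qed
  qed
qed

text \<open>Countable unions of partial Borel choices of an \<open>Ek k\<close>-class: over each
  second coordinate, the section of \<open>R m\<close> is either empty or exactly one class.\<close>

definition section_ideal :: "nat \<Rightarrow> (baire \<times> baire) set \<Rightarrow> bool" where
  "section_ideal k Z \<longleftrightarrow> (\<exists>R :: nat \<Rightarrow> (baire \<times> baire) set.
     (\<forall>m. R m \<in> sets borel \<and> small_sections k (R m) \<and> invariant_sections k (R m)) \<and> Z = (\<Union>m. R m))"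

lemma section_ideal_empty [simp]: "section_ideal k {}"
  unfolding section_ideal_def
  by (intro exI[of _ "\<lambda>_. {}"]) (auto simp: small_sections_def invariant_sections_def)

lemma section_ideal_borel: "section_ideal k Z \<Longrightarrow> Z \<in> sets borel"
  unfolding section_ideal_def by auto

lemma section_ideal_invariant: "section_ideal k Z \<Longrightarrow> (x, y) \<in> Z \<Longrightarrow> (x, x') \<in> Ek k \<Longrightarrow> (x', y) \<in> Z"
  unfolding section_ideal_def invariant_sections_def by blast

lemma section_ideal_UN:
  assumes "\<And>i::nat. section_ideal k (Z i)"
  shows "section_ideal k (\<Union>i. Z i)"
proof -
  obtain R :: "nat \<Rightarrow> nat \<Rightarrow> (baire \<times> baire) set" where
    R: "\<And>i m. R i m \<in> sets borel \<and> small_sections k (R i m) \<and> invariant_sections k (R i m)"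
      "\<And>i. Z i = (\<Union>m. R i m)"
    using assms unfolding section_ideal_def by metis
  have "(\<Union>i. Z i) = (\<Union>j. R (fst (prod_decode j)) (snd (prod_decode j)))"
  proof (intro equalityI subsetI)
    fix t assume "t \<in> (\<Union>i. Z i)"
    then obtain i m where "t \<in> R i m" using R(2) by auto
    then show "t \<in> (\<Union>j. R (fst (prod_decode j)) (snd (prod_decode j)))"
      by (intro UN_I[of "prod_encode (i, m)"]) auto
  qed (use R(2) in auto)
  then show ?thesis unfolding section_ideal_def
    using R(1) by (intro exI[of _ "\<lambda>j. R (fst (prod_decode j)) (snd (prod_decode j))"]) auto
qed

lemma section_ideal_Un:
  assumes "section_ideal k A" "section_ideal k B"
  shows "section_ideal k (A \<union> B)"
proof -
  have "A \<union> B = (\<Union>i::nat. if i = 0 then A else B)"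
    by (auto split: if_splits)
  also have "section_ideal k \<dots>" by (rule section_ideal_UN) (use assms in auto)
  finally show ?thesis .
qed

text \<open>An enumeration of representatives stands in for the countable family of classes. The
  representatives may lie outside \<open>B\<close>, so subsets of \<open>B\<close> inherit the
  property with the same enumeration.\<close>

definition countable_index :: "nat \<Rightarrow> baire set \<Rightarrow> bool" where
  "countable_index n B \<longleftrightarrow> (\<forall>x. \<exists>f::nat \<Rightarrow> baire. \<forall>y\<in>B. (x, y) \<in> E \<longrightarrow> (\<exists>i. (f i, y) \<in> Ek n))"

text \<open>\<open>index_ideal UNIV\<close> is the first alternative, pulled back to the Baire
  space.\<close>

definition index_ideal :: "baire set \<Rightarrow> bool" where
  "index_ideal W \<longleftrightarrow> (\<exists>B. (\<forall>n. B n \<in> sets borel \<and> invariant_set (Ek n) (B n) \<and> countable_index n (B n))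
     \<and> W \<subseteq> (\<Union>n. B n))"

lemma index_idealI:
  assumes "B \<in> sets borel" "invariant_set (Ek n) B" "countable_index n B" "W \<subseteq> B"
  shows "index_ideal W"
  unfolding index_ideal_def
proof (intro exI[of _ "\<lambda>i. if i = n then B else {}"] conjI allI)
  fix m show "(if m = n then B else {}) \<in> sets borel" using assms by auto
  show "invariant_set (Ek m) (if m = n then B else {})"
    using assms by (auto simp: invariant_set_def)
  show "countable_index m (if m = n then B else {})"
    using assms by (auto simp: countable_index_def)
next
  show "W \<subseteq> (\<Union>i. if i = n then B else {})" using assms(4) by auto
qed

lemma index_ideal_UN:
  assumes "\<And>i::nat. index_ideal (W i)"
  shows "index_ideal (\<Union>i. W i)"
proof -
  obtain B where B: "\<And>i n. B i n \<in> sets borel" "\<And>i n. invariant_set (Ek n) (B i n)"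
    "\<And>i n. countable_index n (B i n)" "\<And>i. W i \<subseteq> (\<Union>n. B i n)"
    using assms unfolding index_ideal_def by metis
  show ?thesis unfolding index_ideal_def
  proof (intro exI[of _ "\<lambda>n. \<Union>i. B i n"] conjI allI)
    fix n
    show "(\<Union>i. B i n) \<in> sets borel" using B(1) by auto
    show "invariant_set (Ek n) (\<Union>i. B i n)" using B(2) unfolding invariant_set_def by blast
    show "countable_index n (\<Union>i. B i n)" unfolding countable_index_def
    proof
      fix x
      have "\<forall>i. \<exists>f::nat \<Rightarrow> baire. \<forall>y\<in>B i n. (x, y) \<in> E \<longrightarrow> (\<exists>j. (f j, y) \<in> Ek n)"
        using B(3) unfolding countable_index_def by blast
      then obtain f :: "nat \<Rightarrow> nat \<Rightarrow> baire" where
        f: "\<And>i y. y \<in> B i n \<Longrightarrow> (x, y) \<in> E \<Longrightarrow> \<exists>j. (f i j, y) \<in> Ek n" by metis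
      have "\<exists>j. (case_prod f (prod_decode j), y) \<in> Ek n" if y: "y \<in> (\<Union>i. B i n)" "(x, y) \<in> E" for y
      proof -
        obtain i where "y \<in> B i n" using y by auto
        then obtain j where "(f i j, y) \<in> Ek n" using f y by blast
        then show ?thesis by (intro exI[of _ "prod_encode (i, j)"]) simp
      qed
      then show "\<exists>f::nat \<Rightarrow> baire. \<forall>y\<in>\<Union>i. B i n. (x, y) \<in> E \<longrightarrow> (\<exists>j. (f j, y) \<in> Ek n)"
        by (intro exI[of _ "\<lambda>j. case_prod f (prod_decode j)"]) blast
    qed
  qed (use B(4) in blast)
qed

lemma index_ideal_borel_cover:
  assumes "index_ideal W"
  obtains W' where "W \<subseteq> W'" "W' \<in> sets borel" "index_ideal W'"
proof -
  obtain B where B: "\<And>n. B n \<in> sets borel \<and> invariant_set (Ek n) (B n) \<and> countable_index n (B n)"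
    "W \<subseteq> (\<Union>n. B n)" using assms unfolding index_ideal_def by metis
  show ?thesis
  proof
    show "W \<subseteq> (\<Union>n. B n)" by fact
    show "(\<Union>n. B n) \<in> sets borel" using B(1) by auto
    show "index_ideal (\<Union>n. B n)" unfolding index_ideal_def using B(1) by (intro exI[of _ B]) auto
  qed
qed

lemma index_ideal_Un:
  assumes "index_ideal A" "index_ideal B"
  shows "index_ideal (A \<union> B)"
proof -
  have "A \<union> B = (\<Union>i::nat. if i = 0 then A else B)"
    by (auto split: if_splits)
  also have "index_ideal \<dots>" by (rule index_ideal_UN) (use assms in auto)
  finally show ?thesis .
qed

lemma index_ideal_empty [simp]: "index_ideal {}"
  by (rule index_idealI[of "{}" 0]) (auto simp: invariant_set_def countable_index_def)

text \<open>The set \<open>D\<close> of all points whose \<open>E\<close>-class lies over them in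
  \<open>Z\<close> is coanalytic and \<open>Ek k\<close>-invariant. Separation from its complement,
  alternated with saturation, gives an invariant Borel set between \<open>\<Theta>\<close> and
  \<open>D\<close>. It has countable index because every section of \<open>Z\<close> is a countable
  union of \<open>Ek k\<close>-classes.\<close>

lemma index_ideal_reflection:
  assumes Z: "section_ideal k Z" and Th: "analytic euclidean \<Theta>"
    and sub: "\<And>x y. x \<in> \<Theta> \<Longrightarrow> (x, y) \<in> E \<Longrightarrow> (x, y) \<in> Z"
  shows "index_ideal \<Theta>"
proof -
  define D where "D = {x. \<forall>y. (x, y) \<in> E \<longrightarrow> (x, y) \<in> Z}"
  have Dinv: "x' \<in> D" if "x \<in> D" "(x, x') \<in> Ek k" for x x'
  proof -
    have "(x, x') \<in> E" using that Ek_subset by blast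
    then show ?thesis using that section_ideal_invariant[OF Z]
      unfolding D_def by (blast intro: E_trans)
  qed
  have "analytic euclidean (fst ` (E \<inter> - Z))"
    by (intro analytic_image analytic_Int analytic_E analytic_of_borel cm_pair borel_comp
        section_ideal_borel[OF Z] Hausdorff_euclidean continuous_on_fst continuous_on_id)
  also have "fst ` (E \<inter> - Z) = - D" unfolding D_def by force
  finally have Dan: "analytic euclidean (- D)" .
  have "\<exists>S. \<forall>n::nat. (S n \<in> sets borel \<and> \<Theta> \<subseteq> S n \<and> S n \<subseteq> D) \<and> Ek k `` S n \<subseteq> S (Suc n)"
  proof (rule dependent_nat_choice)
    have "\<Theta> \<inter> - D = {}" using sub by (auto simp: D_def)
    then show "\<exists>x. x \<in> sets borel \<and> \<Theta> \<subseteq> x \<and> x \<subseteq> D"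
      using borel_separation[OF completely_metrizable_baire Th Dan]
      by (metis disjoint_eq_subset_Compl double_compl)
  next
    fix A and n :: nat assume A: "A \<in> sets borel \<and> \<Theta> \<subseteq> A \<and> A \<subseteq> D"
    have "analytic euclidean (Ek k `` A)"
      using A by (intro analytic_Image analytic_Ek analytic_of_borel completely_metrizable_baire) auto
    moreover have "Ek k `` A \<inter> - D = {}" using A Dinv by auto
    ultimately obtain B where B: "B \<in> sets borel" "Ek k `` A \<subseteq> B" "B \<subseteq> D"
      using borel_separation[OF completely_metrizable_baire _ Dan]
      by (metis disjoint_eq_subset_Compl double_compl)
    have "A \<subseteq> Ek k `` A" using Ek_refl by auto
    then have "\<Theta> \<subseteq> B" using A B(2) by (metis subset_trans)
    then show "\<exists>y. (y \<in> sets borel \<and> \<Theta> \<subseteq> y \<and> y \<subseteq> D) \<and> Ek k `` A \<subseteq> y"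
      using B by (intro exI[of _ B]) simp
  qed
  then obtain S where S: "\<And>n::nat. S n \<in> sets borel" "\<And>n. \<Theta> \<subseteq> S n" "\<And>n. S n \<subseteq> D"
    "\<And>n. Ek k `` S n \<subseteq> S (Suc n)" by metis
  show ?thesis
  proof (rule index_idealI)
    show "(\<Union>n. S n) \<in> sets borel" using S(1) by auto
    show "\<Theta> \<subseteq> (\<Union>n. S n)" using S(2) by auto
    show "invariant_set (Ek k) (\<Union>n. S n)" using S(4) unfolding invariant_set_def by blast
    show "countable_index k (\<Union>n. S n)" unfolding countable_index_def
    proof
      fix x
      obtain R :: "nat \<Rightarrow> (baire \<times> baire) set" where
        R: "\<And>m. small_sections k (R m)" "Z = (\<Union>m. R m)"
        using Z unfolding section_ideal_def by metis
      have "\<exists>m. ((SOME y. (y, x) \<in> R m), y) \<in> Ek k" if y: "y \<in> (\<Union>n. S n)" "(x, y) \<in> E" for y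
      proof -
        have "y \<in> D" using y(1) S(3) by auto
        then have "(y, x) \<in> Z" using E_sym[OF y(2)] by (auto simp: D_def)
        then obtain m where m: "(y, x) \<in> R m" using R(2) by auto
        then have "((SOME y. (y, x) \<in> R m), x) \<in> R m" by (rule someI[of "\<lambda>y. (y, x) \<in> R m"])
        then show ?thesis using R(1)[of m] m unfolding small_sections_def by metis
      qed
      then show "\<exists>f::nat \<Rightarrow> baire. \<forall>y\<in>\<Union>n. S n. (x, y) \<in> E \<longrightarrow> (\<exists>i. (f i, y) \<in> Ek k)"
        by (intro exI[of _ "\<lambda>m. SOME y. (y, x) \<in> R m"]) blast
    qed
  qed
qed

end

section \<open>Configurations\<close>

text \<open>A leaf of stage \<open>m\<close> is a list of \<open>m\<close> bits; bit \<open>t\<close> belongs to coordinate \<open>coord t\<close> of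
  \<open>(2\<^sup>\<nat>)\<^sup>\<nat>\<close> and is visible at the levels \<open>n \<le> lam (coord t)\<close> only. The value of \<open>lam\<close> is dictated by
  the number of roots added at each stage: one per leaf.\<close>

definition coord :: "nat \<Rightarrow> nat" where
  "coord t = fst (prod_decode t)"

definition lam :: "nat \<Rightarrow> nat" where
  "lam k = 2 ^ Suc k - 2"

lemma coord_le: "coord t \<le> t"
  unfolding coord_def by (metis le_prod_encode_1 prod.collapse prod_decode_inverse)

lemma lam_mono: "i \<le> j \<Longrightarrow> lam i \<le> lam j"
  unfolding lam_def by (intro diff_le_mono power_increasing) auto

lemma Suc_lam: "Suc (lam k) = 2 ^ Suc k - 1"
proof -
  have "(2::nat) \<le> 2 ^ Suc k" by simp
  then show ?thesis unfolding lam_def by linarith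
qed

definition agree :: "nat \<Rightarrow> bool list \<Rightarrow> bool list \<Rightarrow> bool" where
  "agree n u v \<longleftrightarrow> length u = length v \<and> (\<forall>t<length u. n \<le> lam (coord t) \<longrightarrow> u ! t = v ! t)"

lemma agree_refl [simp]: "agree n u u"
  and agree_sym: "agree n u v \<Longrightarrow> agree n v u"
  and agree_trans: "agree n u v \<Longrightarrow> agree n v w \<Longrightarrow> agree n u w"
  and agree_mono: "agree n u v \<Longrightarrow> n \<le> n' \<Longrightarrow> agree n' u v"
  and agree_length: "agree n u v \<Longrightarrow> length u = length v"
  by (auto simp: agree_def)

lemma agree_snoc:
  "agree n (u @ [b]) (v @ [c]) \<longleftrightarrow> agree n u v \<and> (n \<le> lam (coord (length u)) \<longrightarrow> b = c)"
  by (auto simp: agree_def nth_append less_Suc_eq)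

text \<open>The first \<open>m\<close> bits belong to coordinates below \<open>m\<close>, so none of
  them is visible at a level \<open>\<ge> 2 ^ m - 1\<close>: at such a level all leaves of stage
  \<open>m\<close> share one hub.\<close>

lemma agree_root: "length u = m \<Longrightarrow> length v = m \<Longrightarrow> 2 ^ m - 1 \<le> s \<Longrightarrow> agree s u v"
proof -
  assume *: "length u = m" "length v = m" "2 ^ m - 1 \<le> s"
  have "lam (coord t) < s" if "t < m" for t
  proof -
    have "Suc (lam (coord t)) \<le> Suc (lam (m - 1))"
      using coord_le[of t] that by (simp add: lam_mono)
    also have "\<dots> \<le> s" using * that by (simp add: Suc_lam)
    finally show ?thesis by simp
  qed
  then show ?thesis using * by (auto simp: agree_def dest: leD)
qed

section \<open>Configurations, conditions and largeness\<close>

text \<open>The first component of a configuration gives the points, the second the witnesses for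
  the \<open>E\<close>-relatedness of the points at consecutive levels.\<close>

type_synonym config = "(nat \<Rightarrow> bool list \<Rightarrow> baire) \<times> (nat \<Rightarrow> bool list \<Rightarrow> baire)"

lemma cm_config: "completely_metrizable_space (euclidean :: config topology)"
  by (intro cm_intros)

lemma continuous_fst_config: "continuous_on UNIV (\<lambda>\<gamma>::config. fst \<gamma> n u)"
  by (intro continuous_on_product_then_coordinatewise[OF
      continuous_on_product_then_coordinatewise[OF continuous_on_fst[OF continuous_on_id]]])

lemma continuous_snd_config: "continuous_on UNIV (\<lambda>\<gamma>::config. snd \<gamma> n u)"
  by (intro continuous_on_product_then_coordinatewise[OF
      continuous_on_product_then_coordinatewise[OF continuous_on_snd[OF continuous_on_id]]])

lemma closed_eq_config:
  fixes f g :: "config \<Rightarrow> baire"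
  assumes "continuous_on UNIV f" "continuous_on UNIV g"
  shows "closed {\<gamma>. f \<gamma> = g \<gamma>}"
  using closedin_continuous_maps_eq[OF Hausdorff_euclidean[OF completely_metrizable_baire], of euclidean f g]
    assms by simp

lemma borel_Collect_all:
  assumes "\<And>i::'i::countable. {x. P i x} \<in> sets borel"
  shows "{x. \<forall>i. P i x} \<in> sets borel"
proof -
  have "{x. \<forall>i. P i x} = (\<Inter>i. {x. P i x})" by auto
  also have "\<dots> \<in> sets borel" using assms by (intro sets.countable_INT'') auto
  finally show ?thesis .
qed

lemma borel_Collect_imp:
  assumes "Q \<Longrightarrow> {x. P x} \<in> sets borel"
  shows "{x. Q \<longrightarrow> P x} \<in> sets borel"
  using assms by (cases Q) auto

lemma borel_Collect_conj:
  assumes "{x. P x} \<in> sets borel" "{x. Q x} \<in> sets borel"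
  shows "{x. P x \<and> Q x} \<in> sets borel"
  using sets.Int[OF assms] by (simp add: Int_def)

text \<open>Grafts the part of \<open>\<gamma>'\<close> from the hub of \<open>u\<close> at level
  \<open>n\<close> downwards onto \<open>\<gamma>\<close>. The witnesses at level \<open>n\<close>
  move along, since they belong to the edge from level \<open>n\<close> to level
  \<open>n + 1\<close>.\<close>

definition mix :: "nat \<Rightarrow> bool list \<Rightarrow> config \<Rightarrow> config \<Rightarrow> config" where
  "mix n u \<gamma> \<gamma>' = (\<lambda>i v. if i \<le> n \<and> agree n u v then fst \<gamma>' i v else fst \<gamma> i v,
                   \<lambda>i v. if i \<le> n \<and> agree n u v then snd \<gamma>' i v else snd \<gamma> i v)"

lemma fst_mix: "fst (mix n u \<gamma> \<gamma>') i v = (if i \<le> n \<and> agree n u v then fst \<gamma>' i v else fst \<gamma> i v)"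
  and snd_mix: "snd (mix n u \<gamma> \<gamma>') i v = (if i \<le> n \<and> agree n u v then snd \<gamma>' i v else snd \<gamma> i v)"
  by (simp_all add: mix_def)

text \<open>Configurations are total functions, of which only finitely many values matter for leaves
  of length \<open>m\<close> and top level \<open>s\<close>.\<close>

definition same_on :: "nat \<Rightarrow> nat \<Rightarrow> config \<Rightarrow> config \<Rightarrow> bool" where
  "same_on m s \<gamma> \<gamma>' \<longleftrightarrow> (\<forall>u. length u = m \<longrightarrow>
     (\<forall>n\<le>s. fst \<gamma> n u = fst \<gamma>' n u) \<and> (\<forall>n<s. snd \<gamma> n u = snd \<gamma>' n u))"

context baire_relations
begin

definition valid :: "nat \<Rightarrow> nat \<Rightarrow> config \<Rightarrow> bool" where
  "valid m s \<gamma> \<longleftrightarrow>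
     (\<forall>n u v. n \<le> s \<and> length u = m \<and> agree n u v \<longrightarrow> fst \<gamma> n u = fst \<gamma> n v) \<and>
     (\<forall>n u v. n < s \<and> length u = m \<and> agree n u v \<longrightarrow> snd \<gamma> n u = snd \<gamma> n v) \<and>
     (\<forall>n u. n < s \<and> length u = m \<longrightarrow> (fst \<gamma> n u, fst \<gamma> (Suc n) u, snd \<gamma> n u) \<in> Ew)"

lemma valid_fst: "valid m s \<gamma> \<Longrightarrow> n \<le> s \<Longrightarrow> length u = m \<Longrightarrow> agree n u v \<Longrightarrow> fst \<gamma> n u = fst \<gamma> n v"
  and valid_snd: "valid m s \<gamma> \<Longrightarrow> n < s \<Longrightarrow> length u = m \<Longrightarrow> agree n u v \<Longrightarrow> snd \<gamma> n u = snd \<gamma> n v"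
  and valid_Ew: "valid m s \<gamma> \<Longrightarrow> n < s \<Longrightarrow> length u = m \<Longrightarrow> (fst \<gamma> n u, fst \<gamma> (Suc n) u, snd \<gamma> n u) \<in> Ew"
  by (auto simp: valid_def)

lemma borel_valid: "{\<gamma>. valid m s \<gamma>} \<in> sets borel"
proof -
  have "closed ((\<lambda>\<gamma>::config. (fst \<gamma> n u, fst \<gamma> (Suc n) u, snd \<gamma> n u)) -` Ew)" for n u
    by (intro closed_vimage closed_Ew continuous_on_Pair continuous_fst_config continuous_snd_config)
  then have *: "{\<gamma>::config. (fst \<gamma> n u, fst \<gamma> (Suc n) u, snd \<gamma> n u) \<in> Ew} \<in> sets borel" for n u
    by (simp add: vimage_def borel_closed)
  show ?thesis unfolding valid_def
    by (intro borel_Collect_conj borel_Collect_all borel_Collect_imp * borel_closed closed_eq_config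
        continuous_fst_config continuous_snd_config)
qed

text \<open>The one edge that joins grafted to old material leads from level \<open>n\<close> to
  level \<open>n + 1\<close>; by \<open>eq\<close> its upper end is the same in both configurations,
  so it is an edge of \<open>\<gamma>'\<close>.\<close>

lemma valid_mix:
  assumes v: "valid m s \<gamma>" "valid m s \<gamma>'" and n: "n < s" "length u = m"
    and eq: "fst \<gamma> (Suc n) u = fst \<gamma>' (Suc n) u"
  shows "valid m s (mix n u \<gamma> \<gamma>')"
  unfolding valid_def
proof (intro conjI allI impI; elim conjE)
  \<comment> \<open>Leaves that share a hub at a level \<open>i \<le> n\<close> lie on the same side
    of the graft.\<close>
  have cong: "agree n u a = agree n u b" if "agree i a b" "i \<le> n" for i a b
    using that by (meson agree_mono agree_sym agree_trans)
  fix i a b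
  assume i: "length a = m" "agree i a b"
  show "fst (mix n u \<gamma> \<gamma>') i a = fst (mix n u \<gamma> \<gamma>') i b" if "i \<le> s"
    using cong[OF i(2)] valid_fst[OF v(1) that i] valid_fst[OF v(2) that i] by (auto simp: fst_mix)
  show "snd (mix n u \<gamma> \<gamma>') i a = snd (mix n u \<gamma> \<gamma>') i b" if "i < s"
    using cong[OF i(2)] valid_snd[OF v(1) that i] valid_snd[OF v(2) that i] by (auto simp: snd_mix)
next
  fix i and a :: "bool list" assume i: "i < s" "length a = m"
  note 1 = valid_Ew[OF v(1) i] and 2 = valid_Ew[OF v(2) i]
  show "(fst (mix n u \<gamma> \<gamma>') i a, fst (mix n u \<gamma> \<gamma>') (Suc i) a, snd (mix n u \<gamma> \<gamma>') i a) \<in> Ew"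
  proof (cases "i = n \<and> agree n u a")
    case True
    then have "agree (Suc n) u a" using agree_mono by auto
    then have "fst \<gamma> (Suc n) a = fst \<gamma>' (Suc n) a"
      using valid_fst[OF v(1), of "Suc n" u a] valid_fst[OF v(2), of "Suc n" u a] n eq by simp
    then show ?thesis using True 2 by (auto simp: fst_mix snd_mix)
  next
    case False
    then show ?thesis using 1 2 by (auto simp: fst_mix snd_mix)
  qed
qed

lemma valid_same_on:
  assumes same: "same_on m s \<gamma> \<gamma>'" and v: "valid m s \<gamma>"
  shows "valid m s \<gamma>'"
proof -
  have eq: "fst \<gamma>' n u = fst \<gamma> n u" if "n \<le> s" "length u = m" for n u
    using same that by (simp add: same_on_def)
  have eq': "snd \<gamma>' n u = snd \<gamma> n u" if "n < s" "length u = m" for n u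
    using same that by (simp add: same_on_def)
  show ?thesis unfolding valid_def
  proof (intro conjI allI impI; elim conjE)
    fix n u v assume "n \<le> s" "length u = m" "agree n u v"
    then show "fst \<gamma>' n u = fst \<gamma>' n v"
      using eq[of n u] eq[of n v] valid_fst[OF v, of n u v] agree_length[of n u v] by simp
  next
    fix n u v assume "n < s" "length u = m" "agree n u v"
    then show "snd \<gamma>' n u = snd \<gamma>' n v"
      using eq'[of n u] eq'[of n v] valid_snd[OF v, of n u v] agree_length[of n u v] by simp
  next
    fix n and u :: "bool list" assume "n < s" "length u = m"
    then show "(fst \<gamma>' n u, fst \<gamma>' (Suc n) u, snd \<gamma>' n u) \<in> Ew"
      using eq[of n u] eq[of "Suc n" u] eq'[of n u] valid_Ew[OF v, of n u] by simp
  qed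
qed

text \<open>Closure under grafting lets the part below a hub vary independently of the rest. Closure
  under \<open>same_on\<close> leaves the irrelevant entries free, so that a level can be added by
  overwriting them.\<close>

definition condition :: "nat \<Rightarrow> nat \<Rightarrow> config set \<Rightarrow> bool" where
  "condition m s G \<longleftrightarrow> G \<in> sets borel \<and> (\<forall>\<gamma>\<in>G. valid m s \<gamma>) \<and>
     (\<forall>\<gamma>\<in>G. \<forall>\<gamma>'\<in>G. \<forall>n<s. \<forall>u. length u = m \<longrightarrow> fst \<gamma> (Suc n) u = fst \<gamma>' (Suc n) u \<longrightarrow> mix n u \<gamma> \<gamma>' \<in> G) \<and>
     (\<forall>\<gamma>\<in>G. \<forall>\<gamma>'. same_on m s \<gamma> \<gamma>' \<longrightarrow> \<gamma>' \<in> G)"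

lemma conditionD:
  assumes "condition m s G"
  shows "G \<in> sets borel" "\<And>\<gamma>. \<gamma> \<in> G \<Longrightarrow> valid m s \<gamma>"
    "\<And>\<gamma> \<gamma>' n u. \<gamma> \<in> G \<Longrightarrow> \<gamma>' \<in> G \<Longrightarrow> n < s \<Longrightarrow> length u = m \<Longrightarrow>
       fst \<gamma> (Suc n) u = fst \<gamma>' (Suc n) u \<Longrightarrow> mix n u \<gamma> \<gamma>' \<in> G"
    "\<And>\<gamma> \<gamma>'. \<gamma> \<in> G \<Longrightarrow> same_on m s \<gamma> \<gamma>' \<Longrightarrow> \<gamma>' \<in> G"
  using assms unfolding condition_def by auto

lemma condition_Int:
  assumes G: "condition m s G" and H: "H \<in> sets borel"
    and "\<And>\<gamma> \<gamma>' n u. \<gamma> \<in> G \<Longrightarrow> \<gamma> \<in> H \<Longrightarrow> \<gamma>' \<in> G \<Longrightarrow> \<gamma>' \<in> H \<Longrightarrow> n < s \<Longrightarrow> length u = m \<Longrightarrow>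
       fst \<gamma> (Suc n) u = fst \<gamma>' (Suc n) u \<Longrightarrow> mix n u \<gamma> \<gamma>' \<in> H"
    and "\<And>\<gamma> \<gamma>'. \<gamma> \<in> H \<Longrightarrow> same_on m s \<gamma> \<gamma>' \<Longrightarrow> \<gamma>' \<in> H"
  shows "condition m s (G \<inter> H)"
  unfolding condition_def using conditionD[OF G] assms(2-4) by auto

text \<open>A triple \<open>(k, l, n)\<close> records the decision that the \<open>E\<^sub>k\<close>-class of the value at leaf \<open>l\<close> is a
  function of the point at level \<open>n\<close> above it, but cannot be captured by countably many Borel
  choices from the point at level \<open>n + 1\<close>. The second half is part of \<open>positive\<close> below.\<close>

definition determined :: "(nat \<times> bool list \<times> nat) set \<Rightarrow> config set \<Rightarrow> bool" where
  "determined P G \<longleftrightarrow> (\<forall>k l n \<gamma> \<gamma>'. (k, l, n) \<in> P \<longrightarrow> \<gamma> \<in> G \<longrightarrow> \<gamma>' \<in> G \<longrightarrow> fst \<gamma> n l = fst \<gamma>' n l \<longrightarrow>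
     (fst \<gamma> 0 l, fst \<gamma>' 0 l) \<in> Ek k)"

lemma determined_mono: "determined P G \<Longrightarrow> G' \<subseteq> G \<Longrightarrow> determined P G'"
  unfolding determined_def by blast

definition ideals :: "(nat \<Rightarrow> (baire \<times> baire) set) \<Rightarrow> baire set \<Rightarrow> bool" where
  "ideals Z W \<longleftrightarrow> (\<forall>k. section_ideal k (Z k)) \<and> W \<in> sets borel \<and> index_ideal W"

lemma ideals_UN: "(\<And>i::nat. ideals (Z i) (W i)) \<Longrightarrow> ideals (\<lambda>k. \<Union>i. Z i k) (\<Union>i. W i)"
  unfolding ideals_def by (auto intro: section_ideal_UN index_ideal_UN)

lemma ideals_empty: "ideals (\<lambda>_. {}) {}"
  by (simp add: ideals_def)

text \<open>The triple \<open>t\<close> is taken apart by projections, so that Borelness follows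
  from a single countable conjunction.\<close>

definition avoids :: "nat \<Rightarrow> (nat \<times> bool list \<times> nat) set \<Rightarrow> (nat \<Rightarrow> (baire \<times> baire) set) \<Rightarrow> baire set \<Rightarrow> config \<Rightarrow> bool" where
  "avoids m P Z W \<gamma> \<longleftrightarrow> (\<forall>u. length u = m \<longrightarrow> fst \<gamma> 0 u \<notin> W) \<and>
     (\<forall>t. t \<in> P \<longrightarrow> (fst \<gamma> 0 (fst (snd t)), fst \<gamma> (Suc (snd (snd t))) (fst (snd t))) \<notin> Z (fst t))"

lemma avoidsD:
  assumes "avoids m P Z W \<gamma>"
  shows "\<And>u. length u = m \<Longrightarrow> fst \<gamma> 0 u \<notin> W"
    "\<And>k l n. (k, l, n) \<in> P \<Longrightarrow> (fst \<gamma> 0 l, fst \<gamma> (Suc n) l) \<notin> Z k"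
  using assms unfolding avoids_def by force+

lemma avoids_mono:
  assumes "avoids m P Z W \<gamma>" "\<And>k. Z' k \<subseteq> Z k" "W' \<subseteq> W" "P' \<subseteq> P"
  shows "avoids m P' Z' W' \<gamma>"
  using assms unfolding avoids_def by blast

lemma borel_avoids: "ideals Z W \<Longrightarrow> {\<gamma>. avoids m P Z W \<gamma>} \<in> sets borel"
proof -
  assume id: "ideals Z W"
  have 1: "{\<gamma>::config. fst \<gamma> 0 u \<notin> W} \<in> sets borel" for u
  proof -
    have "(\<lambda>\<gamma>::config. fst \<gamma> 0 u) -` (- W) \<in> sets borel"
      by (intro borel_vimage continuous_fst_config borel_comp) (use id in \<open>simp add: ideals_def\<close>)
    then show ?thesis by (simp add: vimage_def)
  qed
  have 2: "{\<gamma>::config. (fst \<gamma> 0 l, fst \<gamma> n l) \<notin> Z k} \<in> sets borel" for k l n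
  proof -
    have "(\<lambda>\<gamma>::config. (fst \<gamma> 0 l, fst \<gamma> n l)) -` (- Z k) \<in> sets borel"
      using id by (intro borel_vimage continuous_on_Pair continuous_fst_config borel_comp)
        (auto simp: ideals_def intro: section_ideal_borel)
    then show ?thesis by (simp add: vimage_def)
  qed
  show ?thesis unfolding avoids_def
    by (intro borel_Collect_conj borel_Collect_all borel_Collect_imp 1 2)
qed

text \<open>Largeness: by \<open>positive_split\<close>, the sets of configurations that fail this
  form a sigma-ideal.\<close>

definition positive :: "nat \<Rightarrow> (nat \<times> bool list \<times> nat) set \<Rightarrow> config set \<Rightarrow> bool" where
  "positive m P G \<longleftrightarrow> (\<forall>Z W. ideals Z W \<longrightarrow> (\<exists>\<gamma>\<in>G. avoids m P Z W \<gamma>))"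

lemma positiveD:
  assumes "positive m P G" "ideals Z W"
  obtains \<gamma> where "\<gamma> \<in> G" "avoids m P Z W \<gamma>"
  using assms unfolding positive_def by metis

lemma positive_mono: "positive m P G \<Longrightarrow> G \<subseteq> G' \<Longrightarrow> positive m P G'"
  unfolding positive_def by blast

lemma positive_nonempty: "positive m P G \<Longrightarrow> G \<noteq> {}"
  unfolding positive_def using ideals_empty by blast

text \<open>If every piece misses some member of the ideals, the union of these members witnesses
  that the whole is not large, both ideals being closed under countable unions.\<close>

lemma positive_split:
  assumes G: "positive m P G" "G \<subseteq> (\<Union>i::nat. H i)"
  shows "\<exists>i. positive m P (G \<inter> H i)"
proof (rule ccontr)
  assume "\<not> ?thesis"
  then have "\<forall>i. \<exists>Z W. ideals Z W \<and> (\<forall>\<gamma>\<in>G \<inter> H i. \<not> avoids m P Z W \<gamma>)"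
    unfolding positive_def by blast
  then obtain Z W where ZW: "\<And>i. ideals (Z i) (W i)" "\<And>i \<gamma>. \<gamma> \<in> G \<inter> H i \<Longrightarrow> \<not> avoids m P (Z i) (W i) \<gamma>"
    by metis
  obtain \<gamma> where \<gamma>: "\<gamma> \<in> G" "avoids m P (\<lambda>k. \<Union>i. Z i k) (\<Union>i. W i) \<gamma>"
    by (rule positiveD[OF G(1) ideals_UN[OF ZW(1)]])
  obtain i where "\<gamma> \<in> H i" using \<gamma>(1) G(2) by auto
  moreover have "avoids m P (Z i) (W i) \<gamma>" by (rule avoids_mono[OF \<gamma>(2)]) auto
  ultimately show False using ZW(2)[of \<gamma> i] \<gamma>(1) by simp
qed

definition good :: "nat \<Rightarrow> nat \<Rightarrow> (nat \<times> bool list \<times> nat) set \<Rightarrow> config set \<Rightarrow> bool" where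
  "good m s P G \<longleftrightarrow> condition m s G \<and> determined P G \<and> positive m P G \<and>
     (\<forall>k l n. (k, l, n) \<in> P \<longrightarrow> length l = m \<and> n < s)"

lemma mix_avoids:
  assumes G: "condition m s G" "determined P G" and P: "\<And>k l n. (k, l, n) \<in> P \<Longrightarrow> n < s"
    and Z: "ideals Z W" and \<gamma>: "\<gamma> \<in> G" "\<gamma>' \<in> G" "avoids m P Z W \<gamma>" "avoids m P Z W \<gamma>'"
    and n: "n < s" "length u = m" and eq: "fst \<gamma> (Suc n) u = fst \<gamma>' (Suc n) u"
  shows "avoids m P Z W (mix n u \<gamma> \<gamma>')"
proof -
  let ?\<delta> = "mix n u \<gamma> \<gamma>'"
  have \<delta>: "?\<delta> \<in> G" using conditionD(3)[OF G(1) \<gamma>(1,2) n eq] .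
  have "(fst ?\<delta> 0 l, fst ?\<delta> (Suc i) l) \<notin> Z k" if kl: "(k, l, i) \<in> P" for k l i
  proof (cases "agree n u l")
    case False
    then show ?thesis using avoidsD(2)[OF \<gamma>(3) kl] by (simp add: fst_mix)
  next
    case True
    consider "Suc i \<le> n" | "i = n" | "n < i" by linarith
    then show ?thesis
    proof cases
      case 1
      then show ?thesis using avoidsD(2)[OF \<gamma>(4) kl] True by (simp add: fst_mix)
    next
      case 2
      have "agree (Suc n) u l" using True agree_mono by auto
      then have "fst \<gamma> (Suc n) l = fst \<gamma>' (Suc n) l"
        using valid_fst[OF conditionD(2)[OF G(1) \<gamma>(1)], of "Suc n" u l]
          valid_fst[OF conditionD(2)[OF G(1) \<gamma>(2)], of "Suc n" u l] n eq by simp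
      then show ?thesis using avoidsD(2)[OF \<gamma>(4) kl] True 2 by (simp add: fst_mix)
    next
      \<comment> \<open>The leaf comes from \<open>\<gamma>'\<close>, the point at level
        \<open>i + 1\<close> from \<open>\<gamma>\<close>. The unchanged point at level
        \<open>i\<close> fixes the class of the leaf, and \<open>Z k\<close> is invariant in the
        leaf.\<close>
      case 3
      then have "fst ?\<delta> i l = fst \<gamma> i l" "fst ?\<delta> (Suc i) l = fst \<gamma> (Suc i) l"
        by (auto simp: fst_mix)
      moreover then have "(fst ?\<delta> 0 l, fst \<gamma> 0 l) \<in> Ek k"
        using G(2) kl \<delta> \<gamma>(1) unfolding determined_def by blast
      ultimately show ?thesis
        using avoidsD(2)[OF \<gamma>(3) kl] Z section_ideal_invariant[of k "Z k"] unfolding ideals_def by metis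
    qed
  qed
  moreover have "fst ?\<delta> 0 v \<notin> W" if "length v = m" for v
    using avoidsD(1)[OF \<gamma>(3) that] avoidsD(1)[OF \<gamma>(4) that] by (simp add: fst_mix)
  ultimately show ?thesis unfolding avoids_def by auto
qed

lemma analytic_image_avoiding:
  assumes "condition m s G" "ideals Z W" "continuous_on UNIV (f :: config \<Rightarrow> 'b::topological_space)"
  shows "analytic euclidean (f ` {\<gamma>\<in>G. avoids m P Z W \<gamma>})"
proof -
  have "{\<gamma>\<in>G. avoids m P Z W \<gamma>} = G \<inter> {\<gamma>. avoids m P Z W \<gamma>}" by auto
  also have "\<dots> \<in> sets borel" using conditionD(1)[OF assms(1)] borel_avoids[OF assms(2)] by auto
  finally show ?thesis by (intro analytic_image analytic_of_borel cm_config assms(3))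
qed

text \<open>Otherwise, mixing two configurations below level \<open>n + 1\<close> shows that the point at that level
  determines the \<open>E\<^sub>k\<close>-class of the leaf, and reflection yields a member of the ideal that every
  configuration hits.\<close>

lemma positive_separate:
  assumes G: "good m s P G" and kl: "(k, l, n) \<in> P" and l': "length l' = m" "\<not> agree n l l'"
  shows "positive m P (G \<inter> {\<gamma>. (fst \<gamma> 0 l, fst \<gamma> 0 l') \<notin> Ek k})"
proof (rule ccontr)
  assume "\<not> ?thesis"
  then obtain Z W where ZW: "ideals Z W"
    and hit: "\<And>\<gamma>. \<gamma> \<in> G \<Longrightarrow> avoids m P Z W \<gamma> \<Longrightarrow> (fst \<gamma> 0 l, fst \<gamma> 0 l') \<in> Ek k"
    unfolding positive_def by auto
  have c: "condition m s G" "determined P G" "positive m P G" "\<And>k l n. (k, l, n) \<in> P \<Longrightarrow> length l = m \<and> n < s"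
    using G unfolding good_def by blast+
  define \<Gamma> where "\<Gamma> = {\<gamma>\<in>G. avoids m P Z W \<gamma>}"
  define R where "R = (\<lambda>\<gamma>. (fst \<gamma> 0 l, fst \<gamma> (Suc n) l)) ` \<Gamma>"
  have n: "n < s" "length l = m" using c(4)[OF kl] by auto
  have "analytic euclidean R" unfolding R_def \<Gamma>_def
    by (intro analytic_image_avoiding[OF c(1) ZW] continuous_on_Pair continuous_fst_config)
  moreover have "small_sections k R" unfolding small_sections_def
  proof (intro allI impI)
    fix x x' y assume "(x, y) \<in> R" "(x', y) \<in> R"
    then obtain \<gamma> \<gamma>' where g: "\<gamma> \<in> \<Gamma>" "\<gamma>' \<in> \<Gamma>" "x = fst \<gamma> 0 l" "x' = fst \<gamma>' 0 l"
      "fst \<gamma> (Suc n) l = fst \<gamma>' (Suc n) l" unfolding R_def by auto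
    let ?\<delta> = "mix n l \<gamma> \<gamma>'"
    have "?\<delta> \<in> G" using conditionD(3)[OF c(1) _ _ n g(5)] g(1,2) by (simp add: \<Gamma>_def)
    moreover have "avoids m P Z W ?\<delta>"
      by (rule mix_avoids[OF c(1,2) _ ZW _ _ _ _ n g(5)]) (use g(1,2) c(4) in \<open>auto simp: \<Gamma>_def\<close>)
    ultimately have "(fst ?\<delta> 0 l, fst ?\<delta> 0 l') \<in> Ek k" by (rule hit)
    \<comment> \<open>\<open>l'\<close> lies outside the graft and keeps its value, which serves as
      a common reference for the two values at \<open>l\<close>.\<close>
    then have "(x', fst \<gamma> 0 l') \<in> Ek k" using l'(2) g(4) by (simp add: fst_mix)
    moreover have "(x, fst \<gamma> 0 l') \<in> Ek k" using hit g(1,3) by (simp add: \<Gamma>_def)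
    ultimately show "(x, x') \<in> Ek k" by (blast intro: Ek_sym Ek_trans)
  qed
  ultimately obtain R' where R': "R' \<in> sets borel" "R \<subseteq> R'" "small_sections k R'" "invariant_sections k R'"
    by (rule reflection)
  have "section_ideal k R'" unfolding section_ideal_def using R' by (intro exI[of _ "\<lambda>_. R'"]) auto
  then have "ideals (Z(k := Z k \<union> R')) W"
    using ZW section_ideal_Un unfolding ideals_def by auto
  then obtain \<gamma> where \<gamma>: "\<gamma> \<in> G" "avoids m P (Z(k := Z k \<union> R')) W \<gamma>"
    by (rule positiveD[OF c(3)])
  have "avoids m P Z W \<gamma>" by (rule avoids_mono[OF \<gamma>(2)]) auto
  then have "(fst \<gamma> 0 l, fst \<gamma> (Suc n) l) \<in> R'" using R'(2) \<gamma>(1) unfolding R_def \<Gamma>_def by auto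
  then show False using avoidsD(2)[OF \<gamma>(2) kl] by simp
qed

end

section \<open>Transformations and finite approximations of configurations\<close>

definition add_top :: "nat \<Rightarrow> baire \<Rightarrow> baire \<Rightarrow> config \<Rightarrow> config" where
  "add_top s y w \<gamma> = ((fst \<gamma>)(Suc s := \<lambda>_. y), (snd \<gamma>)(s := \<lambda>_. w))"

definition copy :: "bool \<Rightarrow> config \<Rightarrow> config" where
  "copy b \<gamma> = (\<lambda>n u. fst \<gamma> n (u @ [b]), \<lambda>n u. snd \<gamma> n (u @ [b]))"

definition diagonal :: "config \<Rightarrow> config" where
  "diagonal \<gamma> = (\<lambda>n u. fst \<gamma> n (butlast u), \<lambda>n u. snd \<gamma> n (butlast u))"

definition close :: "nat \<Rightarrow> nat \<Rightarrow> nat \<Rightarrow> config \<Rightarrow> config \<Rightarrow> bool" where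
  "close N m s \<gamma> \<gamma>' \<longleftrightarrow> (\<forall>n u. n \<le> s \<and> length u = m \<longrightarrow> fst \<gamma> n u \<in> cyl (fst \<gamma>' n u) N) \<and>
     (\<forall>n u. n < s \<and> length u = m \<longrightarrow> snd \<gamma> n u \<in> cyl (snd \<gamma>' n u) N)"

lemma close_sym: "close N m s \<gamma> \<gamma>' \<Longrightarrow> close N m s \<gamma>' \<gamma>"
  by (simp add: close_def cyl_def)

lemma close_trans: "close N m s \<gamma> \<gamma>' \<Longrightarrow> close N m s \<gamma>' \<gamma>'' \<Longrightarrow> close N m s \<gamma> \<gamma>''"
  by (simp add: close_def cyl_def)

lemma close_mix:
  assumes "close N m s \<gamma> \<delta>" "close N m s \<gamma>' \<delta>"
  shows "close N m s (mix n u \<gamma> \<gamma>') \<delta>"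
  using assms by (simp add: close_def fst_mix snd_mix)

lemma close_same_on: "close N m s \<gamma> \<delta> \<Longrightarrow> same_on m s \<gamma> \<gamma>' \<Longrightarrow> close N m s \<gamma>' \<delta>"
  by (simp add: close_def same_on_def cyl_def)

lemma borel_close: "{\<gamma>. close N m s \<gamma> \<delta>} \<in> sets borel"
proof -
  have "{\<gamma>::config. fst \<gamma> n u \<in> cyl x N} \<in> sets borel" "{\<gamma>::config. snd \<gamma> n u \<in> cyl x N} \<in> sets borel" for n u x
    using borel_vimage[OF continuous_fst_config borel_open[OF open_cyl], of n u x N]
      borel_vimage[OF continuous_snd_config borel_open[OF open_cyl], of n u x N]
    by (simp_all add: vimage_def)
  then show ?thesis unfolding close_def
    by (intro borel_Collect_conj borel_Collect_all borel_Collect_imp)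
qed

text \<open>Nested lists keep the codes in a countable type, so that \<open>positive_split\<close>
  can fix the code.\<close>

definition code :: "nat \<Rightarrow> nat \<Rightarrow> nat \<Rightarrow> config \<Rightarrow> nat list list list \<times> nat list list list" where
  "code N m s \<gamma> = (let us = List.n_lists m [False, True] in
     (map (\<lambda>n. map (\<lambda>u. map (fst \<gamma> n u) [0..<N]) us) [0..<Suc s],
      map (\<lambda>n. map (\<lambda>u. map (snd \<gamma> n u) [0..<N]) us) [0..<s]))"

lemma close_if_code_eq:
  assumes "code N m s \<gamma> = code N m s \<delta>"
  shows "close N m s \<gamma> \<delta>"
proof -
  have us: "u \<in> set (List.n_lists m [False, True])" if "length u = m" for u
    using that by (auto simp: set_n_lists)
  have *: "\<forall>n\<in>set [0..<Suc s]. \<forall>u\<in>set (List.n_lists m [False, True]). \<forall>i\<in>set [0..<N]. fst \<gamma> n u i = fst \<delta> n u i"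
    "\<forall>n\<in>set [0..<s]. \<forall>u\<in>set (List.n_lists m [False, True]). \<forall>i\<in>set [0..<N]. snd \<gamma> n u i = snd \<delta> n u i"
    using assms unfolding code_def Let_def prod.inject map_eq_conv by blast+
  have "fst \<gamma> n u i = fst \<delta> n u i" if "n \<le> s" "length u = m" "i < N" for n u i
    by (rule *(1)[THEN bspec, THEN bspec, THEN bspec]) (use that us in auto)
  moreover have "snd \<gamma> n u i = snd \<delta> n u i" if "n < s" "length u = m" "i < N" for n u i
    by (rule *(2)[THEN bspec, THEN bspec, THEN bspec]) (use that us in auto)
  ultimately show ?thesis by (simp add: close_def cyl_def)
qed

context baire_relations
begin

lemma add_top_simps:
  "fst (add_top s y w \<gamma>) n u = (if n = Suc s then y else fst \<gamma> n u)"
  "snd (add_top s y w \<gamma>) n u = (if n = s then w else snd \<gamma> n u)"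
  by (simp_all add: add_top_def)

text \<open>Since a condition leaves level \<open>s + 1\<close> free, imposing validity there
  already adds a hub above the old root, and by \<open>add_top_in_add_root\<close> every point that
  is \<open>E\<close>-related to the old root occurs as its value.\<close>

definition add_root :: "nat \<Rightarrow> nat \<Rightarrow> config set \<Rightarrow> config set" where
  "add_root m s G = {\<gamma>\<in>G. valid m (Suc s) \<gamma>}"

lemma condition_add_root:
  assumes G: "condition m s G" and root: "\<And>u v. length u = m \<Longrightarrow> length v = m \<Longrightarrow> agree s u v"
  shows "condition m (Suc s) (add_root m s G)"
  unfolding condition_def
proof (intro conjI ballI allI impI)
  have "add_root m s G = G \<inter> {\<gamma>. valid m (Suc s) \<gamma>}" by (auto simp: add_root_def)
  then show "add_root m s G \<in> sets borel"
    using sets.Int[OF conditionD(1)[OF G] borel_valid] by simp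
next
  fix \<gamma> assume "\<gamma> \<in> add_root m s G"
  then show "valid m (Suc s) \<gamma>" by (simp add: add_root_def)
next
  fix \<gamma> \<gamma>' n u
  assume g: "\<gamma> \<in> add_root m s G" "\<gamma>' \<in> add_root m s G" and n: "n < Suc s" "length u = m"
    and eq: "fst \<gamma> (Suc n) u = fst \<gamma>' (Suc n) u"
  have "mix n u \<gamma> \<gamma>' \<in> G"
  proof (cases "n = s")
    case True
    \<comment> \<open>All leaves share the root at level \<open>s\<close>, so a graft there replaces
      everything up to that level.\<close>
    have "same_on m s \<gamma>' (mix n u \<gamma> \<gamma>')"
      using root[OF n(2)] by (simp add: same_on_def fst_mix snd_mix True)
    from conditionD(4)[OF G _ this] show ?thesis using g(2) by (simp add: add_root_def)
  next
    case False
    then show ?thesis using conditionD(3)[OF G _ _ _ n(2) eq] g n(1) by (auto simp: add_root_def)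
  qed
  moreover have "valid m (Suc s) (mix n u \<gamma> \<gamma>')"
    using valid_mix[OF _ _ n eq] g by (simp add: add_root_def)
  ultimately show "mix n u \<gamma> \<gamma>' \<in> add_root m s G" by (simp add: add_root_def)
next
  fix \<gamma> \<gamma>' assume g: "\<gamma> \<in> add_root m s G" "same_on m (Suc s) \<gamma> \<gamma>'"
  then have "same_on m s \<gamma> \<gamma>'" by (simp add: same_on_def)
  then show "\<gamma>' \<in> add_root m s G"
    using g conditionD(4)[OF G, of \<gamma> \<gamma>'] valid_same_on[OF g(2)] by (simp add: add_root_def)
qed

lemma add_top_in_add_root:
  assumes G: "condition m s G" and root: "\<And>u v. length u = m \<Longrightarrow> length v = m \<Longrightarrow> agree s u v"
    and \<gamma>: "\<gamma> \<in> G" and w: "length u = m" "(fst \<gamma> s u, y, w) \<in> Ew"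
  shows "add_top s y w \<gamma> \<in> add_root m s G"
proof -
  have v: "valid m s \<gamma>" using conditionD(2)[OF G \<gamma>] .
  have "same_on m s \<gamma> (add_top s y w \<gamma>)" by (simp add: same_on_def add_top_simps)
  then have "add_top s y w \<gamma> \<in> G" using conditionD(4)[OF G \<gamma>] by simp
  moreover have "valid m (Suc s) (add_top s y w \<gamma>)" unfolding valid_def
  proof (intro conjI allI impI; elim conjE)
    fix n a b assume "n \<le> Suc s" "length a = m" "agree n a b"
    then show "fst (add_top s y w \<gamma>) n a = fst (add_top s y w \<gamma>) n b"
      using valid_fst[OF v, of n a b] by (auto simp: add_top_simps)
  next
    fix n a b assume "n < Suc s" "length a = m" "agree n a b"
    then show "snd (add_top s y w \<gamma>) n a = snd (add_top s y w \<gamma>) n b"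
      using valid_snd[OF v, of n a b] by (auto simp: add_top_simps)
  next
    fix n and a :: "bool list" assume n: "n < Suc s" "length a = m"
    show "(fst (add_top s y w \<gamma>) n a, fst (add_top s y w \<gamma>) (Suc n) a, snd (add_top s y w \<gamma>) n a) \<in> Ew"
    proof (cases "n = s")
      case True
      have "fst \<gamma> s a = fst \<gamma> s u" using valid_fst[OF v _ n(2) root[OF n(2) w(1)]] by simp
      then show ?thesis using True w(2) by (simp add: add_top_simps)
    next
      case False
      then show ?thesis using valid_Ew[OF v _ n(2), of n] n(1) by (simp add: add_top_simps)
    qed
  qed
  ultimately show ?thesis by (simp add: add_root_def)
qed

text \<open>All critical levels are below \<open>s\<close>, so \<open>avoids\<close> reads nothing
  above level \<open>s\<close>.\<close>

lemma avoids_add_top: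
  assumes "\<And>k l n. (k, l, n) \<in> P \<Longrightarrow> n < s"
  shows "avoids m P Z W (add_top s y w \<gamma>) \<longleftrightarrow> avoids m P Z W \<gamma>"
proof -
  have "Suc (snd (snd t)) \<noteq> Suc s" if "t \<in> P" for t
    using assms[of "fst t" "fst (snd t)" "snd (snd t)"] that by simp
  then show ?thesis unfolding avoids_def add_top_simps
    by (intro conj_cong refl all_cong1 imp_cong) simp_all
qed

lemma valid_E: "valid m s \<gamma> \<Longrightarrow> n \<le> s \<Longrightarrow> length u = m \<Longrightarrow> (fst \<gamma> 0 u, fst \<gamma> n u) \<in> E"
proof (induction n)
  case (Suc n)
  have "(fst \<gamma> n u, fst \<gamma> (Suc n) u) \<in> E"
    using valid_Ew[OF Suc.prems(1), of n u] Suc.prems unfolding E_iff by auto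
  then show ?case using Suc E_trans by (meson Suc_leD)
qed (simp add: E_refl)

lemma positive_avoids:
  assumes G: "positive m P G" and Z: "ideals Z W"
  shows "positive m P {\<gamma>\<in>G. avoids m P Z W \<gamma>}"
  unfolding positive_def
proof (intro allI impI)
  fix Z' W' assume "ideals Z' W'"
  then have "ideals (\<lambda>k. Z k \<union> Z' k) (W \<union> W')"
    using Z section_ideal_Un index_ideal_Un unfolding ideals_def by auto
  then obtain \<gamma> where \<gamma>: "\<gamma> \<in> G" "avoids m P (\<lambda>k. Z k \<union> Z' k) (W \<union> W') \<gamma>"
    by (rule positiveD[OF G])
  moreover have "avoids m P Z W \<gamma>" "avoids m P Z' W' \<gamma>"
    by (rule avoids_mono[OF \<gamma>(2)]; simp)+
  ultimately show "\<exists>\<gamma>\<in>{\<gamma>\<in>G. avoids m P Z W \<gamma>}. avoids m P Z' W' \<gamma>"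
    by (intro bexI[of _ \<gamma>]) simp_all
qed

lemma goodD:
  assumes "good m s P G"
  shows "condition m s G" "determined P G" "positive m P G"
    "\<And>k l n. (k, l, n) \<in> P \<Longrightarrow> length l = m" "\<And>k l n. (k, l, n) \<in> P \<Longrightarrow> n < s"
  using assms unfolding good_def by blast+

lemma determinedD:
  "determined P G \<Longrightarrow> (k, l, n) \<in> P \<Longrightarrow> \<gamma> \<in> G \<Longrightarrow> \<gamma>' \<in> G \<Longrightarrow> fst \<gamma> n l = fst \<gamma>' n l \<Longrightarrow>
    (fst \<gamma> 0 l, fst \<gamma>' 0 l) \<in> Ek k"
  unfolding determined_def by blast

lemma determined_insert:
  "determined (insert t P) G \<longleftrightarrow> determined {t} G \<and> determined P G"
  unfolding determined_def by blast

text \<open>If \<open>n\<close> is not a possible level for \<open>(k, l)\<close>, then after shrinking, the \<open>E\<^sub>k\<close>-class of the leaf is a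
  function of the point at level \<open>n + 1\<close>, and one moves up.\<close>

lemma decide_level:
  assumes G: "good m s P G" and l: "length l = m" and "n \<le> s"
  shows "(\<exists>G'\<subseteq>G. \<exists>i<n. good m s (insert (k, l, i) P) G') \<or>
    (\<exists>G'\<subseteq>G. good m s P G' \<and> determined {(k, l, n)} G')"
  using \<open>n \<le> s\<close>
proof (induction n)
  case 0
  \<comment> \<open>The point at level \<open>0\<close> is the value at the leaf itself.\<close>
  have "determined {(k, l, 0)} G" by (auto simp: determined_def Ek_refl)
  then show ?case using G by blast
next
  case (Suc n)
  then have n: "n < s" by simp
  from Suc consider (decided) G' i where "G' \<subseteq> G" "i < n" "good m s (insert (k, l, i) P) G'"
    | (det) G' where "G' \<subseteq> G" "good m s P G'" "determined {(k, l, n)} G'"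
    by (meson Suc_leD)
  then show ?case
  proof cases
    case decided
    then show ?thesis using less_SucI by metis
  next
    case det
    note c = goodD[OF det(2)]
    show ?thesis
    proof (cases "positive m (insert (k, l, n) P) G'")
      case True
      have "determined (insert (k, l, n) P) G'"
        using determined_insert[of "(k, l, n)" P G'] det(3) c(2) by simp
      then have "good m s (insert (k, l, n) P) G'"
        using c True n l unfolding good_def by auto
      then show ?thesis using det(1) by blast
    next
      case False
      then obtain Z W where ZW: "ideals Z W"
        and hit: "\<And>\<gamma>. \<gamma> \<in> G' \<Longrightarrow> \<not> avoids m (insert (k, l, n) P) Z W \<gamma>"
        unfolding positive_def by auto
      obtain R :: "nat \<Rightarrow> (baire \<times> baire) set" where
        R: "\<And>j. R j \<in> sets borel" "\<And>j. small_sections k (R j)" "\<And>j. invariant_sections k (R j)" "Z k = (\<Union>j. R j)"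
        using ZW unfolding ideals_def section_ideal_def by metis
      \<comment> \<open>As positivity fails, \<open>Z k\<close> catches every configuration that
        avoids the ideals for \<open>P\<close>. Restricting to those caught by one suitable
        \<open>R j\<close> keeps largeness and makes level \<open>n + 1\<close> determining.\<close>
      define H where "H j = {\<gamma>::config. (fst \<gamma> 0 l, fst \<gamma> (Suc n) l) \<in> R j}" for j
      have "{\<gamma>\<in>G'. avoids m P Z W \<gamma>} \<subseteq> (\<Union>j. H j)"
      proof
        fix \<gamma> assume "\<gamma> \<in> {\<gamma>\<in>G'. avoids m P Z W \<gamma>}"
        then have "(fst \<gamma> 0 l, fst \<gamma> (Suc n) l) \<in> Z k"
          using hit[of \<gamma>] unfolding avoids_def by auto
        then show "\<gamma> \<in> (\<Union>j. H j)" using R(4) by (auto simp: H_def)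
      qed
      then have "\<exists>j. positive m P ({\<gamma>\<in>G'. avoids m P Z W \<gamma>} \<inter> H j)"
        by (rule positive_split[OF positive_avoids[OF c(3) ZW]])
      then obtain j where "positive m P ({\<gamma>\<in>G'. avoids m P Z W \<gamma>} \<inter> H j)" ..
      then have pos: "positive m P (G' \<inter> H j)" by (rule positive_mono) auto
      have cond: "condition m s (G' \<inter> H j)"
      proof (rule condition_Int[OF c(1)])
        have "(\<lambda>\<gamma>::config. (fst \<gamma> 0 l, fst \<gamma> (Suc n) l)) -` R j \<in> sets borel"
          by (intro borel_vimage continuous_on_Pair continuous_fst_config R(1))
        then show "H j \<in> sets borel" by (simp add: H_def vimage_def)
      next
        fix \<gamma> \<gamma>' assume "\<gamma> \<in> H j" "same_on m s \<gamma> \<gamma>'"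
        then show "\<gamma>' \<in> H j" using l n by (simp add: H_def same_on_def)
      next
        fix \<gamma> \<gamma>' i u
        assume g: "\<gamma> \<in> G'" "\<gamma> \<in> H j" "\<gamma>' \<in> G'" "\<gamma>' \<in> H j" and i: "i < s" "length u = m"
          and eq: "fst \<gamma> (Suc i) u = fst \<gamma>' (Suc i) u"
        let ?\<delta> = "mix i u \<gamma> \<gamma>'"
        have \<delta>: "?\<delta> \<in> G'" using conditionD(3)[OF c(1) g(1,3) i eq] .
        show "?\<delta> \<in> H j"
        proof (cases "agree i u l")
          case False
          then show ?thesis using g(2) by (simp add: H_def fst_mix)
        next
          case True
          consider "Suc n \<le> i" | "i = n" | "i < n" by linarith
          then show ?thesis
          proof cases
            case 1
            then show ?thesis using g(4) True by (simp add: H_def fst_mix)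
          next
            case 2
            have "agree (Suc n) u l" using True 2 agree_mono by auto
            then have "fst \<gamma> (Suc n) l = fst \<gamma>' (Suc n) l"
              using valid_fst[OF conditionD(2)[OF c(1) g(1)], of "Suc n" u l]
                valid_fst[OF conditionD(2)[OF c(1) g(3)], of "Suc n" u l] i eq 2 by simp
            then show ?thesis using g(4) True 2 by (simp add: H_def fst_mix)
          next
            \<comment> \<open>The graft stays below the point at level \<open>n\<close>, which
              determines the class of the leaf; invariance of \<open>R j\<close> absorbs the
              change.\<close>
            case 3
            then have "fst ?\<delta> n l = fst \<gamma> n l" "fst ?\<delta> (Suc n) l = fst \<gamma> (Suc n) l"
              by (auto simp: fst_mix)
            moreover then have "(fst \<gamma> 0 l, fst ?\<delta> 0 l) \<in> Ek k"
              using determinedD[OF det(3) insertI1 g(1) \<delta>] by simp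
            ultimately show ?thesis
              using g(2) R(3)[of j] unfolding H_def invariant_sections_def by auto
          qed
        qed
      qed
      have "determined {(k, l, Suc n)} (G' \<inter> H j)"
        unfolding determined_def
      proof (intro allI impI)
        fix k' l' n' and \<gamma> \<gamma>' :: config
        assume "(k', l', n') \<in> {(k, l, Suc n)}" "\<gamma> \<in> G' \<inter> H j" "\<gamma>' \<in> G' \<inter> H j"
          "fst \<gamma> n' l' = fst \<gamma>' n' l'"
        then show "(fst \<gamma> 0 l', fst \<gamma>' 0 l') \<in> Ek k'"
          using R(2)[of j] unfolding small_sections_def H_def by simp blast
      qed
      moreover have "good m s P (G' \<inter> H j)"
        using c cond pos determined_mono[OF c(2), of "G' \<inter> H j"] unfolding good_def by blast
      moreover have "G' \<inter> H j \<subseteq> G" using det(1) by auto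
      ultimately show ?thesis by metis
    qed
  qed
qed

text \<open>If a new root cannot serve, then for each leaf value \<open>x\<close> that avoids the ideals, the whole
  class of \<open>x\<close> lies in the section ideal, so that \<open>x\<close> falls into \<open>index_ideal\<close>.\<close>

lemma decide_leaf:
  assumes G: "good m s P G" and l: "length l = m"
    and root: "\<And>u v. length u = m \<Longrightarrow> length v = m \<Longrightarrow> agree s u v"
  obtains G' i where "G' \<subseteq> G" "i \<le> s" "good m (Suc s) (insert (k, l, i) P) G'"
proof -
  have sub: "add_root m s G' \<subseteq> G'" for G' by (auto simp: add_root_def)
  consider (decided) G' i where "G' \<subseteq> G" "i < s" "good m s (insert (k, l, i) P) G'"
    | (det) G' where "G' \<subseteq> G" "good m s P G'" "determined {(k, l, s)} G'"
    using decide_level[OF G l order_refl, of k] by metis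
  then show ?thesis
  proof cases
    case decided
    let ?P = "insert (k, l, i) P"
    note c = goodD[OF decided(3)]
    have "positive m ?P (add_root m s G')" unfolding positive_def
    proof (intro allI impI)
      fix Z W assume "ideals Z W"
      then obtain \<gamma> where \<gamma>: "\<gamma> \<in> G'" "avoids m ?P Z W \<gamma>" by (rule positiveD[OF c(3)])
      \<comment> \<open>The decision fell on an old level, and the new root just repeats the old
        one. Thus every leaf costs exactly one level, whatever the decision.\<close>
      obtain w where w: "(fst \<gamma> s l, fst \<gamma> s l, w) \<in> Ew" using E_refl unfolding E_iff by metis
      have "avoids m ?P Z W (add_top s (fst \<gamma> s l) w \<gamma>)"
        by (rule iffD2[OF avoids_add_top]) (erule c(5), rule \<gamma>(2))
      then show "\<exists>\<gamma>\<in>add_root m s G'. avoids m ?P Z W \<gamma>"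
        using add_top_in_add_root[OF c(1) root \<gamma>(1) l w] by (rule bexI)
    qed
    then have "good m (Suc s) ?P (add_root m s G')"
      unfolding good_def using condition_add_root[OF c(1) root] determined_mono[OF c(2) sub] c(4,5)
      using less_SucI by blast
    then show ?thesis using that[of "add_root m s G'" i] decided(1,2) sub[of G'] by simp
  next
    case det
    let ?P = "insert (k, l, s) P"
    note c = goodD[OF det(2)]
    have "positive m ?P (add_root m s G')" unfolding positive_def
    proof (intro allI impI)
      fix Z W assume ZW: "ideals Z W"
      show "\<exists>\<gamma>\<in>add_root m s G'. avoids m ?P Z W \<gamma>"
      proof (rule ccontr)
        assume neg: "\<not> ?thesis"
        define \<Theta> where "\<Theta> = (\<lambda>\<gamma>. fst \<gamma> 0 l) ` {\<gamma>\<in>G'. avoids m P Z W \<gamma>}"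
        have "analytic euclidean \<Theta>" unfolding \<Theta>_def
          by (intro analytic_image_avoiding[OF c(1) ZW] continuous_fst_config)
        moreover have "(x, y) \<in> Z k" if xy: "x \<in> \<Theta>" "(x, y) \<in> E" for x y
        proof -
          obtain \<gamma> where \<gamma>: "\<gamma> \<in> G'" "avoids m P Z W \<gamma>" "x = fst \<gamma> 0 l"
            using xy(1) by (auto simp: \<Theta>_def)
          have "(fst \<gamma> 0 l, fst \<gamma> s l) \<in> E"
            using valid_E[OF conditionD(2)[OF c(1) \<gamma>(1)] order_refl l] .
          then have "(fst \<gamma> s l, y) \<in> E" using xy(2) \<gamma>(3) by (blast intro: E_sym E_trans)
          then obtain w where w: "(fst \<gamma> s l, y, w) \<in> Ew" unfolding E_iff by blast
          \<comment> \<open>Any \<open>y\<close> in the class can be the new root, so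
            \<open>Z k\<close> has to catch the pair of \<open>x\<close> with each of them.\<close>
          have "\<not> avoids m ?P Z W (add_top s y w \<gamma>)"
            using neg add_top_in_add_root[OF c(1) root \<gamma>(1) l w] by blast
          moreover have "avoids m P Z W (add_top s y w \<gamma>)"
            by (rule iffD2[OF avoids_add_top]) (erule c(5), rule \<gamma>(2))
          ultimately show ?thesis using \<gamma>(3) unfolding avoids_def by (auto simp: add_top_simps)
        qed
        moreover have "section_ideal k (Z k)" using ZW by (simp add: ideals_def)
        ultimately have "index_ideal \<Theta>" using index_ideal_reflection by metis
        then obtain W' where W': "\<Theta> \<subseteq> W'" "W' \<in> sets borel" "index_ideal W'"
          by (rule index_ideal_borel_cover)
        then have "ideals Z (W \<union> W')"
          using ZW index_ideal_Un unfolding ideals_def by auto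
        then obtain \<gamma> where \<gamma>: "\<gamma> \<in> G'" "avoids m P Z (W \<union> W') \<gamma>" by (rule positiveD[OF c(3)])
        have "avoids m P Z W \<gamma>" by (rule avoids_mono[OF \<gamma>(2)]) auto
        then have "fst \<gamma> 0 l \<in> W'" using W'(1) \<gamma>(1) by (auto simp: \<Theta>_def)
        then show False using avoidsD(1)[OF \<gamma>(2) l] by simp
      qed
    qed
    moreover have "determined ?P (add_root m s G')"
      using determined_insert[of "(k, l, s)" P G'] det(3) c(2) determined_mono[OF _ sub] by blast
    ultimately have "good m (Suc s) ?P (add_root m s G')"
      unfolding good_def using condition_add_root[OF c(1) root] c(4,5) l less_SucI by blast
    then show ?thesis using that[of "add_root m s G'" s] det(1) sub[of G'] by simp
  qed
qed

text \<open>The leaves are decided one after the other, each at the price of one new root; hence the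
  summand \<open>card L\<close>.\<close>

lemma decide_leaves:
  assumes "finite L" "L \<subseteq> {l. length l = m}" "good m s P G" "2 ^ m - 1 \<le> s"
  shows "\<exists>G' P'. G' \<subseteq> G \<and> P \<subseteq> P' \<and> good m (s + card L) P' G' \<and>
    (\<forall>l\<in>L. \<exists>i<s + card L. (k, l, i) \<in> P')"
  using assms(1,2)
proof (induction L rule: finite_induct)
  case empty
  then show ?case using assms(3) by auto
next
  case (insert l L)
  then obtain G1 P1 where 1: "G1 \<subseteq> G" "P \<subseteq> P1" "good m (s + card L) P1 G1"
    "\<And>l. l \<in> L \<Longrightarrow> \<exists>i<s + card L. (k, l, i) \<in> P1" by auto
  have l: "length l = m" using insert.prems by simp
  have "agree (s + card L) u v" if "length u = m" "length v = m" for u v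
    using agree_root[OF that] assms(4) by simp
  then obtain G2 i where 2: "G2 \<subseteq> G1" "i \<le> s + card L"
    "good m (Suc (s + card L)) (insert (k, l, i) P1) G2"
    using decide_leaf[OF 1(3) l] by metis
  have card: "s + card (insert l L) = Suc (s + card L)" using insert.hyps by simp
  show ?case
  proof (intro exI[of _ G2] exI[of _ "insert (k, l, i) P1"] conjI ballI)
    show "G2 \<subseteq> G" "P \<subseteq> insert (k, l, i) P1" using 1 2 by auto
    show "good m (s + card (insert l L)) (insert (k, l, i) P1) G2" unfolding card by fact
    fix l' assume l': "l' \<in> insert l L"
    show "\<exists>j<s + card (insert l L). (k, l', j) \<in> insert (k, l, i) P1"
    proof (cases "l' = l")
      case True
      then show ?thesis using 2(2) unfolding card by (intro exI[of _ i]) auto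
    next
      case False
      then obtain j where "j < s + card L" "(k, l', j) \<in> P1" using 1(4) l' by blast
      then show ?thesis unfolding card by (intro exI[of _ j]) auto
    qed
  qed
qed

end

section \<open>Adding a bit\<close>

lemma copy_simps: "fst (copy b \<gamma>) n u = fst \<gamma> n (u @ [b])" "snd (copy b \<gamma>) n u = snd \<gamma> n (u @ [b])"
  by (simp_all add: copy_def)

lemma diagonal_simps: "fst (diagonal \<gamma>) n u = fst \<gamma> n (butlast u)" "snd (diagonal \<gamma>) n u = snd \<gamma> n (butlast u)"
  by (simp_all add: diagonal_def)

lemma copy_diagonal: "copy b (diagonal \<gamma>) = \<gamma>"
  by (simp add: copy_def diagonal_def)

lemma continuous_copy: "continuous_on UNIV (copy b)"
  unfolding copy_def
  by (intro continuous_on_Pair continuous_on_coordinatewise_then_product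
      continuous_fst_config[unfolded case_prod_unfold] continuous_snd_config)

lemma agree_butlast: "agree n u v \<Longrightarrow> agree n (butlast u) (butlast v)"
  by (auto simp: agree_def nth_butlast)

text \<open>If the new bit is visible at level \<open>n\<close>, the graft below
  \<open>u @ [c]\<close> stays within the copy for \<open>c\<close>; otherwise the hub is common to
  both copies and both are grafted.\<close>

lemma copy_mix:
  "copy b (mix n (u @ [c]) \<gamma> \<gamma>') =
    (if n \<le> lam (coord (length u)) \<and> b \<noteq> c then copy b \<gamma> else mix n u (copy b \<gamma>) (copy b \<gamma>'))"
proof -
  have "agree n (u @ [c]) (v @ [b]) \<longleftrightarrow> agree n u v \<and> \<not> (n \<le> lam (coord (length u)) \<and> b \<noteq> c)" for v
    by (auto simp: agree_snoc)
  then show ?thesis by (intro prod_eqI ext) (auto simp: copy_simps fst_mix snd_mix)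
qed

lemma same_on_copy: "same_on (Suc m) s \<gamma> \<gamma>' \<Longrightarrow> same_on m s (copy b \<gamma>) (copy b \<gamma>')"
  by (simp add: same_on_def copy_simps)

lemma card_leaves: "card {l :: bool list. length l = m} = 2 ^ m"
  using card_lists_length_eq[of "UNIV :: bool set" m] by simp

lemma finite_leaves [simp]: "finite {l :: bool list. length l = m}"
  using finite_lists_length_eq[of "UNIV :: bool set" m] by simp

context baire_relations
begin

text \<open>Two members of \<open>G\<close> side by side, which validity glues together at the hubs
  from which the new bit is hidden.\<close>

definition add_bit :: "nat \<Rightarrow> nat \<Rightarrow> config set \<Rightarrow> config set" where
  "add_bit m s G = {\<gamma>. valid (Suc m) s \<gamma> \<and> (\<forall>b. copy b \<gamma> \<in> G)}"

definition bit_decisions :: "(nat \<times> bool list \<times> nat) set \<Rightarrow> (nat \<times> bool list \<times> nat) set" where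
  "bit_decisions P = {(k, u @ [b], n) | k u b n. (k, u, n) \<in> P}"

lemma condition_add_bit:
  assumes G: "condition m s G"
  shows "condition (Suc m) s (add_bit m s G)"
  unfolding condition_def
proof (intro conjI ballI allI impI)
  have "{\<gamma>. copy b \<gamma> \<in> G} \<in> sets borel" for b
    using borel_vimage[OF continuous_copy conditionD(1)[OF G]] by (simp add: vimage_def)
  then show "add_bit m s G \<in> sets borel"
    unfolding add_bit_def by (intro borel_Collect_conj borel_Collect_all borel_valid)
next
  fix \<gamma> assume "\<gamma> \<in> add_bit m s G"
  then show "valid (Suc m) s \<gamma>" by (simp add: add_bit_def)
next
  fix \<gamma> \<gamma>' and n and v :: "bool list"
  assume g: "\<gamma> \<in> add_bit m s G" "\<gamma>' \<in> add_bit m s G" and n: "n < s" "length v = Suc m"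
    and eq: "fst \<gamma> (Suc n) v = fst \<gamma>' (Suc n) v"
  have val: "valid (Suc m) s \<gamma>" "valid (Suc m) s \<gamma>'" and cp: "copy b \<gamma> \<in> G" "copy b \<gamma>' \<in> G" for b
    using g by (auto simp: add_bit_def)
  obtain u c where v: "v = u @ [c]" "length u = m"
    using n(2) by (metis append_butlast_last_id butlast_snoc diff_Suc_1 length_0_conv length_butlast nat.distinct(1))
  have "copy b (mix n v \<gamma> \<gamma>') \<in> G" for b
  proof (cases "n \<le> lam (coord m) \<and> b \<noteq> c")
    case True
    then show ?thesis using cp(1) v by (simp add: copy_mix)
  next
    case False
    \<comment> \<open>Either \<open>b = c\<close>, or the new bit is already hidden at level
      \<open>n\<close>. In both cases the equality at level \<open>n + 1\<close> is available in the
      copy for \<open>b\<close>.\<close>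
    have "agree (Suc n) v (u @ [b])"
      unfolding v(1) agree_snoc using False v(2) by auto
    then have "fst (copy b \<gamma>) (Suc n) u = fst (copy b \<gamma>') (Suc n) u"
      using valid_fst[OF val(1), of "Suc n" v "u @ [b]"] valid_fst[OF val(2), of "Suc n" v "u @ [b]"] n eq
      by (simp add: copy_simps)
    then have "mix n u (copy b \<gamma>) (copy b \<gamma>') \<in> G"
      by (rule conditionD(3)[OF G cp n(1) v(2)])
    moreover have "copy b (mix n v \<gamma> \<gamma>') = mix n u (copy b \<gamma>) (copy b \<gamma>')"
      unfolding v(1) copy_mix using False v(2) by auto
    ultimately show ?thesis by simp
  qed
  then show "mix n v \<gamma> \<gamma>' \<in> add_bit m s G"
    using valid_mix[OF val n eq] by (simp add: add_bit_def)
next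
  fix \<gamma> \<gamma>' assume g: "\<gamma> \<in> add_bit m s G" "same_on (Suc m) s \<gamma> \<gamma>'"
  have "copy b \<gamma>' \<in> G" for b
    using g conditionD(4)[OF G, of "copy b \<gamma>" "copy b \<gamma>'"] same_on_copy[OF g(2)] by (simp add: add_bit_def)
  then show "\<gamma>' \<in> add_bit m s G" using g valid_same_on[OF g(2)] by (simp add: add_bit_def)
qed

text \<open>Doubling a member of \<open>G\<close> gives a member of \<open>add_bit\<close> that
  avoids the same ideals, so largeness survives. Determinacy speaks of a single leaf and hence of a
  single copy.\<close>

lemma good_add_bit:
  assumes G: "good m s P G"
  shows "good (Suc m) s (bit_decisions P) (add_bit m s G)"
proof -
  note c = goodD[OF G]
  have "determined (bit_decisions P) (add_bit m s G)" unfolding determined_def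
  proof (intro allI impI)
    fix k l n \<gamma> \<gamma>'
    assume "(k, l, n) \<in> bit_decisions P" and g: "\<gamma> \<in> add_bit m s G" "\<gamma>' \<in> add_bit m s G"
      and eq: "fst \<gamma> n l = fst \<gamma>' n l"
    then obtain u b where u: "l = u @ [b]" "(k, u, n) \<in> P" by (auto simp: bit_decisions_def)
    have "copy b \<gamma> \<in> G" "copy b \<gamma>' \<in> G" using g by (simp_all add: add_bit_def)
    then show "(fst \<gamma> 0 l, fst \<gamma>' 0 l) \<in> Ek k"
      using determinedD[OF c(2) u(2), of "copy b \<gamma>" "copy b \<gamma>'"] eq u(1) by (simp add: copy_simps)
  qed
  moreover have "positive (Suc m) (bit_decisions P) (add_bit m s G)" unfolding positive_def
  proof (intro allI impI)
    fix Z W assume "ideals Z W"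
    then obtain \<gamma> where \<gamma>: "\<gamma> \<in> G" "avoids m P Z W \<gamma>" by (rule positiveD[OF c(3)])
    have v: "valid m s \<gamma>" using conditionD(2)[OF c(1) \<gamma>(1)] .
    have "valid (Suc m) s (diagonal \<gamma>)" unfolding valid_def diagonal_simps
    proof (intro conjI allI impI; elim conjE)
      fix n u v assume "n \<le> s" "length u = Suc m" "agree n u v"
      then show "fst \<gamma> n (butlast u) = fst \<gamma> n (butlast v)"
        using valid_fst[OF v _ _ agree_butlast] by simp
    next
      fix n u v assume "n < s" "length u = Suc m" "agree n u v"
      then show "snd \<gamma> n (butlast u) = snd \<gamma> n (butlast v)"
        using valid_snd[OF v _ _ agree_butlast] by simp
    next
      fix n and u :: "bool list" assume "n < s" "length u = Suc m"
      then show "(fst \<gamma> n (butlast u), fst \<gamma> (Suc n) (butlast u), snd \<gamma> n (butlast u)) \<in> Ew"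
        using valid_Ew[OF v] by simp
    qed
    then have "diagonal \<gamma> \<in> add_bit m s G" using \<gamma>(1) by (simp add: add_bit_def copy_diagonal)
    moreover have "avoids (Suc m) (bit_decisions P) Z W (diagonal \<gamma>)"
      unfolding avoids_def diagonal_simps
    proof (intro conjI allI impI)
      fix u :: "bool list" assume "length u = Suc m"
      then show "fst \<gamma> 0 (butlast u) \<notin> W" using avoidsD(1)[OF \<gamma>(2)] by simp
    next
      fix t assume "t \<in> bit_decisions P"
      then obtain k u b n where "t = (k, u @ [b], n)" "(k, u, n) \<in> P" by (auto simp: bit_decisions_def)
      then show "(fst \<gamma> 0 (butlast (fst (snd t))), fst \<gamma> (Suc (snd (snd t))) (butlast (fst (snd t)))) \<notin> Z (fst t)"
        using avoidsD(2)[OF \<gamma>(2)] by simp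
    qed
    ultimately show "\<exists>\<gamma>\<in>add_bit m s G. avoids (Suc m) (bit_decisions P) Z W \<gamma>" by (rule bexI[rotated])
  qed
  moreover have "length l = Suc m \<and> n < s" if "(k, l, n) \<in> bit_decisions P" for k l n
    using that c(4,5) by (auto simp: bit_decisions_def)
  ultimately show ?thesis unfolding good_def using condition_add_bit[OF c(1)] by blast
qed

section \<open>Shrinking and separating\<close>

lemma condition_close:
  assumes "condition m s G"
  shows "condition m s (G \<inter> {\<gamma>. close N m s \<gamma> \<delta>})"
  by (rule condition_Int[OF assms borel_close])
    (auto simp only: mem_Collect_eq intro: close_mix close_same_on)

text \<open>\<open>A\<close> need not be closed under grafting, so intersecting \<open>G\<close>
  with it could destroy the condition. Closeness to one \<open>\<delta> \<in> A\<close> is closed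
  under grafting, and it transfers to all of \<open>G'\<close> whatever finitely many digits of
  \<open>\<delta>\<close> guarantee; countably many codes suffice to find a large such set.\<close>

lemma refine_close:
  assumes G: "condition m s G" "determined P G" "\<And>k l n. (k, l, n) \<in> P \<Longrightarrow> length l = m \<and> n < s"
    and A: "positive m P (G \<inter> A)"
  shows "\<exists>G' \<delta>. G' \<subseteq> G \<and> good m s P G' \<and> \<delta> \<in> G' \<inter> A \<and> (\<forall>\<gamma>\<in>G'. close N m s \<gamma> \<delta>)"
proof -
  define H where "H i = {\<gamma>. to_nat (code N m s \<gamma>) = i}" for i
  have "G \<inter> A \<subseteq> (\<Union>i. H i)" by (auto simp: H_def)
  then have "\<exists>i. positive m P (G \<inter> A \<inter> H i)" by (rule positive_split[OF A])
  then obtain i where i: "positive m P (G \<inter> A \<inter> H i)" ..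
  then obtain \<delta> where \<delta>: "\<delta> \<in> G \<inter> A \<inter> H i" using positive_nonempty by blast
  have cl: "close N m s \<gamma> \<delta>" if "\<gamma> \<in> H i" for \<gamma>
  proof (rule close_if_code_eq[OF injD[OF inj_to_nat]])
    show "to_nat (code N m s \<gamma>) = to_nat (code N m s \<delta>)" using that \<delta> by (simp add: H_def)
  qed
  let ?G = "G \<inter> {\<gamma>. close N m s \<gamma> \<delta>}"
  have "positive m P ?G" by (rule positive_mono[OF i]) (use cl in auto)
  then have "good m s P ?G"
    unfolding good_def using condition_close[OF G(1)] determined_mono[OF G(2), of ?G] G(3) by blast
  moreover have "\<delta> \<in> ?G \<inter> A" using \<delta> cl by auto
  ultimately show ?thesis by (intro exI[of _ ?G] exI[of _ \<delta>]) simp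
qed

lemma refine_separate:
  assumes G: "good m s P G" and kl: "(k, l, n) \<in> P" and l': "length l' = m" "\<not> agree n l l'"
  obtains G' A B where "G' \<subseteq> G" "good m s P G'" "closed A" "closed B" "A \<times> B \<subseteq> Ok k q"
    "\<And>\<gamma>. \<gamma> \<in> G' \<Longrightarrow> fst \<gamma> 0 l \<in> A" "\<And>\<gamma>. \<gamma> \<in> G' \<Longrightarrow> fst \<gamma> 0 l' \<in> B"
proof -
  note c = goodD[OF G]
  \<comment> \<open>The length at which cylinders fit into \<open>Ok k q\<close> varies with the
    configuration; \<open>positive_split\<close> fixes it.\<close>
  let ?A = "\<lambda>N. {\<gamma>::config. cyl (fst \<gamma> 0 l) N \<times> cyl (fst \<gamma> 0 l') N \<subseteq> Ok k q}"
  have "G \<inter> {\<gamma>. (fst \<gamma> 0 l, fst \<gamma> 0 l') \<notin> Ek k} \<subseteq> (\<Union>N. ?A N)"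
  proof
    fix \<gamma> assume "\<gamma> \<in> G \<inter> {\<gamma>. (fst \<gamma> 0 l, fst \<gamma> 0 l') \<notin> Ek k}"
    then have "(fst \<gamma> 0 l, fst \<gamma> 0 l') \<in> Ok k q" using Ek_compl[of k] by blast
    then obtain U V where UV: "open U" "open V" "fst \<gamma> 0 l \<in> U" "fst \<gamma> 0 l' \<in> V" "U \<times> V \<subseteq> Ok k q"
      using open_Ok[of k q] unfolding open_prod_def by (metis SigmaD1 SigmaD2)
    obtain a where a: "cyl (fst \<gamma> 0 l) a \<subseteq> U" using open_contains_cyl UV(1,3) by metis
    obtain b where b: "cyl (fst \<gamma> 0 l') b \<subseteq> V" using open_contains_cyl UV(2,4) by metis
    have "cyl (fst \<gamma> 0 l) (max a b) \<subseteq> U" "cyl (fst \<gamma> 0 l') (max a b) \<subseteq> V"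
      using subset_trans[OF cyl_antimono a] subset_trans[OF cyl_antimono b] by simp_all
    then have "\<gamma> \<in> ?A (max a b)" using UV(5) by blast
    then show "\<gamma> \<in> (\<Union>N. ?A N)" by (rule UN_I[OF UNIV_I])
  qed
  then have "\<exists>N. positive m P (G \<inter> {\<gamma>. (fst \<gamma> 0 l, fst \<gamma> 0 l') \<notin> Ek k} \<inter> ?A N)"
    by (rule positive_split[OF positive_separate[OF G kl l']])
  then obtain N where "positive m P (G \<inter> {\<gamma>. (fst \<gamma> 0 l, fst \<gamma> 0 l') \<notin> Ek k} \<inter> ?A N)" ..
  then have "positive m P (G \<inter> ?A N)" by (rule positive_mono) auto
  then have "\<exists>G' \<delta>. G' \<subseteq> G \<and> good m s P G' \<and> \<delta> \<in> G' \<inter> ?A N \<and> (\<forall>\<gamma>\<in>G'. close N m s \<gamma> \<delta>)"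
    by (rule refine_close[OF c(1,2), rotated]) (use c(4,5) in simp)
  then obtain G' \<delta> where G': "G' \<subseteq> G" "good m s P G'" "\<delta> \<in> G' \<inter> ?A N" "\<And>\<gamma>. \<gamma> \<in> G' \<Longrightarrow> close N m s \<gamma> \<delta>"
    by (elim exE conjE) simp
  show ?thesis
  proof
    show "closed (cyl (fst \<delta> 0 l) N)" "closed (cyl (fst \<delta> 0 l') N)" by (rule closed_cyl)+
    show "cyl (fst \<delta> 0 l) N \<times> cyl (fst \<delta> 0 l') N \<subseteq> Ok k q" using G'(3) by simp
    show "fst \<gamma> 0 l \<in> cyl (fst \<delta> 0 l) N" "fst \<gamma> 0 l' \<in> cyl (fst \<delta> 0 l') N" if "\<gamma> \<in> G'" for \<gamma>
      using G'(4)[OF that] c(4)[OF kl] l'(1) by (simp_all add: close_def)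
  qed (use G' in auto)
qed

text \<open>Rectangles are needed here: different leaves of a later stage descend to the two given
  leaves through different copies of the configuration.\<close>

definition separated :: "config set \<Rightarrow> nat \<times> nat \<times> bool list \<times> bool list \<Rightarrow> bool" where
  "separated G = (\<lambda>(k, q, l, l'). \<exists>A B. closed A \<and> closed B \<and> A \<times> B \<subseteq> Ok k q \<and>
     (\<forall>\<gamma>\<in>G. fst \<gamma> 0 l \<in> A \<and> fst \<gamma> 0 l' \<in> B))"

lemma separated_mono: "separated G t \<Longrightarrow> G' \<subseteq> G \<Longrightarrow> separated G' t"
  unfolding separated_def by (cases t) (simp, blast)

lemma refine_separated:
  assumes "finite Q" and G: "good m s P G"
    and Q: "\<And>k q l l'. (k, q, l, l') \<in> Q \<Longrightarrow> \<exists>n. (k, l, n) \<in> P \<and> length l' = m \<and> \<not> agree n l l'"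
  shows "\<exists>G'\<subseteq>G. good m s P G' \<and> (\<forall>t\<in>Q. separated G' t)"
  using assms(1) Q
proof (induction Q rule: finite_induct)
  case empty
  then show ?case using G by (intro exI[of _ G]) simp
next
  case (insert t Q)
  obtain k q l l' where t: "t = (k, q, l, l')" by (cases t)
  have "\<exists>G'\<subseteq>G. good m s P G' \<and> (\<forall>t\<in>Q. separated G' t)"
    by (rule insert.IH) (use insert.prems in blast)
  then obtain G1 where 1: "G1 \<subseteq> G" "good m s P G1" "\<And>t. t \<in> Q \<Longrightarrow> separated G1 t" by auto
  obtain n where "(k, l, n) \<in> P" "length l' = m" "\<not> agree n l l'" using insert.prems t by blast
  then obtain G2 A B where 2: "G2 \<subseteq> G1" "good m s P G2" "closed A" "closed B" "A \<times> B \<subseteq> Ok k q"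
    "\<And>\<gamma>. \<gamma> \<in> G2 \<Longrightarrow> fst \<gamma> 0 l \<in> A" "\<And>\<gamma>. \<gamma> \<in> G2 \<Longrightarrow> fst \<gamma> 0 l' \<in> B"
    using refine_separate[OF 1(2)] by metis
  have "separated G2 t" unfolding separated_def t prod.case
    by (intro exI[of _ A] exI[of _ B] conjI ballI 2(3-7))
  then have "separated G2 t'" if "t' \<in> insert t Q" for t'
    using that separated_mono[OF 1(3)[of t'] 2(1)] by (cases "t' = t") simp_all
  moreover have "G2 \<subseteq> G" using 1 2 by simp
  ultimately show ?case using 2(2) by (intro exI[of _ G2]) simp
qed

section \<open>Stages of the fusion\<close>

definition stage :: "nat \<Rightarrow> (nat \<times> bool list \<times> nat) set \<Rightarrow> config set \<Rightarrow> bool" where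
  "stage m P G \<longleftrightarrow> good m (2 ^ m - 1) P G \<and> (\<forall>k<m. \<forall>l. length l = m \<longrightarrow> (\<exists>n\<le>lam k. (k, l, n) \<in> P))"

text \<open>With one leaf, one level and no decisions, largeness says only that no Borel member of
  \<open>index_ideal\<close> is the whole space.\<close>

lemma stage_0: "\<not> index_ideal UNIV \<Longrightarrow> stage 0 {} UNIV"
proof -
  assume neg: "\<not> index_ideal UNIV"
  have "condition 0 0 UNIV"
    by (simp add: condition_def valid_def agree_def)
  moreover have "positive 0 {} UNIV" unfolding positive_def
  proof (intro allI impI)
    fix Z W assume "ideals Z W"
    then have "W \<noteq> UNIV" using neg by (auto simp: ideals_def)
    then obtain x where "x \<notin> W" by blast
    then show "\<exists>\<gamma>\<in>UNIV. avoids 0 {} Z W \<gamma>"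
      by (intro bexI[of _ "(\<lambda>_ _. x, \<lambda>_ _. x)"]) (auto simp: avoids_def)
  qed
  ultimately show ?thesis by (simp add: stage_def good_def determined_def)
qed

text \<open>Index \<open>m\<close> is decided before the new bit is added, while there are only
  \<open>2 ^ m\<close> leaves; both copies then inherit the decisions. Separation comes after the
  bit, since it concerns the new leaves.\<close>

lemma stage_Suc:
  assumes "stage m P G"
  shows "\<exists>P' G'. stage (Suc m) P' G' \<and> (\<forall>\<gamma>\<in>G'. \<forall>b. copy b \<gamma> \<in> G) \<and>
    (\<forall>\<gamma>\<in>G'. \<forall>\<gamma>'\<in>G'. close (Suc m) (Suc m) (2 ^ Suc m - 1) \<gamma> \<gamma>') \<and>
    (\<forall>k q l l'. k \<le> m \<longrightarrow> q \<le> m \<longrightarrow> length l = Suc m \<longrightarrow> length l' = Suc m \<longrightarrow> \<not> agree (lam k) l l' \<longrightarrow>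
      separated G' (k, q, l, l'))"
proof -
  let ?s = "2 ^ Suc m - 1 :: nat"
  have good: "good m (2 ^ m - 1) P G" and dec: "\<And>k l. k < m \<Longrightarrow> length l = m \<Longrightarrow> \<exists>n\<le>lam k. (k, l, n) \<in> P"
    using assms unfolding stage_def by blast+
  have "\<exists>G1 P1. G1 \<subseteq> G \<and> P \<subseteq> P1 \<and> good m (2 ^ m - 1 + card {l::bool list. length l = m}) P1 G1 \<and>
    (\<forall>l\<in>{l. length l = m}. \<exists>i<2 ^ m - 1 + card {l::bool list. length l = m}. (m, l, i) \<in> P1)"
    by (rule decide_leaves[OF _ _ good]) auto
  moreover have "2 ^ m - 1 + card {l::bool list. length l = m} = ?s"
    by (simp add: card_leaves)
  ultimately obtain G1 P1 where 1: "G1 \<subseteq> G" "P \<subseteq> P1" "good m ?s P1 G1"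
    "\<And>l. length l = m \<Longrightarrow> \<exists>i<?s. (m, l, i) \<in> P1" by auto
  have dec1: "\<exists>n\<le>lam k. (k, l, n) \<in> P1" if "k \<le> m" "length l = m" for k l
  proof (cases "k = m")
    case True
    then obtain i where "i < ?s" "(m, l, i) \<in> P1" using 1(4) \<open>length l = m\<close> by blast
    \<comment> \<open>The top level is now \<open>2 ^ Suc m - 1 = lam m + 1\<close>, and the
      critical level is strictly below it.\<close>
    then show ?thesis using True Suc_lam[of m] by (metis less_Suc_eq_le)
  next
    case False
    then show ?thesis using dec[of k l] that 1(2) by fastforce
  qed
  let ?P = "bit_decisions P1"
  have good2: "good (Suc m) ?s ?P (add_bit m ?s G1)" by (rule good_add_bit[OF 1(3)])
  note c = goodD[OF good2]
  have dec2: "\<exists>n\<le>lam k. (k, l, n) \<in> ?P" if kl: "k < Suc m" "length l = Suc m" for k l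
  proof -
    obtain u b where u: "l = u @ [b]" "length u = m"
      using kl(2) by (metis append_butlast_last_id diff_Suc_1 length_0_conv length_butlast nat.distinct(1))
    obtain n where "n \<le> lam k" "(k, u, n) \<in> P1" using dec1[of k u] kl(1) u(2) by auto
    then show ?thesis using u(1) by (intro exI[of _ n]) (auto simp: bit_decisions_def)
  qed
  \<comment> \<open>Leaves distinguished at level \<open>lam k\<close> are distinguished at every
    critical level of \<open>k\<close>, as these are at most \<open>lam k\<close>; this is what
    \<open>positive_separate\<close> requires.\<close>
  define Q where "Q = {(k, q, l, l'). k \<le> m \<and> q \<le> m \<and> length l = Suc m \<and> length l' = Suc m \<and> \<not> agree (lam k) l l'}"
  have "Q \<subseteq> {..m} \<times> {..m} \<times> {l. length l = Suc m} \<times> {l. length l = Suc m}" by (auto simp: Q_def)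
  then have "finite Q" by (rule finite_subset) (intro finite_cartesian_product finite_leaves finite_atMost)
  then have "\<exists>G3\<subseteq>add_bit m ?s G1. good (Suc m) ?s ?P G3 \<and> (\<forall>t\<in>Q. separated G3 t)"
  proof (rule refine_separated[OF _ good2])
    fix k q l l' assume Q: "(k, q, l, l') \<in> Q"
    then obtain n where "n \<le> lam k" "(k, l, n) \<in> ?P" using dec2[of k l] by (auto simp: Q_def)
    then show "\<exists>n. (k, l, n) \<in> ?P \<and> length l' = Suc m \<and> \<not> agree n l l'"
      using Q by (intro exI[of _ n]) (auto simp: Q_def dest: agree_mono)
  qed
  then obtain G3 where 3: "G3 \<subseteq> add_bit m ?s G1" "good (Suc m) ?s ?P G3" "\<And>t. t \<in> Q \<Longrightarrow> separated G3 t"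
    by auto
  note d = goodD[OF 3(2)]
  have "positive (Suc m) ?P (G3 \<inter> UNIV)" using d(3) by simp
  then have "\<exists>G' \<delta>. G' \<subseteq> G3 \<and> good (Suc m) ?s ?P G' \<and> \<delta> \<in> G' \<inter> UNIV \<and> (\<forall>\<gamma>\<in>G'. close (Suc m) (Suc m) ?s \<gamma> \<delta>)"
    by (rule refine_close[OF d(1,2), rotated]) (use d(4,5) in simp)
  then obtain G4 \<delta> where 4: "G4 \<subseteq> G3" "good (Suc m) ?s ?P G4" "\<And>\<gamma>. \<gamma> \<in> G4 \<Longrightarrow> close (Suc m) (Suc m) ?s \<gamma> \<delta>"
    by metis
  show ?thesis
  proof (intro exI[of _ ?P] exI[of _ G4] conjI ballI allI impI)
    show "stage (Suc m) ?P G4" unfolding stage_def using 4(2) dec2 by blast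
    fix \<gamma> assume \<gamma>: "\<gamma> \<in> G4"
    then have "\<gamma> \<in> add_bit m ?s G1" using 3(1) 4(1) by blast
    then show "copy b \<gamma> \<in> G" for b using 1(1) by (auto simp: add_bit_def)
    show "close (Suc m) (Suc m) ?s \<gamma> \<gamma>'" if "\<gamma>' \<in> G4" for \<gamma>'
      using close_trans[OF 4(3)[OF \<gamma>] close_sym[OF 4(3)[OF that]]] .
  next
    fix k q l l' assume "k \<le> m" "q \<le> m" "length l = Suc m" "length l' = Suc m" "\<not> agree (lam k) l l'"
    then have "(k, q, l, l') \<in> Q" by (simp add: Q_def)
    then show "separated G4 (k, q, l, l')" using separated_mono[OF 3(3) 4(1)] by blast
  qed
qed

end

section \<open>The limit map\<close>

definition bit :: "(nat \<Rightarrow> nat \<Rightarrow> bool) \<Rightarrow> nat \<Rightarrow> bool" where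
  "bit x t = x (fst (prod_decode t)) (snd (prod_decode t))"

definition leaf :: "(nat \<Rightarrow> nat \<Rightarrow> bool) \<Rightarrow> nat \<Rightarrow> bool list" where
  "leaf x m = map (bit x) [0..<m]"

lemma length_leaf [simp]: "length (leaf x m) = m"
  by (simp add: leaf_def)

lemma nth_leaf [simp]: "t < m \<Longrightarrow> leaf x m ! t = bit x t"
  by (simp add: leaf_def)

lemma leaf_Suc: "leaf x (Suc m) = leaf x m @ [bit x m]"
  by (simp add: leaf_def)

lemma open_leaf: "open {x. leaf x m = u}"
proof (cases "length u = m")
  case True
  have "open {x. bit x t = b}" for t b
  proof -
    have "continuous_on UNIV (\<lambda>x. bit x t)" unfolding bit_def
      by (rule continuous_on_product_then_coordinatewise[OF continuous_on_product_coordinates])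
    then have "open ((\<lambda>x. bit x t) -` {b})"
      by (rule open_vimage[rotated]) (rule discrete_topology_class.open_discrete)
    then show ?thesis by (simp add: vimage_def)
  qed
  then have "open (\<Inter>t\<in>{..<m}. {x. bit x t = u ! t})" by (intro open_INT) auto
  also have "(\<Inter>t\<in>{..<m}. {x. bit x t = u ! t}) = {x. leaf x m = u}"
    using True by (auto simp: list_eq_iff_nth_eq)
  finally show ?thesis .
next
  case False
  then have "{x. leaf x m = u} = {}" by auto
  then show ?thesis by (metis open_empty)
qed

text \<open>The argument enters only through finitely many bits, so \<open>f\<close> may be
  arbitrary.\<close>

lemma continuous_on_leaf:
  "continuous_on UNIV (\<lambda>x. f (leaf x m) :: 'a::topological_space)"
proof (rule continuous_on_open_vimage[THEN iffD2, rule_format, OF open_UNIV])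
  fix B :: "'a set"
  have "(\<lambda>x. f (leaf x m)) -` B \<inter> UNIV = (\<Union>u\<in>{u. f u \<in> B}. {x. leaf x m = u})" by auto
  also have "open \<dots>" by (intro open_UN ballI open_leaf)
  finally show "open ((\<lambda>x. f (leaf x m)) -` B \<inter> UNIV)" .
qed

lemma tendsto_cyl:
  fixes z :: "nat \<Rightarrow> 'a::topological_space"
  assumes "\<And>M. M \<ge> M0 \<Longrightarrow> z \<in> cyl (zs M) M"
  shows "zs \<longlonglongrightarrow> z"
proof (rule topological_tendstoI)
  fix S assume "open S" "z \<in> S"
  then obtain n where n: "cyl z n \<subseteq> S" by (rule open_contains_cyl)
  have "zs M \<in> S" if "M \<ge> max n M0" for M
  proof -
    have "zs M \<in> cyl z n" using assms[of M] that by (auto simp: cyl_def)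
    then show ?thesis using n by blast
  qed
  then show "eventually (\<lambda>M. zs M \<in> S) sequentially"
    unfolding eventually_sequentially by blast
qed

text \<open>Follows \<open>x\<close> from stage \<open>m + k\<close> back to stage \<open>m\<close>,
  so that everything imposed on the configurations of stage \<open>m\<close> can be read off the
  later ones.\<close>

primrec desc :: "(nat \<Rightarrow> nat \<Rightarrow> bool) \<Rightarrow> nat \<Rightarrow> nat \<Rightarrow> config \<Rightarrow> config" where
  "desc x m 0 \<gamma> = \<gamma>"
| "desc x m (Suc k) \<gamma> = desc x m k (copy (bit x (m + k)) \<gamma>)"

lemma desc_leaf:
  "fst (desc x m k \<gamma>) n (leaf x m) = fst \<gamma> n (leaf x (m + k))"
  "snd (desc x m k \<gamma>) n (leaf x m) = snd \<gamma> n (leaf x (m + k))"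
  by (induction k arbitrary: \<gamma>) (simp_all add: copy_simps leaf_Suc)

context baire_relations
begin

theorem baire_homomorphism:
  assumes "\<not> index_ideal UNIV"
  obtains \<phi> :: "(nat \<Rightarrow> nat \<Rightarrow> bool) \<Rightarrow> baire" where "continuous_on UNIV \<phi>"
    "\<And>n x y. (x, y) \<in> F0 n \<Longrightarrow> (\<phi> x, \<phi> y) \<in> E"
    "\<And>n k x y. (x, y) \<notin> F0 n \<Longrightarrow> k \<le> n \<Longrightarrow> (\<phi> x, \<phi> y) \<notin> Ek k"
proof -
  have "\<exists>S. \<forall>m. stage m (fst (S m)) (snd (S m)) \<and>
    ((\<forall>\<gamma>\<in>snd (S (Suc m)). \<forall>b. copy b \<gamma> \<in> snd (S m)) \<and>
    (\<forall>\<gamma>\<in>snd (S (Suc m)). \<forall>\<gamma>'\<in>snd (S (Suc m)). close (Suc m) (Suc m) (2 ^ Suc m - 1) \<gamma> \<gamma>') \<and>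
    (\<forall>k q l l'. k \<le> m \<longrightarrow> q \<le> m \<longrightarrow> length l = Suc m \<longrightarrow> length l' = Suc m \<longrightarrow> \<not> agree (lam k) l l' \<longrightarrow>
      separated (snd (S (Suc m))) (k, q, l, l')))"
    (is "\<exists>S. \<forall>m. ?P m (S m) \<and> ?Q m (S m) (S (Suc m))")
  proof (rule dependent_nat_choice)
    show "\<exists>S. ?P 0 S" using stage_0[OF assms] by (intro exI[of _ "({}, UNIV)"]) simp
    fix S m assume "?P m S"
    from stage_Suc[OF this] obtain P' G' where "stage (Suc m) P' G' \<and> (\<forall>\<gamma>\<in>G'. \<forall>b. copy b \<gamma> \<in> snd S) \<and>
      (\<forall>\<gamma>\<in>G'. \<forall>\<gamma>'\<in>G'. close (Suc m) (Suc m) (2 ^ Suc m - 1) \<gamma> \<gamma>') \<and>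
      (\<forall>k q l l'. k \<le> m \<longrightarrow> q \<le> m \<longrightarrow> length l = Suc m \<longrightarrow> length l' = Suc m \<longrightarrow> \<not> agree (lam k) l l' \<longrightarrow>
        separated G' (k, q, l, l'))" by (elim exE)
    then show "\<exists>S'. ?P (Suc m) S' \<and> ?Q m S S'" by (intro exI[of _ "(P', G')"]) simp
  qed
  then obtain S where S: "\<forall>m. ?P m (S m) \<and> ?Q m (S m) (S (Suc m))" by (elim exE)
  define G where "G m = snd (S m)" for m
  have stage: "stage m (fst (S m)) (G m)" for m using S by (simp add: G_def)
  have cp: "copy b \<gamma> \<in> G m" if "\<gamma> \<in> G (Suc m)" for b \<gamma> m
    using S that unfolding G_def by blast
  have cl: "close (Suc m) (Suc m) (2 ^ Suc m - 1) \<gamma> \<gamma>'" if "\<gamma> \<in> G (Suc m)" "\<gamma>' \<in> G (Suc m)" for \<gamma> \<gamma>' m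
    using S that unfolding G_def by blast
  have sep: "separated (G (Suc m)) (k, q, l, l')"
    if "k \<le> m" "q \<le> m" "length l = Suc m" "length l' = Suc m" "\<not> agree (lam k) l l'" for m k q l l'
    using S that unfolding G_def by blast
  have good: "good m (2 ^ m - 1) (fst (S m)) (G m)" for m using stage[of m] by (simp add: stage_def)
  have "G m \<noteq> {}" for m using positive_nonempty[OF goodD(3)[OF good[of m]]] .
  then have "\<forall>m. \<exists>\<gamma>. \<gamma> \<in> G m" by blast
  then obtain \<gamma> where \<gamma>: "\<And>m. \<gamma> m \<in> G m" by metis
  have val: "valid m (2 ^ m - 1) (\<gamma> m)" for m
    using conditionD(2)[OF goodD(1)[OF good[of m]] \<gamma>] .
  have desc: "desc x m k \<delta> \<in> G m" if "\<delta> \<in> G (m + k)" for x m k \<delta>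
    using that
  proof (induction k arbitrary: \<delta>)
    case (Suc k)
    then show ?case using cp[of \<delta> "m + k"] by simp
  qed simp
  \<comment> \<open>From stage \<open>n + 1\<close> on, both level \<open>n\<close> and level
    \<open>n + 1\<close> exist.\<close>
  have lvl: "n < 2 ^ m - 1" if "n < m" for n m :: nat
  proof -
    have "Suc n < 2 ^ Suc n" by (rule less_exp)
    also have "(2::nat) ^ Suc n \<le> 2 ^ m" using that by (intro power_increasing) auto
    finally show ?thesis by simp
  qed
  \<comment> \<open>Descending from stage \<open>M\<close> leads into \<open>G m\<close>, whose
    members share their first \<open>m\<close> digits.\<close>
  have conv: "fst (\<gamma> M) n (leaf x M) i = fst (\<gamma> m) n (leaf x m) i"
    "snd (\<gamma> M) n (leaf x M) i = snd (\<gamma> m) n (leaf x m) i"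
    if "n < m" "i < m" "m \<le> M" for n m M i x
  proof -
    obtain k where k: "M = m + k" using \<open>m \<le> M\<close> le_Suc_ex by blast
    obtain m' where m': "m = Suc m'" using \<open>n < m\<close> by (cases m) auto
    have "desc x m k (\<gamma> M) \<in> G m" using desc \<gamma> k by simp
    then have "close m m (2 ^ m - 1) (desc x m k (\<gamma> M)) (\<gamma> m)" using cl \<gamma>[of m] m' by simp
    moreover have "n < 2 ^ m - 1" by (rule lvl[OF \<open>n < m\<close>])
    ultimately have "fst (desc x m k (\<gamma> M)) n (leaf x m) i = fst (\<gamma> m) n (leaf x m) i"
      "snd (desc x m k (\<gamma> M)) n (leaf x m) i = snd (\<gamma> m) n (leaf x m) i"
      using that(2) by (simp_all add: close_def cyl_def)
    then show "fst (\<gamma> M) n (leaf x M) i = fst (\<gamma> m) n (leaf x m) i"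
      "snd (\<gamma> M) n (leaf x M) i = snd (\<gamma> m) n (leaf x m) i"
      unfolding desc_leaf k by simp_all
  qed
  \<comment> \<open>Digit \<open>i\<close> at level \<open>n\<close> is final from stage
    \<open>max n i + 1\<close> on.\<close>
  define h where "h n x = (\<lambda>i. fst (\<gamma> (Suc (max n i))) n (leaf x (Suc (max n i))) i)" for n x
  define g where "g n x = (\<lambda>i. snd (\<gamma> (Suc (max n i))) n (leaf x (Suc (max n i))) i)" for n x
  have h: "h n x \<in> cyl (fst (\<gamma> M) n (leaf x M)) M" if "n < M" for n x M
    unfolding h_def cyl_def mem_Collect_eq
    by (intro allI impI conv(1)[symmetric]) (use that in auto)
  have g: "g n x \<in> cyl (snd (\<gamma> M) n (leaf x M)) M" if "n < M" for n x M
    unfolding g_def cyl_def mem_Collect_eq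
    by (intro allI impI conv(2)[symmetric]) (use that in auto)
  have h_lim: "(\<lambda>M. fst (\<gamma> M) n (leaf x M)) \<longlonglongrightarrow> h n x" for n x
    by (rule tendsto_cyl[of "Suc n"]) (rule h, simp)
  have g_lim: "(\<lambda>M. snd (\<gamma> M) n (leaf x M)) \<longlonglongrightarrow> g n x" for n x
    by (rule tendsto_cyl[of "Suc n"]) (rule g, simp)
  have "(h n x, h (Suc n) x, g n x) \<in> Ew" for n x
  proof (rule Lim_in_closed_set[OF closed_Ew])
    show "(\<lambda>M. (fst (\<gamma> M) n (leaf x M), fst (\<gamma> M) (Suc n) (leaf x M), snd (\<gamma> M) n (leaf x M)))
        \<longlonglongrightarrow> (h n x, h (Suc n) x, g n x)"
      by (intro tendsto_Pair h_lim g_lim)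
    have "(fst (\<gamma> M) n (leaf x M), fst (\<gamma> M) (Suc n) (leaf x M), snd (\<gamma> M) n (leaf x M)) \<in> Ew"
      if "M \<ge> Suc n" for M
      using valid_Ew[OF val[of M], of n "leaf x M"] lvl[of n M] that by simp
    then show "\<forall>\<^sub>F M in sequentially. (fst (\<gamma> M) n (leaf x M), fst (\<gamma> M) (Suc n) (leaf x M),
        snd (\<gamma> M) n (leaf x M)) \<in> Ew"
      unfolding eventually_sequentially by blast
  qed simp
  then have "(h n x, h (Suc n) x) \<in> E" for n x unfolding E_iff by blast
  then have hE: "(h 0 x, h n x) \<in> E" for n x
    by (induction n) (auto intro: E_refl E_trans)
  show ?thesis
  proof
    show "continuous_on UNIV (h 0)"
      unfolding h_def by (intro continuous_on_coordinatewise_then_product continuous_on_leaf)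
  next
    fix n x y assume xy: "(x, y) \<in> F0 n"
    \<comment> \<open>At level \<open>lam n + 1\<close> all coordinates up to \<open>n\<close> are
      hidden, and \<open>x\<close> and \<open>y\<close> agree on the others. So they have the same
      hub there.\<close>
    let ?N = "Suc (lam n)"
    have "agree ?N (leaf x M) (leaf y M)" for M
      unfolding agree_def
    proof (intro conjI allI impI)
      fix t assume t: "t < length (leaf x M)" "?N \<le> lam (coord t)"
      have "n \<le> coord t"
      proof (rule ccontr)
        assume "\<not> n \<le> coord t"
        then have "lam (coord t) \<le> lam n" by (intro lam_mono) simp
        then show False using t(2) by simp
      qed
      then show "leaf x M ! t = leaf y M ! t"
        using xy t(1) by (auto simp: F0_def bit_def coord_def)
    qed simp
    then have "fst (\<gamma> M) ?N (leaf x M) = fst (\<gamma> M) ?N (leaf y M)" if "?N < M" for M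
      by (rule valid_fst[OF val less_imp_le[OF lvl[OF that]] length_leaf])
    then have "h ?N x i = h ?N y i" for i
      unfolding h_def by (rule fun_cong) simp
    then have "h ?N x = h ?N y" by (intro ext)
    then show "(h 0 x, h 0 y) \<in> E" using hE[of x ?N] hE[of y ?N] by (metis E_sym E_trans)
  next
    fix n k x y assume xy: "(x, y) \<notin> F0 n" and k: "k \<le> n"
    obtain l j where l: "l \<ge> n" "x l j \<noteq> y l j" using xy by (force simp: F0_def)
    define t where "t = prod_encode (l, j)"
    have t: "coord t = l" "bit x t \<noteq> bit y t" using l(2) by (simp_all add: t_def coord_def bit_def)
    have "(h 0 x, h 0 y) \<in> Ok k q" for q
    proof -
      \<comment> \<open>Stage \<open>m + 1\<close> contains the bit \<open>t\<close>, and its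
        separations cover the pair \<open>k\<close>, \<open>q\<close>.\<close>
      define m where "m = max t (max k q)"
      have "\<not> agree (lam k) (leaf x (Suc m)) (leaf y (Suc m))"
      proof
        assume "agree (lam k) (leaf x (Suc m)) (leaf y (Suc m))"
        moreover have "t < Suc m" "lam k \<le> lam (coord t)"
          using k l(1) t(1) by (auto simp: m_def intro: lam_mono)
        ultimately have "leaf x (Suc m) ! t = leaf y (Suc m) ! t" unfolding agree_def by simp
        then show False using t(2) \<open>t < Suc m\<close> by simp
      qed
      then have "separated (G (Suc m)) (k, q, leaf x (Suc m), leaf y (Suc m))"
        by (intro sep) (simp_all add: m_def)
      then obtain A B where AB: "closed A" "closed B" "A \<times> B \<subseteq> Ok k q"
        "\<And>\<delta>. \<delta> \<in> G (Suc m) \<Longrightarrow> fst \<delta> 0 (leaf x (Suc m)) \<in> A"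
        "\<And>\<delta>. \<delta> \<in> G (Suc m) \<Longrightarrow> fst \<delta> 0 (leaf y (Suc m)) \<in> B"
        unfolding separated_def prod.case by metis
      have "fst (\<gamma> M) 0 (leaf x M) \<in> A" "fst (\<gamma> M) 0 (leaf y M) \<in> B" if M: "M \<ge> Suc m" for M
      proof -
        obtain i where i: "M = Suc m + i" using le_Suc_ex[OF M] by blast
        have "desc z (Suc m) i (\<gamma> M) \<in> G (Suc m)" for z using desc \<gamma>[of M] i by simp
        from AB(4)[OF this[of x]] AB(5)[OF this[of y]]
        show "fst (\<gamma> M) 0 (leaf x M) \<in> A" "fst (\<gamma> M) 0 (leaf y M) \<in> B"
          using i by (simp_all only: desc_leaf)
      qed
      then have "\<forall>\<^sub>F M in sequentially. fst (\<gamma> M) 0 (leaf x M) \<in> A"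
        "\<forall>\<^sub>F M in sequentially. fst (\<gamma> M) 0 (leaf y M) \<in> B"
        unfolding eventually_sequentially by blast+
      then have "h 0 x \<in> A" "h 0 y \<in> B"
        using Lim_in_closed_set[OF AB(1) _ _ h_lim[of 0 x]] Lim_in_closed_set[OF AB(2) _ _ h_lim[of 0 y]]
        by simp_all
      then show ?thesis using AB(3) by blast
    qed
    then show "(h 0 x, h 0 y) \<notin> Ek k" using Ek_compl[of k] by blast
  qed
qed

end

section \<open>Exclusiveness and transfer\<close>

instance bool :: second_countable_topology
proof
  have "generate_topology UNIV U" for U :: "bool set"
    by (rule generate_topology.Basis) simp
  then have "open = generate_topology (UNIV :: bool set set)"
    by (auto simp: fun_eq_iff discrete_topology_class.open_discrete)
  then show "\<exists>B :: bool set set. countable B \<and> open = generate_topology B"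
    by (intro exI[of _ UNIV]) auto
qed

definition cantor_measure :: "(nat \<Rightarrow> bool) measure" where
  "cantor_measure = PiM UNIV (\<lambda>_. measure_pmf (bernoulli_pmf (1/2)))"

text \<open>\<open>bool\<close> is discrete and second countable, so the product sigma-algebra of
  the Cantor space is the Borel one.\<close>

lemma sets_cantor_measure: "sets cantor_measure = sets borel"
proof -
  have "sets (borel :: bool measure) = UNIV"
    using borel_open[OF discrete_topology_class.open_discrete] by auto
  then have "sets cantor_measure = sets (PiM UNIV (\<lambda>_::nat. borel :: bool measure))"
    unfolding cantor_measure_def by (intro sets_PiM_cong) auto
  then show ?thesis by (simp add: sets_PiM_equal_borel)
qed

lemma prob_space_cantor_measure: "prob_space cantor_measure"
  unfolding cantor_measure_def by (intro prob_space_PiM measure_pmf.prob_space_axioms)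

lemma singleton_borel: "{z :: nat \<Rightarrow> bool} \<in> sets borel"
proof -
  have "{z} = (\<Inter>n. cyl z n)" by (auto simp: cyl_def)
  also have "\<dots> \<in> sets borel" by (intro sets.countable_INT'') (auto intro: borel_open)
  finally show ?thesis .
qed

lemma null_countable_cantor:
  assumes "countable C"
  shows "C \<in> null_sets cantor_measure"
proof -
  interpret product_prob_space "\<lambda>_. measure_pmf (bernoulli_pmf (1/2))" "UNIV :: nat set"
    by unfold_locales
  have "emeasure cantor_measure {z} \<le> ennreal ((1/2) ^ n)" for z n
  proof -
    have sp: "space cantor_measure = UNIV" by (simp add: cantor_measure_def space_PiM)
    have eq: "cyl z n = {x\<in>space (PiM UNIV (\<lambda>_. measure_pmf (bernoulli_pmf (1/2)))). \<forall>i\<in>{..<n}. x i \<in> {z i}}"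
      by (auto simp: cyl_def space_PiM)
    have "emeasure cantor_measure {z} \<le> emeasure cantor_measure (cyl z n)"
      by (intro emeasure_mono) (auto simp: sets_cantor_measure intro: borel_open)
    also have "\<dots> = (\<Prod>i\<in>{..<n}. emeasure (measure_pmf (bernoulli_pmf (1/2))) {z i})"
      unfolding cantor_measure_def eq by (rule emeasure_PiM_Collect) auto
    also have "\<dots> = (\<Prod>i\<in>{..<n}. ennreal (1/2))"
      by (intro prod.cong refl) (auto simp: emeasure_pmf_single pmf_bernoulli_True pmf_bernoulli_False split: if_splits)
    also have "\<dots> = ennreal ((1/2) ^ n)" 
      by (simp only: prod_constant card_lessThan) (rule ennreal_power, simp)
    finally show ?thesis .
  qed
  then have "emeasure cantor_measure {z} = 0" for z
  proof -
    have "(\<lambda>n. ennreal ((1/2) ^ n)) \<longlonglongrightarrow> ennreal 0"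
      by (intro tendsto_ennrealI LIMSEQ_power_zero) auto
    then have "emeasure cantor_measure {z} \<le> ennreal 0"
      by (rule LIMSEQ_le_const) (use \<open>\<And>z n. emeasure cantor_measure {z} \<le> ennreal ((1/2) ^ n)\<close> in blast)
    then show ?thesis by simp
  qed
  then have "{z} \<in> null_sets cantor_measure" for z
    using singleton_borel by (intro null_setsI) (simp_all add: sets_cantor_measure)
  then have "(\<Union>z\<in>C. {z}) \<in> null_sets cantor_measure" by (intro null_sets_UN' assms)
  then show ?thesis by simp
qed

text \<open>By Fubini, each \<open>A n\<close> is null for the product of the coin-flipping measures.\<close>

lemma no_cover_countable_fibres:
  fixes A :: "nat \<Rightarrow> (nat \<Rightarrow> nat \<Rightarrow> bool) set"
  assumes borel: "\<And>n. A n \<in> sets borel" and cover: "(\<Union>n. A n) = UNIV"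
    and fib: "\<And>n x. countable {z. x(n := z) \<in> A n}"
  shows False
proof -
  define M :: "(nat \<Rightarrow> nat \<Rightarrow> bool) measure" where "M = PiM UNIV (\<lambda>_. cantor_measure)"
  interpret K: prob_space cantor_measure by (rule prob_space_cantor_measure)
  interpret M: prob_space M unfolding M_def by (intro prob_space_PiM prob_space_cantor_measure)
  interpret P: pair_sigma_finite cantor_measure M ..
  have "sets M = sets (PiM UNIV (\<lambda>_::nat. borel :: (nat \<Rightarrow> bool) measure))"
    unfolding M_def by (intro sets_PiM_cong) (simp_all add: sets_cantor_measure)
  then have sM: "sets M = sets borel" by (simp add: sets_PiM_equal_borel)
  have "A n \<in> null_sets M" for n
  proof (rule null_setsI)
    let ?u = "\<lambda>(z, X). (X :: nat \<Rightarrow> nat \<Rightarrow> bool)(n := z)"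
    let ?N = "cantor_measure \<Otimes>\<^sub>M M"
    have meas: "?u \<in> measurable ?N M"
      unfolding M_def case_prod_unfold by (rule measurable_fun_upd[where J = UNIV]) auto
    \<comment> \<open>Resampling coordinate \<open>n\<close> independently preserves the product
      measure.\<close>
    have D: "distr ?N M ?u = M"
      using distr_pair_PiM_eq_PiM[of UNIV "\<lambda>_. cantor_measure" n] prob_space_cantor_measure
      by (simp add: M_def)
    have S: "?u -` A n \<inter> space ?N \<in> sets ?N"
      by (rule measurable_sets[OF meas]) (simp add: sM borel)
    have "emeasure M (A n) = emeasure (distr ?N M ?u) (A n)" by (simp add: D)
    also have "\<dots> = emeasure ?N (?u -` A n \<inter> space ?N)"
      by (rule emeasure_distr[OF meas]) (simp add: sM borel)
    also have "\<dots> = (\<integral>\<^sup>+X. emeasure cantor_measure ((\<lambda>z. (z, X)) -` (?u -` A n \<inter> space ?N)) \<partial>M)"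
      by (rule P.emeasure_pair_measure_alt2[OF S])
    also have "\<dots> = (\<integral>\<^sup>+X. 0 \<partial>M)"
    proof (rule nn_integral_cong)
      fix X
      have "countable ((\<lambda>z. (z, X)) -` (?u -` A n \<inter> space ?N))"
        by (rule countable_subset[OF _ fib[of X n]]) auto
      then show "emeasure cantor_measure ((\<lambda>z. (z, X)) -` (?u -` A n \<inter> space ?N)) = 0"
        using null_countable_cantor by (simp add: null_sets_def)
    qed
    finally show "emeasure M (A n) = 0" by simp
  qed (simp add: sM borel)
  then have "(\<Union>n. A n) \<in> null_sets M" by (rule null_sets_UN)
  then have "emeasure M UNIV = 0" by (simp add: cover null_sets_def)
  moreover have "space M = UNIV" using sets_eq_imp_space_eq[OF sM] by simp
  ultimately show False using M.emeasure_space_1 by simp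
qed

lemma topspace_eq_of_borel_sets:
  assumes "borel_sets_in Y = borel_sets_in X"
  shows "topspace Y = topspace X"
proof -
  have "topspace T \<in> borel_sets_in T" for T :: "'a topology" by (intro openin_borel_sets_in) simp
  then show ?thesis using assms borel_sets_in_subset by (metis subset_antisym)
qed

text \<open>Arguments that differ only in coordinate \<open>n\<close> have values in one
  \<open>E\<close>-class but in pairwise distinct \<open>En n\<close>-classes. As \<open>E\<close>
  has countable index over \<open>En n\<close> on \<open>B n\<close>, only countably many of these
  values lie in \<open>B n\<close>: its preimage has countable fibres in coordinate
  \<open>n\<close>.\<close>

lemma alternatives_exclusive:
  fixes X :: "'a topology" and E :: "'a rel" and En :: "nat \<Rightarrow> 'a rel" and B :: "nat \<Rightarrow> 'a set"
  assumes eq: "\<And>n. equiv (topspace X) (En n)"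
    and B: "(\<Union>n. B n) = topspace X" "\<And>n. B n \<in> borel_sets_in X" "\<And>n. countable_index_on E (En n) (B n)"
    and \<phi>: "continuous_map euclidean X \<phi>" "homomorphism \<phi> E1 E"
      "\<And>n. homomorphism \<phi> (- F0 n) (topspace X \<times> topspace X - (\<Union>i\<le>n. En i))"
  shows False
proof (rule no_cover_countable_fibres)
  show "\<phi> -` B n \<in> sets borel" for n
    using borel_sets_in_vimage[OF \<phi>(1) B(2)] by (simp add: borel_sets_in_euclidean vimage_def)
  show "(\<Union>n. \<phi> -` B n) = UNIV"
    using \<phi>(1) B(1) by (auto simp: continuous_map_def vimage_UN[symmetric])
  fix n and x :: "nat \<Rightarrow> nat \<Rightarrow> bool"
  show "countable {z. x(n := z) \<in> \<phi> -` B n}"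
  proof (cases "{z. x(n := z) \<in> \<phi> -` B n} = {}")
    case False
    then obtain z0 where z0: "\<phi> (x(n := z0)) \<in> B n" by auto
    have "restrict_rel E (B n) `` {\<phi> (x(n := z0))} \<in> B n // restrict_rel E (B n)"
      using z0 by (rule quotientI)
    then obtain D where D: "countable D" "D \<subseteq> B n // restrict_rel (En n) (B n)"
      "restrict_rel E (B n) `` {\<phi> (x(n := z0))} = \<Union>D"
      using B(3)[of n] unfolding countable_index_on_def by metis
    have "\<exists>d\<in>D. \<phi> (x(n := z)) \<in> d" if "\<phi> (x(n := z)) \<in> B n" for z
    proof -
      have "(x(n := z0), x(n := z)) \<in> E1"
        unfolding E1_def F0_def by (intro UN_I[of "Suc n"]) auto
      then have "(\<phi> (x(n := z0)), \<phi> (x(n := z))) \<in> E"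
        using \<phi>(2) unfolding homomorphism_def by force
      then have "\<phi> (x(n := z)) \<in> restrict_rel E (B n) `` {\<phi> (x(n := z0))}"
        using z0 that by (simp add: restrict_rel_def)
      then show ?thesis unfolding D(3) by blast
    qed
    then have "\<forall>z. \<exists>d. \<phi> (x(n := z)) \<in> B n \<longrightarrow> d \<in> D \<and> \<phi> (x(n := z)) \<in> d" by blast
    then obtain d where d: "\<And>z. \<phi> (x(n := z)) \<in> B n \<Longrightarrow> d z \<in> D \<and> \<phi> (x(n := z)) \<in> d z" by metis
    have "inj_on d {z. x(n := z) \<in> \<phi> -` B n}"
    proof (rule inj_onI; rule ccontr)
      fix z z' assume z: "z \<in> {z. x(n := z) \<in> \<phi> -` B n}" "z' \<in> {z. x(n := z) \<in> \<phi> -` B n}"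
        and dz: "d z = d z'" and ne: "z \<noteq> z'"
      obtain b where "d z = restrict_rel (En n) (B n) `` {b}"
        using d[of z] z(1) D(2) by (auto elim!: quotientE)
      then have "(b, \<phi> (x(n := z))) \<in> En n" "(b, \<phi> (x(n := z'))) \<in> En n"
        using d[of z] d[of z'] z dz by (auto simp: restrict_rel_def)
      then have "(\<phi> (x(n := z)), \<phi> (x(n := z'))) \<in> En n"
        using eq[of n] by (meson equivE symD transD)
      moreover have "(x(n := z), x(n := z')) \<in> - F0 n" using ne by (auto simp: F0_def)
      then have "(\<phi> (x(n := z)), \<phi> (x(n := z'))) \<notin> (\<Union>i\<le>n. En i)"
        using \<phi>(3)[of n] unfolding homomorphism_def by force
      ultimately show False by blast
    qed
    moreover have "countable (d ` {z. x(n := z) \<in> \<phi> -` B n})"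
      by (rule countable_subset[OF _ D(1)]) (use d in auto)
    ultimately show ?thesis by (rule countable_image_inj_on[rotated])
  qed simp
qed

section \<open>Transfer to an arbitrary Polish space\<close>

lemma dichotomy_exists:
  fixes X :: "'a topology" and E :: "'a rel" and En :: "nat \<Rightarrow> 'a rel"
  assumes X: "polish X" "topspace X \<noteq> {}"
    and E: "equiv (topspace X) E" "analytic_in (prod_topology X X) E"
    and En: "\<And>n. equiv (topspace X) (En n)" "\<And>n. En n \<subseteq> E" "\<And>n. potentially_fsigma X (En n)"
  shows "(\<exists>B :: nat \<Rightarrow> 'a set. (\<Union>n. B n) = topspace X \<and>
         (\<forall>n. B n \<in> borel_sets_in X \<and> invariant_set (En n) (B n) \<and> countable_index_on E (En n) (B n))) \<or>
    (\<exists>\<phi>. continuous_map euclidean X \<phi> \<and> homomorphism \<phi> E1 E \<and>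
         (\<forall>n. homomorphism \<phi> (- F0 n) (topspace X \<times> topspace X - (\<Union>i\<le>n. En i))))"
proof -
  have H: "Hausdorff_space X" by (rule polish_Hausdorff[OF X(1)])
  have "\<forall>k. \<exists>Y. polish Y \<and> borel_sets_in Y = borel_sets_in X \<and> fsigma_in (prod_topology Y Y) (En k)"
    using En(3) unfolding potentially_fsigma_def by blast
  then obtain Y where Y: "\<And>k. polish (Y k)" "\<And>k. borel_sets_in (Y k) = borel_sets_in X"
    "\<And>k. fsigma_in (prod_topology (Y k) (Y k)) (En k)" by metis
  have top: "topspace (Y k) = topspace X" for k by (rule topspace_eq_of_borel_sets[OF Y(2)])
  have "\<forall>k. \<exists>C :: nat \<Rightarrow> _. (\<forall>q. closedin (prod_topology (Y k) (Y k)) (C q)) \<and> (\<Union>q. C q) = En k"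
    using Y(3) unfolding fsigma_in_ascending by metis
  then obtain C :: "nat \<Rightarrow> nat \<Rightarrow> 'a rel" where
    C: "\<And>k q. closedin (prod_topology (Y k) (Y k)) (C k q)" "\<And>k. (\<Union>q. C k q) = En k" by metis
  have "\<forall>k. \<exists>\<B>. countable \<B> \<and> (\<forall>V\<in>\<B>. openin (Y k) V) \<and>
      (\<forall>U x. openin (Y k) U \<and> x \<in> U \<longrightarrow> (\<exists>V\<in>\<B>. x \<in> V \<and> V \<subseteq> U))"
    using polish_second_countable[OF Y(1)] unfolding second_countable_def by blast
  then obtain \<B> where \<B>: "\<And>k. countable (\<B> k)" "\<And>k V. V \<in> \<B> k \<Longrightarrow> openin (Y k) V"
    "\<And>k U x. openin (Y k) U \<Longrightarrow> x \<in> U \<Longrightarrow> \<exists>V\<in>\<B> k. x \<in> V \<and> V \<subseteq> U" by metis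
  \<comment> \<open>Bases of all the topologies \<open>Y k\<close> in a single sequence; the added
    \<open>{}\<close> keeps each enumerated family nonempty.\<close>
  define U where "U i = (case prod_decode i of (k, j) \<Rightarrow> from_nat_into (insert {} (\<B> k)) j)" for i
  have "U i \<in> borel_sets_in X" for i
  proof (cases "prod_decode i")
    case (Pair k j)
    then have "U i \<in> insert {} (\<B> k)" 
      unfolding U_def using from_nat_into[of "insert {} (\<B> k)" j] by simp
    then have "openin (Y k) (U i)" using \<B>(2) by auto
    then show ?thesis using openin_borel_sets_in Y(2) by blast
  qed
  then obtain p :: "baire \<Rightarrow> 'a" where p: "continuous_map euclidean X p" "range p = topspace X"
    "\<And>i. open {z. p z \<in> U i}" using baire_surjection_open_vimages[OF X] by metis
  have pX: "p a \<in> topspace X" for a using p(2) by blast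
  have openB: "open {z. p z \<in> V}" if "V \<in> \<B> k" for k V
  proof -
    obtain j where "from_nat_into (insert {} (\<B> k)) j = V"
      using from_nat_into_surj[of "insert {} (\<B> k)" V] \<B>(1) \<open>V \<in> \<B> k\<close> by auto
    then have "U (prod_encode (k, j)) = V" by (simp add: U_def)
    then show ?thesis using p(3) by metis
  qed
  have "E \<noteq> {}" using X(2) E(1) by (auto simp: equiv_def refl_on_def)
  then obtain g :: "baire \<Rightarrow> 'a \<times> 'a" where
    g: "continuous_map euclidean (prod_topology X X) g" "range g = E"
    using analytic_in_imp_analytic[OF E(2)] unfolding analytic_def by auto
  define E' where "E' = {(a, b). (p a, p b) \<in> E}"
  define Ek where "Ek k = {(a, b). (p a, p b) \<in> En k}" for k
  define Ok where "Ok k q = {(a, b). (p a, p b) \<notin> C k q}" for k q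
  define Ew where "Ew = {(a, b, w). p a = fst (g w) \<and> p b = snd (g w)}"
  interpret baire_relations E' Ew Ek Ok
  proof
    have *: "equiv UNIV {(a, b). (p a, p b) \<in> R}" if "equiv (topspace X) R" for R
      using that pX by (intro equivI refl_onI symI transI) (auto elim!: equivE dest: refl_onD symD transD)
    show "equiv UNIV E'" "equiv UNIV (Ek k)" for k
      unfolding E'_def Ek_def by (intro * E(1) En(1))+
    have co: "continuous_map euclidean X (\<lambda>t. p (f t))" if "continuous_on UNIV f" for f :: "baire \<times> baire \<times> baire \<Rightarrow> baire"
      using continuous_map_compose[OF _ p(1), of euclidean f] that by (simp add: o_def)
    have cg: "continuous_map euclidean X (\<lambda>t::baire \<times> baire \<times> baire. fst (g (snd (snd t))))"
      "continuous_map euclidean X (\<lambda>t::baire \<times> baire \<times> baire. snd (g (snd (snd t))))"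
    proof -
      have "continuous_map euclidean (prod_topology X X) (g \<circ> (\<lambda>t::baire \<times> baire \<times> baire. snd (snd t)))"
        by (rule continuous_map_compose[OF _ g(1)]) (simp, intro continuous_intros)
      then show "continuous_map euclidean X (\<lambda>t::baire \<times> baire \<times> baire. fst (g (snd (snd t))))"
        "continuous_map euclidean X (\<lambda>t::baire \<times> baire \<times> baire. snd (g (snd (snd t))))"
        using continuous_map_compose[OF _ continuous_map_fst] continuous_map_compose[OF _ continuous_map_snd]
        by (fastforce simp: o_def)+
    qed
    have "Ew = {t. p (fst t) = fst (g (snd (snd t)))} \<inter> {t. p (fst (snd t)) = snd (g (snd (snd t)))}"
      by (auto simp: Ew_def)
    also have "closed \<dots>"
    proof (rule closed_Int)
      show "closed {t :: baire \<times> baire \<times> baire. p (fst t) = fst (g (snd (snd t)))}"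
        using closedin_continuous_maps_eq[OF H co[OF continuous_on_fst[OF continuous_on_id]] cg(1)] by simp
      show "closed {t :: baire \<times> baire \<times> baire. p (fst (snd t)) = snd (g (snd (snd t)))}"
        using closedin_continuous_maps_eq[OF H co[OF continuous_on_fst[OF continuous_on_snd[OF continuous_on_id]]] cg(2)]
        by simp
    qed
    finally show "closed Ew" .
    show "(a, b) \<in> E' \<longleftrightarrow> (\<exists>w. (a, b, w) \<in> Ew)" for a b
    proof
      assume "(a, b) \<in> E'"
      then have "(p a, p b) \<in> range g" using g(2) by (simp add: E'_def)
      then obtain w where "g w = (p a, p b)" by (metis imageE)
      then show "\<exists>w. (a, b, w) \<in> Ew" by (intro exI[of _ w]) (simp add: Ew_def)
    next
      assume "\<exists>w. (a, b, w) \<in> Ew"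
      then obtain w where "g w = (p a, p b)" by (auto simp: Ew_def prod_eq_iff)
      then show "(a, b) \<in> E'" using g(2) by (metis (mono_tags, lifting) E'_def case_prodI mem_Collect_eq rangeI)
    qed
    show "Ek k \<subseteq> E'" for k using En(2) by (auto simp: Ek_def E'_def)
    show "- Ek k = (\<Inter>q. Ok k q)" for k using C(2)[of k] by (auto simp: Ek_def Ok_def)
    \<comment> \<open>Continuity of \<open>p\<close> refers to \<open>X\<close>, while
      \<open>C k q\<close> is closed for \<open>Y k\<close>; the basic sets of \<open>Y k\<close>
      have open preimages by the choice of \<open>p\<close>.\<close>
    show "open (Ok k q)" for k q
      unfolding open_prod_def
    proof (intro ballI)
      fix t assume "t \<in> Ok k q"
      then obtain a b where t: "t = (a, b)" "(p a, p b) \<notin> C k q" by (auto simp: Ok_def)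
      have "openin (prod_topology (Y k) (Y k)) (topspace (prod_topology (Y k) (Y k)) - C k q)"
        using C(1) by blast
      moreover have "(p a, p b) \<in> topspace (prod_topology (Y k) (Y k)) - C k q"
        using t pX by (simp add: top)
      ultimately obtain V W where VW: "openin (Y k) V" "openin (Y k) W" "p a \<in> V" "p b \<in> W"
        "V \<times> W \<subseteq> topspace (prod_topology (Y k) (Y k)) - C k q"
        unfolding openin_prod_topology_alt by metis
      obtain V' where V': "V' \<in> \<B> k" "p a \<in> V'" "V' \<subseteq> V" using \<B>(3)[OF VW(1,3)] by blast
      obtain W' where W': "W' \<in> \<B> k" "p b \<in> W'" "W' \<subseteq> W" using \<B>(3)[OF VW(2,4)] by blast
      have "{z. p z \<in> V'} \<times> {z. p z \<in> W'} \<subseteq> Ok k q"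
        using VW(5) V'(3) W'(3) by (auto simp: Ok_def)
      then show "\<exists>A B. open A \<and> open B \<and> t \<in> A \<times> B \<and> A \<times> B \<subseteq> Ok k q"
        using openB[OF V'(1)] openB[OF W'(1)] V'(2) W'(2) t(1)
        by (intro exI[of _ "{z. p z \<in> V'}"] exI[of _ "{z. p z \<in> W'}"]) simp
    qed
  qed
  show ?thesis
  proof (cases "index_ideal UNIV")
    case True
    then obtain B' where B': "\<And>n. B' n \<in> sets borel" "\<And>n. invariant_set (Ek n) (B' n)"
      "\<And>n. countable_index n (B' n)" "UNIV = (\<Union>n. B' n)"
      unfolding index_ideal_def by (metis top.extremum_unique)
    \<comment> \<open>With reflexivity of \<open>En n\<close>, this applies to two codes of the same
      point: \<open>B' n\<close> is a union of fibres of \<open>p\<close>.\<close>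
    have sat: "a \<in> B' n" if "b \<in> B' n" "(p b, p a) \<in> En n" for a b n
      using B'(2)[of n] that unfolding invariant_set_def Ek_def by blast
    have refl: "(x, x) \<in> En n" if "x \<in> topspace X" for x n
      using En(1)[of n] that by (auto simp: equiv_def refl_on_def)
    have "p ` B' n \<in> borel_sets_in X" for n
    proof -
      \<comment> \<open>These two images are disjoint, analytic and cover the space, so a Borel set
        separating them equals the first one.\<close>
      have an: "analytic X (p ` B' n)" "analytic X (p ` (- B' n))"
        by (intro analytic_continuous_image[OF _ p(1)] analytic_of_borel completely_metrizable_baire
            B'(1) borel_comp)+
      have "p ` B' n \<inter> p ` (- B' n) = {}"
        using sat refl pX by fastforce
      then obtain S where S: "S \<in> borel_sets_in X" "p ` B' n \<subseteq> S" "S \<inter> p ` (- B' n) = {}"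
        using lusin_separation[OF H an] unfolding borel_separated_def by blast
      have "S \<subseteq> p ` B' n"
      proof
        fix x assume x: "x \<in> S"
        then have "x \<in> range p" using borel_sets_in_subset[OF S(1)] p(2) by blast
        then obtain a where "x = p a" by blast
        then show "x \<in> p ` B' n" using x S(3) by blast
      qed
      then show ?thesis using S by (metis subset_antisym)
    qed
    moreover have "invariant_set (En n) (p ` B' n)" for n unfolding invariant_set_def
    proof (intro allI impI)
      fix x y assume "x \<in> p ` B' n" and xy: "(x, y) \<in> En n"
      then obtain b where b: "b \<in> B' n" "x = p b" by blast
      have "y \<in> topspace X" using En(1)[of n] xy by (auto simp: equiv_def refl_on_def)
      then obtain a where "y = p a" using p(2) by blast
      then show "y \<in> p ` B' n" using sat[OF b(1), of a] xy b(2) by simp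
    qed
    moreover have "countable_index_on E (En n) (p ` B' n)" for n unfolding countable_index_on_def
    proof
      let ?B = "p ` B' n"
      let ?F = "restrict_rel (En n) ?B"
      fix D assume "D \<in> ?B // restrict_rel E ?B"
      then obtain a where a: "a \<in> B' n" "D = restrict_rel E ?B `` {p a}" by (auto elim!: quotientE)
      obtain f :: "nat \<Rightarrow> baire" where f: "\<And>y. y \<in> B' n \<Longrightarrow> (a, y) \<in> E' \<Longrightarrow> \<exists>i. (f i, y) \<in> Ek n"
        using B'(3)[of n] unfolding countable_index_def by blast
      have DB: "D \<subseteq> ?B" using a(2) by (auto simp: restrict_rel_def)
      \<comment> \<open>The representatives \<open>f i\<close> may code points outside
        \<open>?B\<close>, so the classes are enumerated by the traces of their
        \<open>En n\<close>-classes on \<open>?B\<close>.\<close>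
      define T where "T i = {c \<in> ?B. (p (f i), c) \<in> En n}" for i
      have cls: "\<exists>i. ?F `` {c} = T i" if c: "c \<in> D" for c
      proof -
        obtain y where y: "y \<in> B' n" "c = p y" "(p a, p y) \<in> E"
          using c a(2) by (auto simp: restrict_rel_def)
        then obtain i where "(p (f i), c) \<in> En n" using f[of y] by (auto simp: E'_def Ek_def)
        then have "(c, c') \<in> En n \<longleftrightarrow> (p (f i), c') \<in> En n" for c'
          using En(1)[of n] by (meson equivE symD transD)
        then have "?F `` {c} = T i" using y(1,2) by (auto simp: restrict_rel_def T_def)
        then show ?thesis ..
      qed
      show "\<exists>\<D>. countable \<D> \<and> \<D> \<subseteq> ?B // ?F \<and> D = \<Union>\<D>"
      proof (intro exI[of _ "(\<lambda>c. ?F `` {c}) ` D"] conjI)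
        have "(\<lambda>c. ?F `` {c}) ` D \<subseteq> range T"
          by (rule image_subsetI) (metis cls rangeI)
        then show "countable ((\<lambda>c. ?F `` {c}) ` D)" by (rule countable_subset) simp
        show "(\<lambda>c. ?F `` {c}) ` D \<subseteq> ?B // ?F" using DB by (auto intro: quotientI)
        show "D = \<Union>((\<lambda>c. ?F `` {c}) ` D)"
        proof (intro equalityI subsetI)
          fix c assume c: "c \<in> D"
          then have "c \<in> ?F `` {c}" using DB refl pX by (auto simp: restrict_rel_def)
          then show "c \<in> \<Union>((\<lambda>c. ?F `` {c}) ` D)" using c by blast
        next
          fix c' assume "c' \<in> \<Union>((\<lambda>c. ?F `` {c}) ` D)"
          then obtain c where c: "c \<in> D" "(c, c') \<in> En n" "c' \<in> ?B" by (auto simp: restrict_rel_def)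
          then have "(p a, c) \<in> E" "(c, c') \<in> E" using a(2) En(2) by (auto simp: restrict_rel_def)
          then have "(p a, c') \<in> E" using E(1) by (meson equivE transD)
          then show "c' \<in> D" using a c(3) by (auto simp: restrict_rel_def)
        qed
      qed
    qed
    moreover have "(\<Union>n. p ` B' n) = topspace X"
      using p(2) B'(4) by (metis image_UN)
    ultimately show ?thesis by (intro disjI1 exI[of _ "\<lambda>n. p ` B' n"]) simp
  next
    case False
    then obtain \<phi> :: "(nat \<Rightarrow> nat \<Rightarrow> bool) \<Rightarrow> baire" where \<phi>: "continuous_on UNIV \<phi>"
      "\<And>n x y. (x, y) \<in> F0 n \<Longrightarrow> (\<phi> x, \<phi> y) \<in> E'"
      "\<And>n k x y. (x, y) \<notin> F0 n \<Longrightarrow> k \<le> n \<Longrightarrow> (\<phi> x, \<phi> y) \<notin> Ek k"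
      using baire_homomorphism by metis
    have "continuous_map euclidean X (p \<circ> \<phi>)"
      using \<phi>(1) by (intro continuous_map_compose[OF _ p(1)]) simp
    moreover have "homomorphism (p \<circ> \<phi>) E1 E"
      unfolding homomorphism_def E1_def using \<phi>(2) by (auto simp: E'_def)
    moreover have "homomorphism (p \<circ> \<phi>) (- F0 n) (topspace X \<times> topspace X - (\<Union>i\<le>n. En i))" for n
      unfolding homomorphism_def using \<phi>(3)[of _ _ n] pX by (auto simp: Ek_def)
    ultimately show ?thesis by (intro disjI2 exI[of _ "p \<circ> \<phi>"]) simp
  qed
qed

theorem theorem6p4:
  fixes X :: "'a topology" and E :: "'a rel" and En :: "nat \<Rightarrow> 'a rel"
  assumes "polish X"
    and "equiv (topspace X) E"
    and "analytic_in (prod_topology X X) E"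
    and "\<And>n. equiv (topspace X) (En n)"
    and "\<And>n. En n \<subseteq> E"
    and "\<And>n. potentially_fsigma X (En n)"
  defines "alternative1 \<equiv>
      (\<exists>B :: nat \<Rightarrow> 'a set. (\<Union>n. B n) = topspace X \<and>
         (\<forall>n. B n \<in> borel_sets_in X \<and> invariant_set (En n) (B n) \<and>
              countable_index_on E (En n) (B n)))"
    and "alternative2 \<equiv> (\<lambda>\<phi> :: (nat \<Rightarrow> nat \<Rightarrow> bool) \<Rightarrow> 'a.
         continuous_map euclidean X \<phi> \<and> homomorphism \<phi> E1 E \<and>
         (\<forall>n. homomorphism \<phi> (- F0 n) (topspace X \<times> topspace X - (\<Union>i\<le>n. En i))))"
  shows "(alternative1 \<or> (\<exists>\<phi>. alternative2 \<phi>)) \<and> \<not> (alternative1 \<and> (\<exists>\<phi>. alternative2 \<phi>)) \<and>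
         (E = (\<Union>n. En n) \<longrightarrow> (\<forall>\<phi>. alternative2 \<phi> \<longrightarrow> rel_embedding \<phi> E1 E))"
proof (intro conjI impI allI)
  show "alternative1 \<or> (\<exists>\<phi>. alternative2 \<phi>)"
  proof (cases "topspace X = {}")
    case True
    \<comment> \<open>The coding needs a nonempty space; the empty one is covered by empty
      sets.\<close>
    then have alternative1 unfolding alternative1_def
      by (intro exI[of _ "\<lambda>_. {}"])
        (auto simp: invariant_set_def countable_index_on_def quotient_def openin_borel_sets_in)
    then show ?thesis ..
  next
    case False
    then show ?thesis unfolding alternative1_def alternative2_def
      using dichotomy_exists[OF assms(1) _ assms(2-6)] by simp
  qed
  show "\<not> (alternative1 \<and> (\<exists>\<phi>. alternative2 \<phi>))"
  proof
    assume "alternative1 \<and> (\<exists>\<phi>. alternative2 \<phi>)"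
    then obtain B \<phi> where "(\<Union>n. B n) = topspace X" "\<And>n. B n \<in> borel_sets_in X"
      "\<And>n. countable_index_on E (En n) (B n)" "continuous_map euclidean X \<phi>" "homomorphism \<phi> E1 E"
      "\<And>n. homomorphism \<phi> (- F0 n) (topspace X \<times> topspace X - (\<Union>i\<le>n. En i))"
      unfolding alternative1_def alternative2_def by metis
    then show False by (rule alternatives_exclusive[OF assms(4)])
  qed
next
  fix \<phi> assume E: "E = (\<Union>n. En n)" and "alternative2 \<phi>"
  then have \<phi>: "continuous_map euclidean X \<phi>" "homomorphism \<phi> E1 E"
    "\<And>n. homomorphism \<phi> (- F0 n) (topspace X \<times> topspace X - (\<Union>i\<le>n. En i))"
    unfolding alternative2_def by blast+
  have non: "(\<phi> x, \<phi> y) \<notin> En n" if "(x, y) \<notin> F0 n" for x y n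
  proof -
    have "(\<phi> x, \<phi> y) \<in> map_prod \<phi> \<phi> ` (- F0 n)" using that by (intro image_eqI[of _ _ "(x, y)"]) auto
    then have "(\<phi> x, \<phi> y) \<in> topspace X \<times> topspace X - (\<Union>i\<le>n. En i)"
      by (rule subsetD[OF \<phi>(3)[of n, unfolded homomorphism_def]])
    then show ?thesis by auto
  qed
  have top: "\<phi> x \<in> topspace X" for x using \<phi>(1) by (auto simp: continuous_map_def)
  show "rel_embedding \<phi> E1 E" unfolding rel_embedding_def
  proof (intro conjI allI iffI)
    show "inj \<phi>"
    proof (rule injI; rule ccontr)
      fix x y assume eq: "\<phi> x = \<phi> y" and "x \<noteq> y"
      \<comment> \<open>\<open>F0 0\<close> is equality, so distinct arguments have
        \<open>En 0\<close>-inequivalent values.\<close>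
      then have "(x, y) \<notin> F0 0" by (auto simp: F0_def)
      then have "(\<phi> x, \<phi> y) \<notin> En 0" by (rule non)
      then show False using eq top assms(4)[of 0] by (auto simp: equiv_def refl_on_def)
    qed
    fix x y
    show "(\<phi> x, \<phi> y) \<in> E" if "(x, y) \<in> E1"
      using \<phi>(2) that unfolding homomorphism_def by force
    show "(x, y) \<in> E1" if "(\<phi> x, \<phi> y) \<in> E"
      using that non unfolding E E1_def by blast
  qed
qed

end
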